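(* Let $k\ge3$ and let $G$ be the infinite $k$-regular tree. If $R_n\ll\log n$, then the MSPRT $(D_n,T_n)$ is asymptotically optimal, i.e. $\max_{v\in V_n}\mathbb E_v[T_n]\approx_{n,\alpha}T^*(V_n,R_n,\alpha)$, and $$T^*(V_n,R_n,\alpha)\ \approx_{n,\alpha}\ \frac{\log\log n}{\log(k-1)}.$$
   Context: Graph. $V$ is the vertex set of $G$, $d(\cdot,\cdot)$ is the shortest-path distance, and for $v\in V$ and an integer $t\ge 0$, $\mathcal N_v(t)=\{w\in V: d(v,w)\le t\}$. A vertex $v_0$ is fixed, and for each $n$, $V_n\subset V$ is a set of $n$ vertices that is a neighborhood of $v_0$, i.e. $V_n$ consists of $n$ vertices closest to $v_0$ (ties broken arbitrarily). Observations. $Q_0,Q_1$ are two distinct mutually absolutely continuous probability measures on $\mathbb R$. Under $\mathbb P_v$ (the law when $v$ is the cascade source, with expectation $\mathbb E_v$), the public states $\{y_u(t)\}_{u\in V,\,t\ge 0}$ (with $t$ integer) are independent, with $y_u(t)\sim Q_1$ if $u\in\mathcal N_v(t)$ and $y_u(t)\sim Q_0$ if $u\notin\mathcal N_v(t)$. Write $y(t)=\{y_u(t)\}_{u\in V}$. Sequential estimators. A sequential estimator is a pair $(D,T)$ where $T$ is a stopping time with respect to the filtration generated by $y(0),y(1),\dots$ and $D=\{D(t)\}_{t\ge0}$ is a sequence of estimators with $D(t)\in V_n$ depending only on $y(0),\dots,y(t)$. Its output is $D(T)$. For a positive integer $R$ (confidence radius) and $\alpha\in(0,1)$, $$\Delta_G(V_n,R,\alpha)=\Big\{(D,T):\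 \max_{u,v\in V_n:\ d(u,v)>R}\mathbb P_v(D(T)=u)\le \alpha/n\Big\}.$$ $(R_n)$ is a sequence of positive integers, and $$T^*(V_n,R_n,\alpha)=\min_{(D,T)\in\Delta_G(V_n,R_n,\alpha)}\ \max_{v\in V_n}\mathbb E_v[T]$$ (read as an infimum if not attained). Log-likelihood ratios. For $u,v\in V$ and integer $t\ge0$, $$Z_{vu}(t)=\sum_{s=0}^t\Big(\sum_{w\in\mathcal N_v(s)\setminus\mathcal N_u(s)}\log\frac{dQ_1}{dQ_0}(y_w(s))+\sum_{w\in\mathcal N_u(s)\setminus\mathcal N_v(s)}\log\frac{dQ_0}{dQ_1}(y_w(s))\Big).$$ MSPRT (matrix sequential probability ratio test). For $v\in V_n$ let $T_v=\min\{t\ge0:\ \min_{u\in V_n\setminus\mathcal N_v(R_n)}Z_{vu}(t)\ge\log(n/\alpha)\}$. The MSPRT is the pair $(D_n,T_n)$ with $T_n=\min_{v\in V_n}T_v$ and $D_n(t)=\arg\max_{v\in V_n}\min_{u\in V_n\setminus\mathcal N_v(R_n)}Z_{vu}(t)$, so that $D_n(T_n)=\arg\min_{v\in V_n}T_v$. Asymptotics. $a_n\ll b_n$ means $a_n/b_n\to0$ as $n\to\infty$. $g\gtrsim_{n,\alpha}h$ means $\liminf_{\alpha\to0}\liminf_{n\to\infty}g(n,\alpha)/h(n,\alpha)\ge1$; $g\lesssim_{n,\alpha}h$ means $\limsup_{\alpha\to0}\limsup_{n\to\infty}g(n,\alpha)/h(n,\alpha)\le1$; $g\approx_{n,\alpha}h$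 means both.
   Formalization: The formal statement additionally assumes that the Kullback–Leibler divergence D(Q_1||Q_0) = E_{Q_1}[log dQ_1/dQ_0] is finite; without it the claim is false, since heavy-tailed log-likelihood ratios allow T* = o(log log n). *)

theory Defs
  imports
    "HOL-Probability.Probability"
    "Graph_Theory.Pair_Digraph"
    "Graph_Theory.Digraph_Component"
    "Graph_Theory.Shortest_Path"
begin

section \<open>Graphs\<close>

text \<open>
  Simple undirected graphs, finite or infinite, are loop-free symmetric digraphs without
  parallel arcs (locale \<^locale>\<open>pair_bidirected_digraph\<close>). An undirected edge is a pair of
  opposite arcs, so \<open>u, v, u\<close> is a cycle in the sense of \<^const>\<open>pre_digraph.cycle\<close> and
  \<^const>\<open>forest\<close> and \<^const>\<open>tree\<close> are not the undirected notions. The cycles of the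
  undirected graph are those of length at least 3.
\<close>

definition undirected_tree :: "'a pair_pre_digraph \<Rightarrow> bool" where
  "undirected_tree G \<longleftrightarrow>
     pair_bidirected_digraph G \<and>
     Digraph_Component.connected (with_proj G) \<and>
     \<not> (\<exists>p. pre_digraph.cycle (with_proj G) p \<and> length p \<ge> 3)"

definition infinite_regular_tree :: "nat \<Rightarrow> 'a pair_pre_digraph \<Rightarrow> bool" where
  "infinite_regular_tree k G \<longleftrightarrow>
     undirected_tree G \<and> infinite (pverts G) \<and>
     (\<forall>v\<in>pverts G. out_degree (with_proj G) v = k)"

definition gdist :: "'a pair_pre_digraph \<Rightarrow> 'a \<Rightarrow> 'a \<Rightarrow> ereal" where
  "gdist G u v = wf_digraph.\<mu> (with_proj G) (\<lambda>_. 1) u v"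

definition nbhd :: "'a pair_pre_digraph \<Rightarrow> 'a \<Rightarrow> nat \<Rightarrow> 'a set" where
  "nbhd G v t = {w \<in> pverts G. gdist G v w \<le> ereal (real t)}"

definition closest_vertices :: "'a pair_pre_digraph \<Rightarrow> 'a \<Rightarrow> nat \<Rightarrow> 'a set \<Rightarrow> bool" where
  "closest_vertices G v0 n V \<longleftrightarrow>
     V \<subseteq> pverts G \<and> finite V \<and> card V = n \<and>
     (\<forall>u\<in>V. \<forall>w\<in>pverts G - V. gdist G v0 u \<le> gdist G v0 w)"

section \<open>Observations\<close>

text \<open>
  \<open>P v\<close> is the law when \<open>v\<close> is the source; all these laws live on the measurable space
  underlying \<open>M\<close>, whose own measure plays no role. The state of vertex \<open>u\<close> at time \<open>t\<close>
  is the random variable \<open>y u t\<close>.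
\<close>

definition cascade_observations ::
  "'a pair_pre_digraph \<Rightarrow> real measure \<Rightarrow> real measure \<Rightarrow> 'w measure \<Rightarrow> ('a \<Rightarrow> 'w measure) \<Rightarrow>
    ('a \<Rightarrow> nat \<Rightarrow> 'w \<Rightarrow> real) \<Rightarrow> bool" where
  "cascade_observations G Q0 Q1 M P y \<longleftrightarrow>
     (\<forall>v\<in>pverts G.
        prob_space (P v) \<and> sets (P v) = sets M \<and>
        prob_space.indep_vars (P v) (\<lambda>_. borel) (\<lambda>(u, t). y u t) (pverts G \<times> UNIV) \<and>
        (\<forall>u\<in>pverts G. \<forall>t. distr (P v) borel (y u t) = (if u \<in> nbhd G v t then Q1 else Q0)))"

text \<open>
  Stopping times may be infinite, hence time ranges over \<^typ>\<open>enat\<close>; at \<open>\<infinity>\<close> the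
  filtration is generated by all observations.
\<close>

definition obs_filtration ::
  "'a pair_pre_digraph \<Rightarrow> 'w measure \<Rightarrow> ('a \<Rightarrow> nat \<Rightarrow> 'w \<Rightarrow> real) \<Rightarrow> enat \<Rightarrow> 'w measure" where
  "obs_filtration G M y t = sigma (space M)
     {y u s -` B \<inter> space M | u s B. u \<in> pverts G \<and> enat s \<le> t \<and> B \<in> sets borel}"

section \<open>Sequential estimators\<close>

type_synonym ('a, 'w) seq_estimator = "(nat \<Rightarrow> 'w \<Rightarrow> 'a) \<times> ('w \<Rightarrow> enat)"

definition sequential_estimators ::
  "'a pair_pre_digraph \<Rightarrow> 'w measure \<Rightarrow> ('a \<Rightarrow> nat \<Rightarrow> 'w \<Rightarrow> real) \<Rightarrow> 'a set \<Rightarrow>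
    ('a, 'w) seq_estimator set" where
  "sequential_estimators G M y V =
     {(D, T). stopping_time (obs_filtration G M y) T \<and>
              (\<forall>t. D t \<in> obs_filtration G M y (enat t) \<rightarrow>\<^sub>M count_space V)}"

text \<open>There is no output on the event that the estimator never stops.\<close>

definition estimator_output :: "('a, 'w) seq_estimator \<Rightarrow> 'w \<Rightarrow> 'a option" where
  "estimator_output E \<omega> = (case snd E \<omega> of enat t \<Rightarrow> Some (fst E t \<omega>) | \<infinity> \<Rightarrow> None)"

definition confidence_class ::
  "'a pair_pre_digraph \<Rightarrow> 'w measure \<Rightarrow> ('a \<Rightarrow> 'w measure) \<Rightarrow> ('a \<Rightarrow> nat \<Rightarrow> 'w \<Rightarrow> real) \<Rightarrow>
    'a set \<Rightarrow> nat \<Rightarrow> real \<Rightarrow> ('a, 'w) seq_estimator set" where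
  "confidence_class G M P y V R \<alpha> =
     {E \<in> sequential_estimators G M y V.
        \<forall>u\<in>V. \<forall>v\<in>V. gdist G u v > ereal (real R) \<longrightarrow>
          measure (P v) {\<omega> \<in> space (P v). estimator_output E \<omega> = Some u} \<le> \<alpha> / real (card V)}"

definition worst_expected_time ::
  "('a \<Rightarrow> 'w measure) \<Rightarrow> 'a set \<Rightarrow> ('a, 'w) seq_estimator \<Rightarrow> ennreal" where
  "worst_expected_time P V E = (SUP v\<in>V. \<integral>\<^sup>+\<omega>. ennreal_of_enat (snd E \<omega>) \<partial>P v)"

definition optimal_expected_time ::
  "'a pair_pre_digraph \<Rightarrow> 'w measure \<Rightarrow> ('a \<Rightarrow> 'w measure) \<Rightarrow> ('a \<Rightarrow> nat \<Rightarrow> 'w \<Rightarrow> real) \<Rightarrow>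
    'a set \<Rightarrow> nat \<Rightarrow> real \<Rightarrow> ennreal" where
  "optimal_expected_time G M P y V R \<alpha> =
     (INF E\<in>confidence_class G M P y V R \<alpha>. worst_expected_time P V E)"

section \<open>The matrix sequential probability ratio test\<close>

text \<open>
  \<open>log_deriv Q Q'\<close> is the logarithm of the density of \<open>Q'\<close> with respect to \<open>Q\<close>. It is
  integrable under \<open>Q'\<close> if and only if the Kullback-Leibler divergence of \<open>Q'\<close> from \<open>Q\<close>
  is finite.
\<close>

definition log_deriv :: "real measure \<Rightarrow> real measure \<Rightarrow> real \<Rightarrow> real" where
  "log_deriv Q Q' x = ln (enn2real (RN_deriv Q Q' x))"

definition llr_stat ::
  "'a pair_pre_digraph \<Rightarrow> real measure \<Rightarrow> real measure \<Rightarrow> ('a \<Rightarrow> nat \<Rightarrow> 'w \<Rightarrow> real) \<Rightarrow>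
    'a \<Rightarrow> 'a \<Rightarrow> nat \<Rightarrow> 'w \<Rightarrow> real" where
  "llr_stat G Q0 Q1 y v u t \<omega> =
     (\<Sum>s\<le>t. (\<Sum>w\<in>nbhd G v s - nbhd G u s. log_deriv Q0 Q1 (y w s \<omega>)) +
              (\<Sum>w\<in>nbhd G u s - nbhd G v s. log_deriv Q1 Q0 (y w s \<omega>)))"

text \<open>Extended reals make the minimum over an empty set of competitors infinite.\<close>

definition min_llr ::
  "'a pair_pre_digraph \<Rightarrow> real measure \<Rightarrow> real measure \<Rightarrow> ('a \<Rightarrow> nat \<Rightarrow> 'w \<Rightarrow> real) \<Rightarrow>
    'a set \<Rightarrow> nat \<Rightarrow> 'a \<Rightarrow> nat \<Rightarrow> 'w \<Rightarrow> ereal" where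
  "min_llr G Q0 Q1 y V R v t \<omega> = (INF u\<in>V - nbhd G v R. ereal (llr_stat G Q0 Q1 y v u t \<omega>))"

definition msprt_vertex_time ::
  "'a pair_pre_digraph \<Rightarrow> real measure \<Rightarrow> real measure \<Rightarrow> ('a \<Rightarrow> nat \<Rightarrow> 'w \<Rightarrow> real) \<Rightarrow>
    'a set \<Rightarrow> nat \<Rightarrow> real \<Rightarrow> 'a \<Rightarrow> 'w \<Rightarrow> enat" where
  "msprt_vertex_time G Q0 Q1 y V R \<alpha> v \<omega> =
     Inf {enat t | t. min_llr G Q0 Q1 y V R v t \<omega> \<ge> ereal (ln (real (card V) / \<alpha>))}"

definition msprt ::
  "'a pair_pre_digraph \<Rightarrow> real measure \<Rightarrow> real measure \<Rightarrow> ('a \<Rightarrow> nat \<Rightarrow> 'w \<Rightarrow> real) \<Rightarrow>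
    'a set \<Rightarrow> nat \<Rightarrow> real \<Rightarrow> ('a, 'w) seq_estimator" where
  "msprt G Q0 Q1 y V R \<alpha> =
     (\<lambda>t \<omega>. arg_max_on (\<lambda>v. min_llr G Q0 Q1 y V R v t \<omega>) V,
      \<lambda>\<omega>. INF v\<in>V. msprt_vertex_time G Q0 Q1 y V R \<alpha> v \<omega>)"

section \<open>Asymptotic comparison\<close>

definition asymp_ge :: "(nat \<Rightarrow> real \<Rightarrow> ennreal) \<Rightarrow> (nat \<Rightarrow> real \<Rightarrow> ennreal) \<Rightarrow> bool" where
  "asymp_ge g h \<longleftrightarrow>
     Liminf (at_right 0) (\<lambda>\<alpha>. Liminf sequentially (\<lambda>n. g n \<alpha> / h n \<alpha>)) \<ge> 1"

definition asymp_le :: "(nat \<Rightarrow> real \<Rightarrow> ennreal) \<Rightarrow> (nat \<Rightarrow> real \<Rightarrow> ennreal) \<Rightarrow> bool" where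
  "asymp_le g h \<longleftrightarrow>
     Limsup (at_right 0) (\<lambda>\<alpha>. Limsup sequentially (\<lambda>n. g n \<alpha> / h n \<alpha>)) \<le> 1"

definition asymp_approx :: "(nat \<Rightarrow> real \<Rightarrow> ennreal) \<Rightarrow> (nat \<Rightarrow> real \<Rightarrow> ennreal) \<Rightarrow> bool" where
  "asymp_approx g h \<longleftrightarrow> asymp_ge g h \<and> asymp_le g h"

end

theory Submission
  imports Defs "HOL-Real_Asymp.Real_Asymp"
begin

text \<open>
  With \<open>q = k - 1\<close>, a ball of radius \<open>s\<close> in the tree has about \<open>q\<^sup>s\<close> vertices, so that about \<open>q\<^sup>t\<close>
  informative observations have been made by time \<open>t\<close>. Finding the source among \<open>n\<close> vertices with
  error probability \<open>\<alpha> / n\<close> per wrong vertex takes of the order of \<open>log n\<close> of them. Hence the time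
  \<open>log log n / log q\<close>: since \<open>q\<^sup>t\<close> is exponential in \<open>t\<close>, a factor \<open>1 \<plusminus> \<epsilon>\<close> in time changes \<open>log n\<close> to
  \<open>(log n)\<^sup>1\<^sup>\<plusminus>\<^sup>\<epsilon>\<close>, which makes all constants irrelevant.

  Upper bound. The branches of the tree at \<open>v\<close> that point away from another vertex \<open>u\<close> contain at
  least \<open>q\<^sup>t\<close> vertices at distance \<open>t\<close> from \<open>v\<close>, all of them farther than \<open>t\<close> from \<open>u\<close>
  (\<open>nbhd_diff_card_ge\<close>). Each of them multiplies a Chernoff bound for the event that \<open>v\<close> is not
  told from \<open>u\<close> by the Hellinger affinity of \<open>Q0\<close> and \<open>Q1\<close>, which is below 1. After the time
  \<open>(1 + \<epsilon>) log log n / log q\<close> this bound beats the threshold and the union over \<open>n\<close> competitors,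
  and its sum over all later times tends to 0 (\<open>msprt_expected_time_le\<close>). A change of measure on
  the event of a wrong output shows that the test belongs to the confidence class
  (\<open>msprt_confidence\<close>), so that the optimal time is bounded as well.

  Lower bound. At time \<open>t = (1 - \<epsilon>) log log n / log q\<close> only \<open>N = o(log n)\<close> observations have been made
  in the neighbourhood of any vertex. If an estimator stopped by then under the source \<open>v\<close>, with
  an output near \<open>v\<close>, this event would have probability at most \<open>n\<close> to the power \<open>- 1 + o(1)\<close> under
  every source \<open>u\<close> far from \<open>v\<close>; as \<open>R = o(log n)\<close>, few vertices are near \<open>v\<close>. To transport this
  bound back to \<open>v\<close>, the likelihood ratio of \<open>v\<close> against \<open>u\<close> has to be at most \<open>n\<close> to a small power.
  The part that comes from the neighbourhood of \<open>v\<close> is \<open>exp (o (log n))\<close> by Markov's inequality,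
  because the divergence of \<open>Q1\<close> from \<open>Q0\<close> is finite (\<open>moderate_prob\<close>). The divergence of \<open>Q0\<close> from
  \<open>Q1\<close> may be infinite, and the observations near a given \<open>u\<close> may well rule out \<open>u\<close>. But they fail
  to do so with probability at least \<open>2\<close> to the power \<open>- N\<close>, and volume considerations
  (\<open>packing\<close>) provide about \<open>sqrt n\<close> far vertices with disjoint neighbourhoods, whose observations
  are independent. With high probability one of them remains plausible
  (\<open>none_plausible_prob\<close>), and a union bound over these vertices suffices
  (\<open>early_stopping_prob\<close>).
\<close>

section \<open>Balls in regular trees\<close>

text \<open>
  The distance is an infimum over walk lengths; as these are integers, a bound on it by an
  integer is witnessed by a walk.
\<close>

lemma (in pair_wf_digraph) nbhd_iff_awalk:
  "w \<in> nbhd G v t \<longleftrightarrow> (\<exists>p. awalk v p w \<and> length p \<le> t)"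
proof -
  have cost: "awalk_cost (\<lambda>_. 1) p = real (length p)" for p :: "('a \<times> 'a) list"
    by (simp add: awalk_cost_def sum_list_triv)
  show ?thesis
  proof
    assume "w \<in> nbhd G v t"
    then have "\<mu> (\<lambda>_. 1) v w \<le> ereal (real t)"
      by (simp add: nbhd_def gdist_def)
    also have "\<dots> < ereal (real t + 1)" by simp
    finally obtain p where "awalk v p w" "ereal (awalk_cost (\<lambda>_. 1) p) < ereal (real t + 1)"
      unfolding \<mu>_def Inf_less_iff by auto
    then show "\<exists>p. awalk v p w \<and> length p \<le> t"
      unfolding cost by (intro exI[of _ p]) auto
  next
    assume "\<exists>p. awalk v p w \<and> length p \<le> t"
    then obtain p where p: "awalk v p w" "length p \<le> t" by blast
    have "\<mu> (\<lambda>_. 1) v w \<le> ereal (real (length p))"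
      using min_cost_le_walk_cost[OF p(1), of "\<lambda>_. 1"] by (simp add: cost)
    also have "\<dots> \<le> ereal (real t)" using p(2) by simp
    finally show "w \<in> nbhd G v t"
      using awalk_last_in_verts[OF p(1)] by (simp add: nbhd_def gdist_def)
  qed
qed

lemma nbhd_mono: "s \<le> t \<Longrightarrow> nbhd G v s \<subseteq> nbhd G v t"
  by (auto simp: nbhd_def intro: order_trans)

lemma nbhd_subset: "nbhd G v t \<subseteq> pverts G"
  by (auto simp: nbhd_def)

lemma (in pair_wf_digraph) nbhd_0: "v \<in> pverts G \<Longrightarrow> nbhd G v 0 = {v}"
  by (auto simp: nbhd_iff_awalk awalk_Nil_iff)

lemma (in pair_wf_digraph) nbhd_self: "v \<in> pverts G \<Longrightarrow> v \<in> nbhd G v t"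
  using nbhd_0 nbhd_mono[of 0 t G v] by auto

lemma (in pair_wf_digraph) nbhd_trans:
  assumes "x \<in> nbhd G v s" and "y \<in> nbhd G x t"
  shows "y \<in> nbhd G v (s + t)"
proof -
  obtain p q where "awalk v p x" "length p \<le> s" "awalk x q y" "length q \<le> t"
    using assms by (auto simp: nbhd_iff_awalk)
  then show ?thesis
    unfolding nbhd_iff_awalk by (intro exI[of _ "p @ q"]) (auto intro: awalk_appendI)
qed

lemma (in pair_sym_digraph) nbhd_sym: "w \<in> nbhd G v t \<longleftrightarrow> v \<in> nbhd G w t"
proof -
  have len: "length (rev_path p) = length p" for p :: "('a \<times> 'a) list"
    by (induction p) auto
  show ?thesis
    unfolding nbhd_iff_awalk
    by (auto simp: len intro: exI[of _ "rev_path _"])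
qed

lemma (in pair_sym_digraph) nbhd_disjoint:
  assumes "u \<notin> nbhd G v (s + t)"
  shows "nbhd G u t \<inter> nbhd G v s = {}"
  using assms nbhd_trans nbhd_sym by blast

lemma (in pair_wf_digraph) nbhd_Suc:
  "nbhd G v (Suc t) = nbhd G v t \<union> {w. \<exists>x\<in>nbhd G v t. (x, w) \<in> parcs G}"
proof (intro equalityI subsetI)
  fix w assume "w \<in> nbhd G v (Suc t)"
  then obtain p where p: "awalk v p w" "length p \<le> Suc t"
    by (auto simp: nbhd_iff_awalk)
  show "w \<in> nbhd G v t \<union> {w. \<exists>x\<in>nbhd G v t. (x, w) \<in> parcs G}"
  proof (cases p rule: rev_cases)
    case Nil
    then show ?thesis using p by (auto simp: nbhd_iff_awalk)
  next
    case (snoc q e)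
    then have "awalk v q (fst e)" "length q \<le> t" "e \<in> parcs G" "snd e = w"
      using p by (auto simp: awalk_simps)
    then have "fst e \<in> nbhd G v t" "(fst e, w) \<in> parcs G"
      by (auto simp: nbhd_iff_awalk)
    then show ?thesis by blast
  qed
next
  fix w assume "w \<in> nbhd G v t \<union> {w. \<exists>x\<in>nbhd G v t. (x, w) \<in> parcs G}"
  then show "w \<in> nbhd G v (Suc t)"
  proof
    assume "w \<in> {w. \<exists>x\<in>nbhd G v t. (x, w) \<in> parcs G}"
    then obtain x where x: "x \<in> nbhd G v t" "(x, w) \<in> parcs G" by blast
    have "awalk x [(x, w)] w"
      using x(2) by (auto simp: awalk_simps dest: in_arcsD1 in_arcsD2)
    then have "w \<in> nbhd G x 1"
      by (auto simp: nbhd_iff_awalk intro!: exI[of _ "[(x, w)]"])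
    then show ?thesis using nbhd_trans[OF x(1), of w 1] by simp
  qed (use nbhd_mono[of t "Suc t" G v] in auto)
qed

lemma (in pair_wf_digraph) nbrs_finite_card:
  assumes "out_degree (with_proj G) v = k" and "0 < k"
  shows "finite {w. (v, w) \<in> parcs G}" and "card {w. (v, w) \<in> parcs G} = k"
proof -
  have eq: "out_arcs (with_proj G) v = Pair v ` {w. (v, w) \<in> parcs G}"
    by (auto simp: out_arcs_def)
  have k: "card (Pair v ` {w. (v, w) \<in> parcs G}) = k"
    using assms(1) by (simp add: out_degree_def eq)
  then have "finite (Pair v ` {w. (v, w) \<in> parcs G})"
    using card_ge_0_finite[of "Pair v ` {w. (v, w) \<in> parcs G}"] assms(2) by simp
  then show "finite {w. (v, w) \<in> parcs G}"
    by (rule finite_imageD) (auto intro: inj_onI)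
  show "card {w. (v, w) \<in> parcs G} = k"
    using k by (subst (asm) card_image) (auto intro: inj_onI)
qed

locale regular_graph = pair_bidirected_digraph G
  for G :: "'a pair_pre_digraph" +
  fixes k :: nat
  assumes k_ge_3: "3 \<le> k"
    and regular: "\<And>v. v \<in> pverts G \<Longrightarrow> out_degree (with_proj G) v = k"
begin

abbreviation nbrs :: "'a \<Rightarrow> 'a set" where
  "nbrs v \<equiv> {w. (v, w) \<in> parcs G}"

lemma nbrs_finite: "v \<in> pverts G \<Longrightarrow> finite (nbrs v)"
  and nbrs_card: "v \<in> pverts G \<Longrightarrow> card (nbrs v) = k"
  using nbrs_finite_card[OF regular] k_ge_3 by auto

lemma nbhd_finite: "v \<in> pverts G \<Longrightarrow> finite (nbhd G v t)"
proof (induction t)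
  case 0
  then show ?case by (simp add: nbhd_0)
next
  case (Suc t)
  have "{w. \<exists>x\<in>nbhd G v t. (x, w) \<in> parcs G} = (\<Union>x\<in>nbhd G v t. nbrs x)"
    by auto
  then show ?case
    unfolding nbhd_Suc using Suc nbrs_finite nbhd_subset[of G v t] by auto
qed

text \<open>
  A vertex of a sphere of positive radius has a neighbour in the sphere before it, which leaves
  at most \<open>k - 1\<close> neighbours for the next sphere.
\<close>

lemma sphere_card_le:
  assumes v: "v \<in> pverts G"
  shows "card (nbhd G v (Suc t) - nbhd G v t) \<le> k * (k - 1) ^ t"
proof (induction t)
  case 0
  have "nbhd G v (Suc 0) - nbhd G v 0 \<subseteq> nbrs v"
    unfolding nbhd_Suc nbhd_0[OF v] by auto
  then have "card (nbhd G v (Suc 0) - nbhd G v 0) \<le> card (nbrs v)"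
    by (rule card_mono[OF nbrs_finite[OF v]])
  then show ?case using nbrs_card[OF v] by simp
next
  case (Suc t)
  define S where "S = nbhd G v (Suc t) - nbhd G v t"
  define C where "C x = nbrs x - nbhd G v t" for x
  have finS: "finite S" using nbhd_finite[OF v] by (simp add: S_def)
  have C: "finite (C x) \<and> card (C x) \<le> k - 1" if "x \<in> S" for x
  proof -
    have xG: "x \<in> pverts G" using that nbhd_subset[of G v "Suc t"] by (auto simp: S_def)
    from that obtain p where "p \<in> nbhd G v t" "(p, x) \<in> parcs G"
      unfolding S_def nbhd_Suc by auto
    then have p: "p \<in> nbrs x" "p \<notin> C x" by (auto simp: C_def arcs_symmetric)
    then have "C x \<subseteq> nbrs x - {p}" by (auto simp: C_def)
    then have "card (C x) \<le> card (nbrs x - {p})"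
      by (intro card_mono) (use nbrs_finite[OF xG] in auto)
    also have "\<dots> = k - 1"
      using p nbrs_card[OF xG] nbrs_finite[OF xG] by simp
    finally show ?thesis using nbrs_finite[OF xG] by (simp add: C_def)
  qed
  have sub: "nbhd G v (Suc (Suc t)) - nbhd G v (Suc t) \<subseteq> (\<Union>x\<in>S. C x)"
  proof
    fix w assume w: "w \<in> nbhd G v (Suc (Suc t)) - nbhd G v (Suc t)"
    then obtain x where x: "x \<in> nbhd G v (Suc t)" "(x, w) \<in> parcs G"
      by (subst (asm) nbhd_Suc) blast
    have "x \<notin> nbhd G v t" using w x(2) by (subst (asm) (2) nbhd_Suc) blast
    moreover have "w \<notin> nbhd G v t" using w nbhd_mono[of t "Suc t" G v] by auto
    ultimately show "w \<in> (\<Union>x\<in>S. C x)" using x by (auto simp: S_def C_def)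
  qed
  have "card (nbhd G v (Suc (Suc t)) - nbhd G v (Suc t)) \<le> card (\<Union>x\<in>S. C x)"
    by (rule card_mono[OF _ sub]) (use finS C in auto)
  also have "\<dots> \<le> (\<Sum>x\<in>S. card (C x))" by (rule card_UN_le[OF finS])
  also have "\<dots> \<le> (\<Sum>x\<in>S. k - 1)" by (rule sum_mono) (use C in auto)
  also have "\<dots> = card S * (k - 1)" by simp
  also have "\<dots> \<le> k * (k - 1) ^ t * (k - 1)" using Suc by (simp add: S_def)
  finally show ?case by (simp add: mult_ac)
qed

lemma nbhd_card_le:
  assumes v: "v \<in> pverts G"
  shows "card (nbhd G v t) \<le> 3 * (k - 1) ^ t"
proof (induction t)
  case 0
  show ?case by (simp add: nbhd_0[OF v])
next
  case (Suc t)
  have split: "nbhd G v (Suc t) = nbhd G v t \<union> (nbhd G v (Suc t) - nbhd G v t)"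
    using nbhd_mono[of t "Suc t" G v] by auto
  have "card (nbhd G v (Suc t)) \<le> card (nbhd G v t) + card (nbhd G v (Suc t) - nbhd G v t)"
    by (subst split) (rule card_Un_le)
  also have "\<dots> \<le> 3 * (k - 1) ^ t + k * (k - 1) ^ t"
    using Suc sphere_card_le[OF v] by (rule add_mono)
  also have "\<dots> = (3 + k) * (k - 1) ^ t" by (simp add: add_mult_distrib)
  \<comment> \<open>The factor 3 is large enough for \<open>3 + k \<le> 3 * (k - 1)\<close>.\<close>
  also have "\<dots> \<le> (3 * (k - 1)) * (k - 1) ^ t"
    using k_ge_3 by (intro mult_right_mono) auto
  finally show ?case by (simp add: mult_ac)
qed

text \<open>
  Greedy packing: while the balls around the points chosen so far cannot cover \<open>W\<close>, there is
  room for one more point.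
\<close>

lemma packing:
  assumes W: "W \<subseteq> pverts G" "finite W" and v: "v \<in> pverts G"
    and room: "(m + 1) * (3 * (k - 1) ^ r) \<le> card W"
  obtains U where "U \<subseteq> W" and "card U = m" and "finite U"
    and "\<And>u. u \<in> U \<Longrightarrow> u \<notin> nbhd G v r"
    and "\<And>u u'. u \<in> U \<Longrightarrow> u' \<in> U \<Longrightarrow> u \<noteq> u' \<Longrightarrow> u' \<notin> nbhd G u r"
proof -
  have "\<exists>U\<subseteq>W. card U = j \<and> finite U \<and> (\<forall>u\<in>U. u \<notin> nbhd G v r) \<and>
      (\<forall>u\<in>U. \<forall>u'\<in>U. u \<noteq> u' \<longrightarrow> u' \<notin> nbhd G u r)" if "j \<le> m" for j
    using that
  proof (induction j)
    case (Suc j)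
    then obtain U where U: "U \<subseteq> W" "card U = j" "finite U" "\<forall>u\<in>U. u \<notin> nbhd G v r"
      "\<forall>u\<in>U. \<forall>u'\<in>U. u \<noteq> u' \<longrightarrow> u' \<notin> nbhd G u r"
      by auto
    define B where "B = (\<Union>u\<in>insert v U. nbhd G u r)"
    have UG: "insert v U \<subseteq> pverts G" using U(1) W(1) v by auto
    have finB: "finite B" using UG U(3) nbhd_finite by (auto simp: B_def)
    have "card B \<le> (\<Sum>u\<in>insert v U. card (nbhd G u r))"
      unfolding B_def by (rule card_UN_le) (use U(3) in simp)
    also have "\<dots> \<le> (\<Sum>u\<in>insert v U. 3 * (k - 1) ^ r)"
      by (rule sum_mono) (use UG nbhd_card_le in blast)
    also have "\<dots> = card (insert v U) * (3 * (k - 1) ^ r)" by simp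
    also have "\<dots> \<le> (j + 1) * (3 * (k - 1) ^ r)"
      using card_insert_le_m1[of "j + 1" U v] U(2) by (intro mult_right_mono) auto
    also have "\<dots> < (m + 1) * (3 * (k - 1) ^ r)"
      using Suc.prems k_ge_3 by (intro mult_strict_right_mono) auto
    also have "\<dots> \<le> card W" by (rule room)
    finally have "\<not> W \<subseteq> B" using card_mono[OF finB, of W] by linarith
    then obtain w where w: "w \<in> W" "w \<notin> B" by blast
    have far: "w \<notin> nbhd G x r" if "x \<in> insert v U" for x using w(2) that by (auto simp: B_def)
    have wU: "w \<notin> U" using far nbhd_self UG by blast
    have "u' \<notin> nbhd G u r" if uu: "u \<in> insert w U" "u' \<in> insert w U" "u \<noteq> u'" for u u'
    proof (cases "u = w")
      case True
      then show ?thesis using uu far[of u'] nbhd_sym[of u' u r] by blast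
    next
      case False
      then show ?thesis using uu far[of u] U(5) by blast
    qed
    moreover have "card (insert w U) = Suc j" using U(2,3) wU by simp
    ultimately have "insert w U \<subseteq> W \<and> card (insert w U) = Suc j \<and> finite (insert w U) \<and>
        (\<forall>u\<in>insert w U. u \<notin> nbhd G v r) \<and>
        (\<forall>u\<in>insert w U. \<forall>u'\<in>insert w U. u \<noteq> u' \<longrightarrow> u' \<notin> nbhd G u r)"
      using U(1,3,4) w(1) far[of v] by blast
    then show ?case by (intro exI[of _ "insert w U"])
  qed auto
  from this[OF order_refl] obtain U where U: "U \<subseteq> W" "card U = m" "finite U"
    "\<forall>u\<in>U. u \<notin> nbhd G v r" "\<forall>u\<in>U. \<forall>u'\<in>U. u \<noteq> u' \<longrightarrow> u' \<notin> nbhd G u r"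
    by (elim exE conjE)
  show ?thesis
    by (rule that[OF U(1-3)]) (use U(4,5) in simp_all)
qed

end

locale regular_tree = regular_graph +
  assumes connected: "Digraph_Component.connected (with_proj G)"
    and acyclic: "\<And>p. cycle p \<Longrightarrow> length p < 3"
begin

lemma finite_distance: "u \<in> pverts G \<Longrightarrow> v \<in> pverts G \<Longrightarrow> \<exists>t. v \<in> nbhd G u t"
proof -
  assume "u \<in> pverts G" "v \<in> pverts G"
  then have "reachable (with_proj G) u v"
    using symmetric_connected_imp_strongly_connected[OF sym_arcs connected]
    by (auto simp: strongly_connected_def)
  then show ?thesis by (auto simp: reachable_awalk nbhd_iff_awalk)
qed

text \<open>
  A walk between two neighbours of \<open>x\<close> that avoids \<open>x\<close> closes to a cycle through \<open>x\<close>.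
\<close>

lemma neighbours_separated:
  assumes "(x, a) \<in> parcs G" "(x, b) \<in> parcs G" "a \<noteq> b"
    and p: "awalk a p b"
  shows "x \<in> set (awalk_verts a p)"
proof (rule ccontr)
  assume x: "x \<notin> set (awalk_verts a p)"
  define q where "q = awalk_to_apath p"
  have q: "apath a q b" unfolding q_def by (rule apath_awalk_to_apath[OF p])
  then have aq: "awalk a q b" by (rule awalkI_apath)
  have "set q \<subseteq> set p" unfolding q_def by (rule awalk_to_apath_subset[OF p])
  then have "set (awalk_verts a q) \<subseteq> set (awalk_verts a p)"
    using set_awalk_verts[OF p] set_awalk_verts[OF aq] by auto
  then have xq: "x \<notin> set (awalk_verts a q)" using x by auto
  have ne: "q \<noteq> []" using aq assms(3) by (auto simp: awalk_Nil_iff)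
  have bx: "awalk b [(b, x)] x"
    using assms(2) by (auto simp: awalk_simps arcs_symmetric dest: in_arcsD1 in_arcsD2)
  then have ax: "awalk a (q @ [(b, x)]) x" using aq by (rule awalk_appendI[rotated])
  have verts: "awalk_verts a (q @ [(b, x)]) = awalk_verts a q @ [x]"
    using awalk_verts_append[OF ax] aq by simp
  have "awalk x ((x, a) # q @ [(b, x)]) x"
    using ax assms(1) by (auto simp: awalk_Cons_iff dest: in_arcsD1)
  moreover have "distinct (tl (awalk_verts x ((x, a) # q @ [(b, x)])))"
    using q xq verts by (simp add: apath_def)
  ultimately have "cycle ((x, a) # q @ [(b, x)])" by (auto simp: cycle_def)
  then have "length ((x, a) # q @ [(b, x)]) < 3" by (rule acyclic)
  then show False using ne by (cases q) auto
qed

text \<open>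
  Hence at most one neighbour of a vertex \<open>x\<close> is no farther from \<open>u\<close> than \<open>x\<close>: shortest walks
  from two such neighbours to \<open>u\<close> avoid \<open>x\<close>, and together they join the two neighbours.
\<close>

lemma unique_parent:
  assumes "(x, a) \<in> parcs G" "(x, b) \<in> parcs G"
    and "a \<in> nbhd G u (Suc t)" "b \<in> nbhd G u (Suc t)" "x \<notin> nbhd G u t"
  shows "a = b"
proof (rule ccontr)
  assume "a \<noteq> b"
  obtain p where p: "awalk u p a" "length p \<le> Suc t" using assms(3) by (auto simp: nbhd_iff_awalk)
  obtain q where q: "awalk u q b" "length q \<le> Suc t" using assms(4) by (auto simp: nbhd_iff_awalk)
  have avoid: "x \<notin> set (awalk_verts u r)"
    if r: "awalk u r w" "length r \<le> Suc t" and w: "(x, w) \<in> parcs G" for r w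
  proof
    assume "x \<in> set (awalk_verts u r)"
    then obtain r1 r2 where r12: "r = r1 @ r2" "awalk u r1 x" "awalk x r2 w"
      using awalk_decomp[OF r(1)] by blast
    have "\<not> length r1 \<le> t" using assms(5) r12(2) by (auto simp: nbhd_iff_awalk)
    then have "r2 = []" using r(2) r12(1) by (cases r2) auto
    then have "x = w" using r12(3) by (simp add: awalk_Nil_iff)
    then show False using pair_no_loops[OF w] by simp
  qed
  have rp: "awalk a (rev_path p) u" using p(1) by simp
  have w: "awalk a (rev_path p @ q) b" using rp q(1) by (rule awalk_appendI)
  have "awalk_verts a (rev_path p @ q) = rev (awalk_verts u p) @ tl (awalk_verts u q)"
    using awalk_verts_append[OF w] awalk_verts_rev_path[OF p(1)] awlast_of_awalk[OF rp] by simp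
  moreover have "set (tl (awalk_verts u q)) \<subseteq> set (awalk_verts u q)"
    by (cases "awalk_verts u q") auto
  ultimately have
    "set (awalk_verts a (rev_path p @ q)) \<subseteq> set (awalk_verts u p) \<union> set (awalk_verts u q)"
    by auto
  then show False
    using neighbours_separated[OF assms(1,2) \<open>a \<noteq> b\<close> w]
      avoid[OF p assms(1)] avoid[OF q assms(2)] by blast
qed

text \<open>
  The subtree of \<open>v\<close> that points away from \<open>u\<close> branches into at least \<open>k - 1\<close> new vertices at
  every vertex, and all of it is farther from \<open>u\<close> than from \<open>v\<close>.
\<close>

lemma nbhd_diff_card_ge:
  assumes u: "u \<in> pverts G" and v: "v \<in> pverts G" and "u \<noteq> v"
  shows "(k - 1) ^ s \<le> card (nbhd G v s - nbhd G u s)"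
proof -
  define D where "D = (LEAST t. v \<in> nbhd G u t)"
  have D: "v \<in> nbhd G u D" unfolding D_def by (rule LeastI_ex[OF finite_distance[OF u v]])
  have "D \<noteq> 0" using D \<open>u \<noteq> v\<close> nbhd_0[OF u] by (cases D) auto
  then obtain d where d: "D = Suc d" by (cases D) auto
  have vd: "v \<notin> nbhd G u d" using not_less_Least[of d "\<lambda>t. v \<in> nbhd G u t"] d by (auto simp: D_def)
  have "\<exists>C. C \<subseteq> nbhd G v s \<inter> (nbhd G u (Suc (d + s)) - nbhd G u (d + s)) \<and> (k - 1) ^ s \<le> card C"
  proof (induction s)
    case 0
    show ?case by (rule exI[of _ "{v}"]) (use D d vd nbhd_0[OF v] in auto)
  next
    case (Suc s)
    define t where "t = d + s"
    obtain C where C: "C \<subseteq> nbhd G v s" "C \<subseteq> nbhd G u (Suc t)" "C \<inter> nbhd G u t = {}"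
      and card: "(k - 1) ^ s \<le> card C"
      using Suc unfolding t_def by blast
    define ch where "ch x = nbrs x - nbhd G u (Suc t)" for x
    have CG: "x \<in> pverts G" if "x \<in> C" for x using that C(1) nbhd_subset[of G v s] by auto
    have finC: "finite C" using C(1) nbhd_finite[OF v] finite_subset by blast
    have card_ch: "finite (ch x) \<and> k - 1 \<le> card (ch x)" if x: "x \<in> C" for x
    proof -
      have fin: "finite (nbrs x)" by (rule nbrs_finite[OF CG[OF x]])
      have "card (nbrs x \<inter> nbhd G u (Suc t)) \<le> 1"
        unfolding One_nat_def card_le_Suc0_iff_eq[OF finite_Int[OF disjI1, OF fin]]
        using unique_parent[of x _ _ u t] C(3) x by blast
      moreover have "card (ch x) = card (nbrs x) - card (nbrs x \<inter> nbhd G u (Suc t))"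
        unfolding ch_def by (rule card_Diff_subset_Int) (use fin in simp)
      ultimately show ?thesis using nbrs_card[OF CG[OF x]] fin by (auto simp: ch_def)
    qed
    have disj: "ch x \<inter> ch x' = {}" if "x \<in> C" "x' \<in> C" "x \<noteq> x'" for x x'
    proof (rule ccontr)
      assume "ch x \<inter> ch x' \<noteq> {}"
      then obtain w where w: "(w, x) \<in> parcs G" "(w, x') \<in> parcs G" "w \<notin> nbhd G u (Suc t)"
        by (auto simp: ch_def dest: arcs_symmetric)
      have "nbhd G u (Suc t) \<subseteq> nbhd G u (Suc (Suc t))" by (rule nbhd_mono) simp
      then have "x = x'" using unique_parent[OF w(1,2) _ _ w(3)] that C(2) by blast
      then show False using that by simp
    qed
    have "(k - 1) ^ Suc s \<le> (\<Sum>x\<in>C. k - 1)" using card by (simp add: mult.commute)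
    also have "\<dots> \<le> (\<Sum>x\<in>C. card (ch x))" by (rule sum_mono) (use card_ch in blast)
    also have "\<dots> = card (\<Union>x\<in>C. ch x)"
      by (rule card_UN_disjoint[symmetric]) (use finC card_ch disj in auto)
    finally have "(k - 1) ^ Suc s \<le> card (\<Union>x\<in>C. ch x)" .
    moreover have "(\<Union>x\<in>C. ch x) \<subseteq> nbhd G v (Suc s)"
      using C(1) unfolding nbhd_Suc ch_def by auto
    moreover have "(\<Union>x\<in>C. ch x) \<subseteq> nbhd G u (Suc (Suc t)) - nbhd G u (Suc t)"
      using C(2) unfolding nbhd_Suc[of u "Suc t"] ch_def by auto
    ultimately show ?case
      by (intro exI[of _ "\<Union>x\<in>C. ch x"]) (simp add: t_def)
  qed
  then obtain C where C: "C \<subseteq> nbhd G v s" "C \<inter> nbhd G u (d + s) = {}" "(k - 1) ^ s \<le> card C"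
    by blast
  have "nbhd G u s \<subseteq> nbhd G u (d + s)" by (rule nbhd_mono) simp
  then have "C \<subseteq> nbhd G v s - nbhd G u s" using C by blast
  then have "card C \<le> card (nbhd G v s - nbhd G u s)"
    by (rule card_mono[rotated]) (use nbhd_finite[OF v] in simp)
  then show ?thesis using C(3) by simp
qed

end

lemma infinite_regular_tree_locale:
  assumes "3 \<le> k" and "infinite_regular_tree k G"
  shows "regular_tree G k"
proof -
  have G: "pair_bidirected_digraph G" "Digraph_Component.connected (with_proj G)"
    "\<not> (\<exists>p. pre_digraph.cycle (with_proj G) p \<and> length p \<ge> 3)"
    "\<forall>v\<in>pverts G. out_degree (with_proj G) v = k"
    using assms(2) by (auto simp: infinite_regular_tree_def undirected_tree_def)
  interpret pair_bidirected_digraph G by (rule G(1))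
  show ?thesis
    by unfold_locales (use assms(1) G in \<open>auto simp: not_le\<close>)
qed

section \<open>Likelihood ratios\<close>

locale equivalent_laws =
  fixes Q Q' :: "real measure"
  assumes prob: "prob_space Q" and prob': "prob_space Q'"
    and sets_Q: "sets Q = sets borel" and sets_Q': "sets Q' = sets borel"
    and ac: "absolutely_continuous Q Q'" and ac': "absolutely_continuous Q' Q"
begin

sublocale Q: prob_space Q by (rule prob)
sublocale Q': prob_space Q' by (rule prob')

lemma measurable_law [simp]: "measurable Q N = measurable borel N" "measurable Q' N = measurable borel N"
  by (rule measurable_cong_sets[OF sets_Q refl], rule measurable_cong_sets[OF sets_Q' refl])

lemma log_deriv_measurable [measurable]: "log_deriv Q Q' \<in> borel_measurable borel"
proof -
  have [measurable]: "RN_deriv Q Q' \<in> borel_measurable borel"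
    using borel_measurable_RN_deriv[of Q Q'] by simp
  show ?thesis unfolding log_deriv_def[abs_def] by measurable
qed

text \<open>
  The values that \<^const>\<open>log_deriv\<close> takes where the density is 0 or \<open>\<infinity>\<close> do not matter: mutual
  absolute continuity makes both cases null sets.
\<close>

lemma density_exp_log_deriv: "density Q (\<lambda>x. ennreal (exp (log_deriv Q Q' x))) = Q'"
proof -
  define f where "f = RN_deriv Q Q'"
  have f[measurable]: "f \<in> borel_measurable borel"
    using borel_measurable_RN_deriv[of Q Q'] by (simp add: f_def)
  have dens: "density Q f = Q'"
    unfolding f_def by (rule Q.density_RN_deriv) (use ac sets_Q sets_Q' in auto)
  have fin: "AE x in Q. f x \<noteq> \<infinity>"
    unfolding f_def
    by (rule Q.RN_deriv_finite) (use ac sets_Q sets_Q' Q'.sigma_finite_measure_axioms in auto)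
  have [measurable_cong]: "sets Q = sets borel" by (rule sets_Q)
  have zero: "{x. f x = 0} \<in> null_sets Q"
  proof -
    have Z: "{x. f x = 0} \<in> sets borel" by measurable
    have "emeasure Q' {x. f x = 0} = (\<integral>\<^sup>+x. f x * indicator {x. f x = 0} x \<partial>Q)"
      unfolding dens[symmetric] by (rule emeasure_density) (use Z sets_Q in auto)
    also have "\<dots> = (\<integral>\<^sup>+x. 0 \<partial>Q)"
      by (rule nn_integral_cong) (auto simp: indicator_def)
    finally have "{x. f x = 0} \<in> null_sets Q'" using Z sets_Q' by (auto simp: null_sets_def)
    then show ?thesis using ac' by (auto simp: absolutely_continuous_def)
  qed
  have pos: "AE x in Q. f x \<noteq> 0" by (rule AE_I'[OF zero]) auto
  have "AE x in Q. f x = ennreal (exp (log_deriv Q Q' x))"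
    using fin pos
  proof eventually_elim
    case (elim x)
    then have "0 < enn2real (f x)" by (simp add: enn2real_positive_iff less_top zero_less_iff_neq_zero)
    then show ?case using elim by (simp add: log_deriv_def f_def[symmetric] less_top)
  qed
  then have "density Q f = density Q (\<lambda>x. ennreal (exp (log_deriv Q Q' x)))"
    by (intro density_cong) auto
  then show ?thesis using dens by simp
qed

lemma nn_integral_law':
  assumes [measurable]: "h \<in> borel_measurable borel"
  shows "(\<integral>\<^sup>+x. h x \<partial>Q') = (\<integral>\<^sup>+x. ennreal (exp (log_deriv Q Q' x)) * h x \<partial>Q)"
  by (subst (1) density_exp_log_deriv[symmetric], subst nn_integral_density) auto

lemma swapped: "equivalent_laws Q' Q"
  using prob prob' sets_Q sets_Q' ac ac' by (simp add: equivalent_laws_def)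

lemma log_deriv_swap: "AE x in Q'. log_deriv Q' Q x = - log_deriv Q Q' x"
proof -
  define l where "l = log_deriv Q Q'"
  have [measurable]: "l \<in> borel_measurable borel" by (simp add: l_def)
  have [measurable]: "log_deriv Q' Q \<in> borel_measurable borel"
    by (rule equivalent_laws.log_deriv_measurable[OF swapped])
  have "density Q' (\<lambda>x. ennreal (exp (- l x)))
      = density (density Q (\<lambda>x. ennreal (exp (l x)))) (\<lambda>x. ennreal (exp (- l x)))"
    by (simp add: l_def density_exp_log_deriv)
  also have "\<dots> = density Q (\<lambda>x. ennreal (exp (l x)) * ennreal (exp (- l x)))"
    by (rule density_density_eq) auto
  also have "\<dots> = density Q (\<lambda>x. 1)"
    by (simp add: ennreal_mult[symmetric] exp_add[symmetric])
  also have "\<dots> = Q" by (rule density_1)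
  finally have *: "density Q' (\<lambda>x. ennreal (exp (- l x))) = Q" .
  have "AE x in Q'. ennreal (exp (- l x)) = RN_deriv Q' Q x"
    by (rule Q'.RN_deriv_unique[OF _ *]) simp
  moreover have "AE x in Q'. ennreal (exp (log_deriv Q' Q x)) = RN_deriv Q' Q x"
    by (rule Q'.RN_deriv_unique[OF _ equivalent_laws.density_exp_log_deriv[OF swapped]])
      simp
  ultimately show ?thesis
  proof eventually_elim
    case (elim x)
    then have "ennreal (exp (- l x)) = ennreal (exp (log_deriv Q' Q x))" by simp
    then have "- l x = log_deriv Q' Q x" by (simp add: ennreal_inj)
    then show ?case by (simp add: l_def)
  qed
qed

text \<open>
  The left-hand side is the Hellinger affinity \<open>\<integral> sqrt (dQ/dQ') dQ'\<close>, which falls short of 1 by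
  half the squared distance between the square roots of the densities.
\<close>

lemma hellinger_affinity_less_1:
  assumes "Q \<noteq> Q'"
  shows "(\<integral>\<^sup>+x. ennreal (exp (- (1 / 2) * log_deriv Q Q' x)) \<partial>Q') < 1"
proof -
  define h where "h x = exp (log_deriv Q Q' x / 2)" for x
  have [measurable]: "h \<in> borel_measurable borel" unfolding h_def[abs_def] by measurable
  have sq: "(h x)\<^sup>2 = exp (log_deriv Q Q' x)" for x
    unfolding h_def by (simp add: exp_double[symmetric])
  have "(\<integral>\<^sup>+x. ennreal ((h x)\<^sup>2) \<partial>Q) = 1"
    using nn_integral_law'[of "\<lambda>_. 1"] Q'.emeasure_space_1 by (simp add: sq)
  then have int2: "integrable Q (\<lambda>x. (h x)\<^sup>2)" and one: "(\<integral>x. (h x)\<^sup>2 \<partial>Q) = 1"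
    by (auto intro!: integrableI_nonneg simp: integral_eq_nn_integral)
  have "integrable Q (\<lambda>x. 1 + (h x)\<^sup>2)" using int2 by simp
  then have int1: "integrable Q h"
  proof (rule Bochner_Integration.integrable_bound)
    show "AE x in Q. norm (h x) \<le> norm (1 + (h x)\<^sup>2)"
    proof (rule AE_I2)
      fix x
      have "0 \<le> (h x - 1)\<^sup>2" "0 \<le> (h x)\<^sup>2" "0 < h x" by (auto simp: h_def)
      then have "h x \<le> 1 + (h x)\<^sup>2" unfolding power2_diff by simp
      then show "norm (h x) \<le> norm (1 + (h x)\<^sup>2)" using \<open>0 < h x\<close> by simp
    qed
  qed simp
  have dist: "integrable Q (\<lambda>x. (1 - h x)\<^sup>2)" "(\<integral>x. (1 - h x)\<^sup>2 \<partial>Q) = 2 - 2 * (\<integral>x. h x \<partial>Q)"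
    using int1 int2 one Q.prob_space by (simp_all add: power2_diff)
  have "(\<integral>x. h x \<partial>Q) < 1"
  proof (rule ccontr)
    assume "\<not> ?thesis"
    moreover have "0 \<le> (\<integral>x. (1 - h x)\<^sup>2 \<partial>Q)" by (rule integral_nonneg_AE) simp
    ultimately have "(\<integral>x. (1 - h x)\<^sup>2 \<partial>Q) = 0" using dist(2) by simp
    then have "AE x in Q. (1 - h x)\<^sup>2 = 0"
      using integral_nonneg_eq_0_iff_AE[OF dist(1)] by simp
    then have "AE x in Q. ennreal (exp (log_deriv Q Q' x)) = 1"
      by eventually_elim (simp add: sq[symmetric])
    then have "density Q (\<lambda>x. ennreal (exp (log_deriv Q Q' x))) = density Q (\<lambda>_. 1)"
      by (intro density_cong) auto
    then show False using assms by (simp add: density_exp_log_deriv density_1)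
  qed
  moreover have "(\<integral>\<^sup>+x. ennreal (exp (- (1 / 2) * log_deriv Q Q' x)) \<partial>Q') = (\<integral>\<^sup>+x. ennreal (h x) \<partial>Q)"
    by (subst nn_integral_law')
       (auto simp: h_def ennreal_mult[symmetric] exp_add[symmetric] intro!: nn_integral_cong)
  moreover have "\<dots> = ennreal (\<integral>x. h x \<partial>Q)"
    by (rule nn_integral_eq_integral[OF int1]) (simp add: h_def)
  ultimately show ?thesis by (simp add: ennreal_less_one_iff)
qed

end

text \<open>
  Two laws of an independent family that differ in finitely many coordinates have as density on
  the generated \<open>\<sigma>\<close>-algebra the product of the densities of those coordinates. Both sides are
  compared as measures on the product space, where boxes with finitely many restricted sides
  suffice.
\<close>

lemma change_of_measure:
  fixes X :: "'i \<Rightarrow> 'w \<Rightarrow> 'b" and f :: "'i \<Rightarrow> 'b \<Rightarrow> ennreal"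
  assumes P: "prob_space P" and P': "prob_space P'" and sets_eq: "sets P' = sets P"
    and ind: "prob_space.indep_vars P (\<lambda>_. N) X I" and ind': "prob_space.indep_vars P' (\<lambda>_. N) X I"
    and J: "finite J" "J \<subseteq> I"
    and f[measurable]: "\<And>i. i \<in> J \<Longrightarrow> f i \<in> borel_measurable N"
    and dens: "\<And>i. i \<in> J \<Longrightarrow> distr P' N (X i) = density (distr P N (X i)) (f i)"
    and same: "\<And>i. i \<in> I - J \<Longrightarrow> distr P' N (X i) = distr P N (X i)"
    and A: "A \<in> sigma_sets (space P) {X i -` B \<inter> space P | i B. i \<in> I \<and> B \<in> sets N}"
  shows "emeasure P' A = (\<integral>\<^sup>+\<omega>. (\<Prod>i\<in>J. f i (X i \<omega>)) * indicator A \<omega> \<partial>P)"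
proof -
  interpret P: prob_space P by (rule P)
  interpret P': prob_space P' by (rule P')
  have space_eq: "space P' = space P" using sets_eq by (rule sets_eq_imp_space_eq)
  have X[measurable]: "X i \<in> measurable P N" if "i \<in> I" for i
    using ind that unfolding P.indep_vars_def by auto
  have X': "X i \<in> measurable P' N" if "i \<in> I" for i
    using ind' that unfolding P'.indep_vars_def by auto
  define Y where "Y \<omega> = (\<lambda>i\<in>I. X i \<omega>)" for \<omega>
  define L where "L \<omega> = (\<Prod>i\<in>J. f i (X i \<omega>))" for \<omega>
  have Y[measurable]: "Y \<in> measurable P (PiM I (\<lambda>_. N))"
    unfolding Y_def[abs_def] by (rule measurable_restrict) (rule X)
  have Y'[measurable]: "Y \<in> measurable P' (PiM I (\<lambda>_. N))"
    using Y sets_eq by (simp cong: measurable_cong_sets)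
  have fX[measurable]: "(\<lambda>\<omega>. f i (X i \<omega>)) \<in> borel_measurable P" if "i \<in> J" for i
    using f[OF that] X[of i] that J(2) by (auto intro: measurable_compose)
  have L[measurable]: "L \<in> borel_measurable P"
    unfolding L_def[abs_def] by (rule borel_measurable_prod_ennreal) (rule fX)
  \<comment> \<open>An event of the generated \<open>\<sigma>\<close>-algebra is a preimage under the joint map.\<close>
  have "{X i -` B \<inter> space P | i B. i \<in> I \<and> B \<in> sets N}
      \<subseteq> {Y -` C \<inter> space P | C. C \<in> sets (PiM I (\<lambda>_. N))}"
  proof safe
    fix i B assume i: "i \<in> I" and B: "B \<in> sets N"
    let ?C = "(\<lambda>x. x i) -` B \<inter> space (PiM I (\<lambda>_. N))"
    have "?C \<in> sets (PiM I (\<lambda>_. N))"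
      by (rule measurable_sets[OF measurable_component_singleton[OF i] B])
    moreover have "X i -` B \<inter> space P = Y -` ?C \<inter> space P"
      using i measurable_space[OF Y] by (auto simp: Y_def)
    ultimately show "\<exists>C. X i -` B \<inter> space P = Y -` C \<inter> space P \<and> C \<in> sets (PiM I (\<lambda>_. N))"
      by blast
  qed
  then have "sigma_sets (space P) {X i -` B \<inter> space P | i B. i \<in> I \<and> B \<in> sets N}
      \<subseteq> sets (vimage_algebra (space P) Y (PiM I (\<lambda>_. N)))"
    using sets.sigma_sets_subset[of _ "vimage_algebra (space P) Y (PiM I (\<lambda>_. N))"]
      measurable_space[OF Y] by (simp add: sets_vimage_algebra2 Pi_iff)
  then obtain C where C: "C \<in> sets (PiM I (\<lambda>_. N))" "A = Y -` C \<inter> space P"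
    using A measurable_space[OF Y] by (auto simp: sets_vimage_algebra2 Pi_iff)
  have joint: "distr P' (PiM I (\<lambda>_. N)) Y = distr (density P L) (PiM I (\<lambda>_. N)) Y"
  proof (rule measure_eqI_PiM_infinite)
    fix B K assume K: "finite K" "K \<subseteq> I" and B: "\<And>i. i \<in> K \<Longrightarrow> B i \<in> sets N"
    let ?E = "prod_emb I (\<lambda>_. N) K (Pi\<^sub>E K B)"
    have E: "?E \<in> sets (PiM I (\<lambda>_. N))" by (rule sets_PiM_I) (use K B in auto)
    define b :: "'i \<Rightarrow> 'b \<Rightarrow> ennreal" where "b i = (if i \<in> K then indicator (B i) else (\<lambda>_. 1))" for i
    define g where "g i = (if i \<in> J then f i else (\<lambda>_. 1))" for i
    have b[measurable]: "b i \<in> borel_measurable N" for i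
      unfolding b_def using B[of i] by auto
    have g[measurable]: "g i \<in> borel_measurable N" for i
      unfolding g_def using f[of i] by auto
    have ind_E: "indicator (Y -` ?E \<inter> space P) \<omega> = (\<Prod>i\<in>K \<union> J. b i (X i \<omega>))"
      if \<omega>: "\<omega> \<in> space P" for \<omega>
    proof -
      have mem: "Y \<omega> \<in> ?E \<longleftrightarrow> (\<forall>i\<in>K. X i \<omega> \<in> B i)"
        using K(2) measurable_space[OF X \<omega>] by (auto simp: prod_emb_iff Y_def PiE_iff)
      have "(\<Prod>i\<in>K \<union> J. b i (X i \<omega>)) = (\<Prod>i\<in>K. indicator (B i) (X i \<omega>))"
        by (rule prod.mono_neutral_cong_right) (use K J in \<open>auto simp: b_def\<close>)
      also have "\<dots> = indicator (Y -` ?E \<inter> space P) \<omega>"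
      proof (cases "Y \<omega> \<in> ?E")
        case True
        then show ?thesis using mem \<omega> by (auto intro!: prod.neutral)
      next
        case False
        then obtain i where "i \<in> K" "X i \<omega> \<notin> B i" using mem by blast
        then have "(\<Prod>i\<in>K. indicator (B i) (X i \<omega>)) = (0::ennreal)"
          using K(1) by (intro prod_zero) (auto intro!: bexI[of _ i])
        then show ?thesis using False by simp
      qed
      finally show ?thesis by simp
    qed
    have fin: "finite (K \<union> J)" "K \<union> J \<subseteq> I" using K J by auto
    have indb: "P'.indep_vars (\<lambda>_. borel) (\<lambda>i \<omega>. b i (X i \<omega>)) (K \<union> J)"
      by (rule P'.indep_vars_compose2[OF P'.indep_vars_subset[OF ind' fin(2)]]) (rule b)
    have indgb: "P.indep_vars (\<lambda>_. borel) (\<lambda>i \<omega>. g i (X i \<omega>) * b i (X i \<omega>)) (K \<union> J)"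
      by (rule P.indep_vars_compose2[OF P.indep_vars_subset[OF ind fin(2)]]) measurable
    have "emeasure (distr P' (PiM I (\<lambda>_. N)) Y) ?E = emeasure P' (Y -` ?E \<inter> space P)"
      by (simp add: emeasure_distr E space_eq)
    also have "\<dots> = (\<integral>\<^sup>+\<omega>. indicator (Y -` ?E \<inter> space P) \<omega> \<partial>P')"
      using measurable_sets[OF Y' E] space_eq by simp
    also have "\<dots> = (\<integral>\<^sup>+\<omega>. (\<Prod>i\<in>K \<union> J. b i (X i \<omega>)) \<partial>P')"
      by (rule nn_integral_cong) (simp add: space_eq ind_E)
    also have "\<dots> = (\<Prod>i\<in>K \<union> J. \<integral>\<^sup>+\<omega>. b i (X i \<omega>) \<partial>P')"
      by (rule P'.indep_vars_nn_integral[OF fin(1) indb]) simp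
    also have "\<dots> = (\<Prod>i\<in>K \<union> J. \<integral>\<^sup>+\<omega>. g i (X i \<omega>) * b i (X i \<omega>) \<partial>P)"
    proof (rule prod.cong[OF refl])
      fix i assume "i \<in> K \<union> J"
      then have i: "i \<in> I" using fin by auto
      have "(\<integral>\<^sup>+\<omega>. b i (X i \<omega>) \<partial>P') = (\<integral>\<^sup>+x. b i x \<partial>distr P' N (X i))"
        by (rule nn_integral_distr[symmetric]) (use X'[OF i] b in auto)
      also have "distr P' N (X i) = density (distr P N (X i)) (g i)"
        using dens[of i] same[of i] i by (auto simp: g_def density_1)
      also have "(\<integral>\<^sup>+x. b i x \<partial>density (distr P N (X i)) (g i)) =
          (\<integral>\<^sup>+x. g i x * b i x \<partial>distr P N (X i))"
        by (rule nn_integral_density) auto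
      also have "\<dots> = (\<integral>\<^sup>+\<omega>. g i (X i \<omega>) * b i (X i \<omega>) \<partial>P)"
        by (rule nn_integral_distr) (use X[OF i] in auto)
      finally show "(\<integral>\<^sup>+\<omega>. b i (X i \<omega>) \<partial>P') = (\<integral>\<^sup>+\<omega>. g i (X i \<omega>) * b i (X i \<omega>) \<partial>P)" .
    qed
    also have "\<dots> = (\<integral>\<^sup>+\<omega>. (\<Prod>i\<in>K \<union> J. g i (X i \<omega>) * b i (X i \<omega>)) \<partial>P)"
      by (rule P.indep_vars_nn_integral[OF fin(1) indgb, symmetric]) simp
    also have "\<dots> = (\<integral>\<^sup>+\<omega>. L \<omega> * indicator (Y -` ?E \<inter> space P) \<omega> \<partial>P)"
    proof (rule nn_integral_cong)
      fix \<omega> assume \<omega>: "\<omega> \<in> space P"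
      have "(\<Prod>i\<in>K \<union> J. g i (X i \<omega>)) = L \<omega>"
        unfolding L_def by (rule prod.mono_neutral_cong_right) (use K J in \<open>auto simp: g_def\<close>)
      then show "(\<Prod>i\<in>K \<union> J. g i (X i \<omega>) * b i (X i \<omega>)) = L \<omega> * indicator (Y -` ?E \<inter> space P) \<omega>"
        by (simp add: prod.distrib ind_E[OF \<omega>])
    qed
    also have "\<dots> = emeasure (density P L) (Y -` ?E \<inter> space P)"
      by (rule emeasure_density[symmetric]) (use measurable_sets[OF Y E] in auto)
    also have "\<dots> = emeasure (distr (density P L) (PiM I (\<lambda>_. N)) Y) ?E"
      by (simp add: emeasure_distr E)
    finally show "emeasure (distr P' (PiM I (\<lambda>_. N)) Y) ?E =
        emeasure (distr (density P L) (PiM I (\<lambda>_. N)) Y) ?E" .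
  next
    show "finite_measure (distr P' (PiM I (\<lambda>_. N)) Y)"
      by (rule P'.finite_measure_distr) (rule Y')
  qed simp_all
  have AP: "A \<in> sets P" using C measurable_sets[OF Y] by simp
  have "emeasure P' A = emeasure (distr P' (PiM I (\<lambda>_. N)) Y) C"
    using C by (simp add: emeasure_distr space_eq)
  also have "\<dots> = emeasure (density P L) A"
    unfolding joint using C by (simp add: emeasure_distr)
  also have "\<dots> = (\<integral>\<^sup>+\<omega>. L \<omega> * indicator A \<omega> \<partial>P)"
    by (rule emeasure_density) (use AP in auto)
  finally show ?thesis by (simp add: L_def)
qed

text \<open>
  At the exponential parameter \<open>1 / 2\<close> of this Chernoff bound, the moment generating function of a
  log-likelihood ratio is a Hellinger affinity.
\<close>

lemma (in prob_space) chernoff_lower_tail: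
  fixes Z :: "'i \<Rightarrow> 'a \<Rightarrow> real"
  assumes J: "finite J" and ind: "indep_vars (\<lambda>_. borel) Z J"
  shows "emeasure M {\<omega> \<in> space M. (\<Sum>i\<in>J. Z i \<omega>) < c}
    \<le> ennreal (exp (c / 2)) * (\<Prod>i\<in>J. \<integral>\<^sup>+\<omega>. ennreal (exp (- (1 / 2) * Z i \<omega>)) \<partial>M)"
proof -
  define S where "S \<omega> = (\<Sum>i\<in>J. Z i \<omega>)" for \<omega>
  have Z[measurable]: "Z i \<in> borel_measurable M" if "i \<in> J" for i
    using ind that by (auto simp: indep_vars_def)
  have [measurable]: "S \<in> borel_measurable M" unfolding S_def[abs_def] by measurable
  have ind2: "indep_vars (\<lambda>_. borel) (\<lambda>i \<omega>. ennreal (exp (- (1 / 2) * Z i \<omega>))) J"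
    by (rule indep_vars_compose2[OF ind]) measurable
  have "emeasure M {\<omega> \<in> space M. S \<omega> < c} = (\<integral>\<^sup>+\<omega>. indicator {\<omega> \<in> space M. S \<omega> < c} \<omega> \<partial>M)"
    by simp
  also have "\<dots> \<le> (\<integral>\<^sup>+\<omega>. ennreal (exp (c / 2)) * ennreal (exp (- (1 / 2) * S \<omega>)) \<partial>M)"
  proof (rule nn_integral_mono)
    fix \<omega>
    show "indicator {\<omega> \<in> space M. S \<omega> < c} \<omega> \<le> ennreal (exp (c / 2)) * ennreal (exp (- (1 / 2) * S \<omega>))"
      by (auto simp: indicator_def ennreal_mult[symmetric] exp_add[symmetric])
  qed
  also have "\<dots> = ennreal (exp (c / 2)) * (\<integral>\<^sup>+\<omega>. ennreal (exp (- (1 / 2) * S \<omega>)) \<partial>M)"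
    by (rule nn_integral_cmult) measurable
  also have "(\<integral>\<^sup>+\<omega>. ennreal (exp (- (1 / 2) * S \<omega>)) \<partial>M)
      = (\<integral>\<^sup>+\<omega>. (\<Prod>i\<in>J. ennreal (exp (- (1 / 2) * Z i \<omega>))) \<partial>M)"
    by (intro nn_integral_cong) (simp add: S_def sum_distrib_left exp_sum[OF J] prod_ennreal)
  also have "\<dots> = (\<Prod>i\<in>J. \<integral>\<^sup>+\<omega>. ennreal (exp (- (1 / 2) * Z i \<omega>)) \<partial>M)"
    by (rule indep_vars_nn_integral[OF J ind2]) simp
  finally show ?thesis by (simp add: S_def)
qed

section \<open>The law of the observations\<close>

locale cascade = regular_tree G k
  for G :: "'a pair_pre_digraph" and k :: nat +
  fixes Q0 Q1 :: "real measure" and M :: "'w measure" and P :: "'a \<Rightarrow> 'w measure"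
    and y :: "'a \<Rightarrow> nat \<Rightarrow> 'w \<Rightarrow> real"
  assumes laws: "equivalent_laws Q0 Q1" and laws_distinct: "Q0 \<noteq> Q1"
    and observations: "cascade_observations G Q0 Q1 M P y"
begin

abbreviation Y :: "'a \<times> nat \<Rightarrow> 'w \<Rightarrow> real" where
  "Y \<equiv> \<lambda>(w, s). y w s"

abbreviation F :: "nat \<Rightarrow> 'w measure" where
  "F t \<equiv> obs_filtration G M y (enat t)"

abbreviation llr :: "'a \<Rightarrow> 'a \<Rightarrow> nat \<Rightarrow> 'w \<Rightarrow> real" where
  "llr \<equiv> llr_stat G Q0 Q1 y"

text \<open>The observations whose law is \<open>Q1\<close> under the source \<open>v\<close> and \<open>Q0\<close> under the source \<open>u\<close>.\<close>

definition separating :: "'a \<Rightarrow> 'a \<Rightarrow> nat \<Rightarrow> ('a \<times> nat) set" where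
  "separating v u t = {(w, s). s \<le> t \<and> w \<in> nbhd G v s - nbhd G u s}"

lemma
  assumes "v \<in> pverts G"
  shows prob_P: "prob_space (P v)" and sets_P: "sets (P v) = sets M"
    and space_P: "space (P v) = space M"
    and indep_Y: "prob_space.indep_vars (P v) (\<lambda>_. borel) Y (pverts G \<times> UNIV)"
    and distr_y: "w \<in> pverts G \<Longrightarrow> distr (P v) borel (y w t) = (if w \<in> nbhd G v t then Q1 else Q0)"
  using observations assms sets_eq_imp_space_eq[of "P v" M]
  unfolding cascade_observations_def by simp_all

lemma y_measurable_P: "v \<in> pverts G \<Longrightarrow> w \<in> pverts G \<Longrightarrow> y w t \<in> borel_measurable (P v)"
  using indep_Y[of v] by (force simp: prob_space.indep_vars_def2[OF prob_P[of v]])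

lemma y_measurable_M: "w \<in> pverts G \<Longrightarrow> y w t \<in> borel_measurable M"
  using y_measurable_P[of w w t] sets_P[of w] measurable_cong_sets[OF sets_P[of w] refl] by auto

lemma obs_generators: "{y u s -` B \<inter> space M | u s B. u \<in> pverts G \<and> enat s \<le> t \<and> B \<in> sets borel} \<subseteq> Pow (space M)"
  by auto

lemma space_F: "space (obs_filtration G M y t) = space M"
  unfolding obs_filtration_def by (rule space_measure_of[OF obs_generators])

lemma sets_F: "sets (obs_filtration G M y t) = sigma_sets (space M)
    {y u s -` B \<inter> space M | u s B. u \<in> pverts G \<and> enat s \<le> t \<and> B \<in> sets borel}"
  unfolding obs_filtration_def by (rule sets_measure_of[OF obs_generators])

lemma sets_F_mono: "t \<le> t' \<Longrightarrow> sets (obs_filtration G M y t) \<subseteq> sets (obs_filtration G M y t')"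
  unfolding sets_F by (rule sigma_sets_mono') (blast intro: order_trans)

lemma sets_F_subset: "sets (obs_filtration G M y t) \<subseteq> sets M"
  unfolding sets_F by (rule sets.sigma_sets_subset) (auto intro: measurable_sets y_measurable_M)

lemma y_measurable_F: "w \<in> pverts G \<Longrightarrow> s \<le> t \<Longrightarrow> y w s \<in> borel_measurable (F t)"
  by (rule measurableI) (auto simp: space_F sets_F intro!: sigma_sets.Basic)

lemma separating_finite: "v \<in> pverts G \<Longrightarrow> finite (separating v u t)"
  by (rule finite_subset[of _ "nbhd G v t \<times> {..t}"])
     (use nbhd_mono[of _ t G v] in \<open>auto simp: separating_def nbhd_finite\<close>)

lemma separating_subset: "separating v u t \<subseteq> pverts G \<times> {..t}"
  using nbhd_subset by (fastforce simp: separating_def)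

lemma separating_disjoint: "separating v u t \<inter> separating u v t = {}"
  by (auto simp: separating_def)

text \<open>
  For an observation \<open>i\<close> that separates \<open>v\<close> and \<open>u\<close>: its contribution to the log-likelihood ratio
  of \<open>v\<close> against \<open>u\<close>.
\<close>

definition increment :: "'a \<Rightarrow> 'a \<Rightarrow> nat \<Rightarrow> 'a \<times> nat \<Rightarrow> real \<Rightarrow> real" where
  "increment v u t i = (if i \<in> separating v u t then log_deriv Q0 Q1 else log_deriv Q1 Q0)"

lemma increment_measurable [measurable]: "increment v u t i \<in> borel_measurable borel"
  using equivalent_laws.log_deriv_measurable[OF laws]
    equivalent_laws.log_deriv_measurable[OF equivalent_laws.swapped[OF laws]]
  by (simp add: increment_def)

lemma llr_eq_sum_separating:
  assumes "u \<in> pverts G" "v \<in> pverts G"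
  shows "llr v u t \<omega> = (\<Sum>i\<in>separating v u t. log_deriv Q0 Q1 (Y i \<omega>)) + (\<Sum>i\<in>separating u v t. log_deriv Q1 Q0 (Y i \<omega>))"
proof -
  have *: "(\<Sum>s\<le>t. \<Sum>w\<in>nbhd G a s - nbhd G b s. g (y w s \<omega>)) = (\<Sum>i\<in>separating a b t. g (Y i \<omega>))"
    if "a \<in> pverts G" for a b and g :: "real \<Rightarrow> real"
  proof -
    have "(\<Sum>s\<le>t. \<Sum>w\<in>nbhd G a s - nbhd G b s. g (y w s \<omega>)) =
        (\<Sum>(s, w)\<in>(SIGMA s:{..t}. nbhd G a s - nbhd G b s). g (y w s \<omega>))"
      using nbhd_finite[OF that] by (intro sum.Sigma) auto
    also have "\<dots> = (\<Sum>i\<in>separating a b t. g (Y i \<omega>))"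
      by (rule sum.reindex_bij_witness[of _ prod.swap prod.swap]) (auto simp: separating_def)
    finally show ?thesis .
  qed
  show ?thesis
    unfolding llr_stat_def sum.distrib *[OF assms(2)] *[OF assms(1)] ..
qed

lemma llr_eq_sum:
  assumes "u \<in> pverts G" "v \<in> pverts G"
  shows "llr v u t \<omega> = (\<Sum>i\<in>separating v u t \<union> separating u v t. increment v u t i (Y i \<omega>))"
proof -
  have "(\<Sum>i\<in>separating u v t. increment v u t i (Y i \<omega>)) = (\<Sum>i\<in>separating u v t. log_deriv Q1 Q0 (Y i \<omega>))"
    by (rule sum.cong) (use separating_disjoint[of v u t] in \<open>auto simp: increment_def\<close>)
  then show ?thesis
    unfolding llr_eq_sum_separating[OF assms]
    by (subst sum.union_disjoint) (auto simp: separating_finite assms separating_disjoint increment_def)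
qed

lemma llr_measurable:
  assumes "u \<in> pverts G" "v \<in> pverts G"
  shows "llr v u t \<in> borel_measurable (F t)"
proof -
  have "(\<lambda>\<omega>. \<Sum>i\<in>separating v u t \<union> separating u v t. increment v u t i (Y i \<omega>)) \<in> borel_measurable (F t)"
  proof (rule borel_measurable_sum)
    fix i assume "i \<in> separating v u t \<union> separating u v t"
    then have "Y i \<in> borel_measurable (F t)"
      using separating_subset[of v u t] separating_subset[of u v t] y_measurable_F[of "fst i" "snd i" t]
      by (cases i) auto
    then show "(\<lambda>\<omega>. increment v u t i (Y i \<omega>)) \<in> borel_measurable (F t)"
      by (rule measurable_compose) simp
  qed
  then show ?thesis using llr_eq_sum[OF assms] by (simp cong: measurable_cong)
qed

lemma distr_Y:
  assumes "v \<in> pverts G" "i \<in> pverts G \<times> UNIV"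
  shows "distr (P v) borel (Y i) = (if fst i \<in> nbhd G v (snd i) then Q1 else Q0)"
  using assms distr_y by (cases i) simp

text \<open>
  The laws of two sources up to time \<open>t\<close> differ only in the finitely many separating observations,
  and the product of their densities is the exponential of the log-likelihood ratio.
\<close>

lemma change_of_source:
  assumes u: "u \<in> pverts G" and v: "v \<in> pverts G" and A: "A \<in> sets (F t)"
  shows "emeasure (P u) A = (\<integral>\<^sup>+\<omega>. ennreal (exp (llr u v t \<omega>)) * indicator A \<omega> \<partial>P v)"
proof -
  let ?I = "pverts G \<times> {..t}" and ?J = "separating u v t \<union> separating v u t"
  let ?f = "\<lambda>i x. ennreal (exp (increment u v t i x))"
  note dens = equivalent_laws.density_exp_log_deriv
  have J: "finite ?J" "?J \<subseteq> ?I" using separating_finite u v separating_subset by auto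
  have "emeasure (P u) A = (\<integral>\<^sup>+\<omega>. (\<Prod>i\<in>?J. ?f i (Y i \<omega>)) * indicator A \<omega> \<partial>P v)"
  proof (rule change_of_measure[where N = borel and I = ?I and J = ?J and X = Y and f = ?f])
    show "prob_space (P v)" "prob_space (P u)" "sets (P u) = sets (P v)"
      using prob_P sets_P u v by auto
    show "prob_space.indep_vars (P v) (\<lambda>_. borel) Y ?I" "prob_space.indep_vars (P u) (\<lambda>_. borel) Y ?I"
      using prob_space.indep_vars_subset[OF prob_P indep_Y, of _ ?I] u v by auto
    show "finite ?J" "?J \<subseteq> ?I" by (fact J)+
    show "?f i \<in> borel_measurable borel" for i by measurable
    show "distr (P u) borel (Y i) = density (distr (P v) borel (Y i)) (?f i)" if i: "i \<in> ?J" for i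
    proof -
      have iG: "i \<in> pverts G \<times> UNIV" using i J(2) by auto
      show ?thesis
      proof (cases "i \<in> separating u v t")
        case True
        then show ?thesis
          unfolding distr_Y[OF u iG] distr_Y[OF v iG]
          by (cases i) (auto simp: increment_def dens[OF laws] separating_def)
      next
        case False
        then have "i \<in> separating v u t" using i by simp
        then show ?thesis
          using False unfolding distr_Y[OF u iG] distr_Y[OF v iG]
          by (cases i) (auto simp: increment_def dens[OF equivalent_laws.swapped[OF laws]] separating_def)
      qed
    qed
    show "distr (P u) borel (Y i) = distr (P v) borel (Y i)" if i: "i \<in> ?I - ?J" for i
    proof -
      have iG: "i \<in> pverts G \<times> UNIV" using i by auto
      show ?thesis
        using i unfolding distr_Y[OF u iG] distr_Y[OF v iG] by (cases i) (auto simp: separating_def)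
    qed
    have "{y u s -` B \<inter> space M | u s B. u \<in> pverts G \<and> enat s \<le> enat t \<and> B \<in> sets borel}
        \<subseteq> {Y i -` B \<inter> space (P v) | i B. i \<in> ?I \<and> B \<in> sets borel}"
      unfolding space_P[OF v] by force
    then show "A \<in> sigma_sets (space (P v)) {Y i -` B \<inter> space (P v) | i B. i \<in> ?I \<and> B \<in> sets borel}"
      using A sigma_sets_mono' unfolding sets_F space_P[OF v] by blast
  qed
  also have "\<dots> = (\<integral>\<^sup>+\<omega>. ennreal (exp (llr u v t \<omega>)) * indicator A \<omega> \<partial>P v)"
    by (rule nn_integral_cong) (simp add: llr_eq_sum[OF v u] exp_sum[OF J(1)] prod_ennreal)
  finally show ?thesis .
qed

end

section \<open>The test controls its errors\<close>

lemma INF_enat_le_iff: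
  fixes f :: "'b \<Rightarrow> enat"
  assumes "V \<noteq> {}"
  shows "(INF v\<in>V. f v) \<le> x \<longleftrightarrow> (\<exists>v\<in>V. f v \<le> x)"
proof
  assume le: "(INF v\<in>V. f v) \<le> x"
  have "(INF v\<in>V. f v) \<in> f ` V" using assms by (intro wellorder_InfI[of "f (SOME v. v \<in> V)"]) (auto simp: some_in_eq)
  then show "\<exists>v\<in>V. f v \<le> x" using le by auto
qed (auto intro: INF_lower2)

text \<open>
  A maximizer over a finite set depends only on the set of all maximizers, which takes finitely
  many values.
\<close>

lemma measurable_arg_max_on:
  fixes f :: "'a \<Rightarrow> 'w \<Rightarrow> ereal"
  assumes V: "finite V" "V \<noteq> {}" and f: "\<And>v. v \<in> V \<Longrightarrow> f v \<in> borel_measurable N"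
  shows "(\<lambda>\<omega>. arg_max_on (\<lambda>v. f v \<omega>) V) \<in> N \<rightarrow>\<^sub>M count_space V"
proof -
  define S where "S \<omega> = {v \<in> V. \<forall>w\<in>V. \<not> f v \<omega> < f w \<omega>}" for \<omega>
  have eq: "arg_max_on (\<lambda>v. f v \<omega>) V = (SOME v. v \<in> S \<omega>)" for \<omega>
    by (simp add: arg_max_on_def arg_max_def is_arg_max_def S_def Bex_def Ball_def)
  have ne: "S \<omega> \<noteq> {}" for \<omega>
  proof -
    have "Max ((\<lambda>v. f v \<omega>) ` V) \<in> (\<lambda>v. f v \<omega>) ` V" using V by (intro Max_in) auto
    then obtain v where "v \<in> V" "f v \<omega> = Max ((\<lambda>v. f v \<omega>) ` V)" by auto
    then have "v \<in> S \<omega>" using V by (auto simp: S_def not_less)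
    then show ?thesis by blast
  qed
  have "S \<in> N \<rightarrow>\<^sub>M count_space (Pow V - {{}})"
  proof (subst measurable_count_space_eq2)
    show "finite (Pow V - {{}})" using V by simp
    show "S \<in> space N \<rightarrow> Pow V - {{}} \<and> (\<forall>A\<in>Pow V - {{}}. S -` {A} \<inter> space N \<in> sets N)"
    proof (intro conjI ballI)
      show "S \<in> space N \<rightarrow> Pow V - {{}}" using ne by (auto simp: S_def)
      fix A assume "A \<in> Pow V - {{}}"
      then have A: "A \<subseteq> V" by simp
      have "{v \<in> V. q v} = A \<longleftrightarrow> (\<forall>v\<in>V. q v \<longleftrightarrow> v \<in> A)" for q using A by blast
      then have "S \<omega> = A \<longleftrightarrow> (\<forall>v\<in>V. (\<forall>w\<in>V. \<not> f v \<omega> < f w \<omega>) \<longleftrightarrow> v \<in> A)" for \<omega>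
        unfolding S_def .
      then have "S -` {A} \<inter> space N =
          {\<omega> \<in> space N. \<forall>v\<in>V. (\<forall>w\<in>V. \<not> f v \<omega> < f w \<omega>) \<longleftrightarrow> v \<in> A}"
        by (simp add: vimage_def Int_def conj_commute)
      also have "\<dots> \<in> sets N"
      proof -
        have "Measurable.pred N (\<lambda>\<omega>. f v \<omega> < f w \<omega>)" if "v \<in> V" "w \<in> V" for v w
          using f[OF that(1)] f[OF that(2)] by measurable
        then have "Measurable.pred N (\<lambda>\<omega>. \<forall>v\<in>V. (\<forall>w\<in>V. \<not> f v \<omega> < f w \<omega>) \<longleftrightarrow> v \<in> A)"
          using V(1) by (intro pred_intros_finite pred_intros_logic) auto
        then show ?thesis by (simp add: pred_def)
      qed
      finally show "S -` {A} \<inter> space N \<in> sets N" .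
    qed
  qed
  moreover have "(\<lambda>A. SOME v. v \<in> A) \<in> count_space (Pow V - {{}}) \<rightarrow>\<^sub>M count_space V"
  proof (subst measurable_count_space_eq1, intro funcsetI)
    fix A assume "A \<in> Pow V - {{}}"
    then show "(SOME v. v \<in> A) \<in> space (count_space V)" using some_in_eq[of A] V(2) by auto
  qed
  ultimately have "(\<lambda>\<omega>. SOME v. v \<in> S \<omega>) \<in> N \<rightarrow>\<^sub>M count_space V"
    by (rule measurable_compose)
  then show ?thesis by (simp add: eq)
qed

context cascade
begin

abbreviation mllr :: "'a set \<Rightarrow> nat \<Rightarrow> 'a \<Rightarrow> nat \<Rightarrow> 'w \<Rightarrow> ereal" where
  "mllr \<equiv> min_llr G Q0 Q1 y"

lemma min_llr_measurable:
  assumes "V \<subseteq> pverts G" "finite V" "v \<in> V"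
  shows "mllr V r v t \<in> borel_measurable (F t)"
  unfolding min_llr_def[abs_def]
  by (rule borel_measurable_INF)
     (use assms llr_measurable[of _ v t] in \<open>auto intro!: countable_finite borel_measurable_ereal\<close>)

lemma F_measurable_mono:
  assumes "s \<le> t" "f \<in> N \<rightarrow>\<^sub>M K" "N = F s"
  shows "f \<in> F t \<rightarrow>\<^sub>M K"
  using assms sets_F_mono[of "enat s" "enat t"] space_F by (auto simp: measurable_def)

lemma msprt_vertex_time_le_iff:
  "msprt_vertex_time G Q0 Q1 y V r \<alpha> v \<omega> \<le> enat t \<longleftrightarrow>
     (\<exists>s\<le>t. ereal (ln (real (card V) / \<alpha>)) \<le> mllr V r v s \<omega>)"
proof
  let ?A = "{enat t | t. ereal (ln (real (card V) / \<alpha>)) \<le> mllr V r v t \<omega>}"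
  assume le: "msprt_vertex_time G Q0 Q1 y V r \<alpha> v \<omega> \<le> enat t"
  have "?A \<noteq> {}"
  proof
    assume "?A = {}"
    then show False using le unfolding msprt_vertex_time_def by (simp only: Inf_enat_def) simp
  qed
  then obtain x where "x \<in> ?A" by blast
  then have "Inf ?A \<in> ?A" by (rule wellorder_InfI)
  then show "\<exists>s\<le>t. ereal (ln (real (card V) / \<alpha>)) \<le> mllr V r v s \<omega>"
    using le unfolding msprt_vertex_time_def by auto
next
  assume "\<exists>s\<le>t. ereal (ln (real (card V) / \<alpha>)) \<le> mllr V r v s \<omega>"
  then obtain s where s: "s \<le> t" "ereal (ln (real (card V) / \<alpha>)) \<le> mllr V r v s \<omega>" by blast
  then have "msprt_vertex_time G Q0 Q1 y V r \<alpha> v \<omega> \<le> enat s"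
    unfolding msprt_vertex_time_def by (intro Inf_lower) auto
  then show "msprt_vertex_time G Q0 Q1 y V r \<alpha> v \<omega> \<le> enat t"
    using s(1) order_trans enat_ord_simps(1) by blast
qed

lemma msprt_time_le_iff:
  assumes "V \<noteq> {}"
  shows "snd (msprt G Q0 Q1 y V r \<alpha>) \<omega> \<le> enat t \<longleftrightarrow>
     (\<exists>v\<in>V. \<exists>s\<le>t. ereal (ln (real (card V) / \<alpha>)) \<le> mllr V r v s \<omega>)"
  by (simp add: msprt_def INF_enat_le_iff[OF assms] msprt_vertex_time_le_iff)

lemma threshold_event:
  assumes V: "V \<subseteq> pverts G" "finite V" "v \<in> V" and "s \<le> t"
  shows "Measurable.pred (F t) (\<lambda>\<omega>. c \<le> mllr V r v s \<omega>)"
proof -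
  have [measurable]: "mllr V r v s \<in> borel_measurable (F t)"
    using F_measurable_mono[OF assms(4) min_llr_measurable[OF V] refl] .
  show ?thesis by measurable
qed

lemma msprt_sequential_estimator:
  assumes V: "V \<subseteq> pverts G" "finite V" "V \<noteq> {}"
  shows "msprt G Q0 Q1 y V r \<alpha> \<in> sequential_estimators G M y V"
proof -
  have "stopping_time (obs_filtration G M y) (snd (msprt G Q0 Q1 y V r \<alpha>))"
  proof
    fix t :: enat
    show "Measurable.pred (obs_filtration G M y t) (\<lambda>\<omega>. snd (msprt G Q0 Q1 y V r \<alpha>) \<omega> \<le> t)"
    proof (cases t)
      case (enat n)
      have "Measurable.pred (F n) (\<lambda>\<omega>. \<exists>v\<in>V. \<exists>s\<in>{..n}. ereal (ln (real (card V) / \<alpha>)) \<le> mllr V r v s \<omega>)"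
        by (intro pred_intros_finite) (use V threshold_event in auto)
      then show ?thesis by (simp add: enat msprt_time_le_iff[OF V(3)] Bex_def)
    qed simp
  qed
  moreover have "fst (msprt G Q0 Q1 y V r \<alpha>) t \<in> F t \<rightarrow>\<^sub>M count_space V" for t
    unfolding msprt_def fst_conv
    by (rule measurable_arg_max_on) (use V min_llr_measurable in auto)
  ultimately show ?thesis
    by (auto simp: sequential_estimators_def split_beta)
qed

lemma estimator_event:
  assumes E: "E \<in> sequential_estimators G M y V"
  shows "{\<omega> \<in> space M. snd E \<omega> = enat t \<and> fst E t \<omega> \<in> S} \<in> sets (F t)"
    and "{\<omega> \<in> space M. snd E \<omega> \<le> enat t} \<in> sets (F t)"
proof -
  have T: "Measurable.pred (F s) (\<lambda>\<omega>. snd E \<omega> \<le> enat s)" for s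
    using E stopping_timeD[of "obs_filtration G M y" "snd E" "enat s"]
    by (auto simp: sequential_estimators_def split_beta)
  have le: "{\<omega> \<in> space M. snd E \<omega> \<le> enat s} \<in> sets (F t)" if "s \<le> t" for s
    using T[of s] sets_F_mono[of "enat s" "enat t"] that by (auto simp: pred_def space_F)
  then show "{\<omega> \<in> space M. snd E \<omega> \<le> enat t} \<in> sets (F t)" by simp
  have D: "fst E t \<in> F t \<rightarrow>\<^sub>M count_space V"
    using E by (auto simp: sequential_estimators_def split_beta)
  have "fst E t -` (S \<inter> V) \<inter> space M \<in> sets (F t)"
    using measurable_sets[OF D, of "S \<inter> V"] by (simp add: space_F)
  moreover have "fst E t -` (S \<inter> V) \<inter> space M = {\<omega> \<in> space M. fst E t \<omega> \<in> S}"
    using measurable_space[OF D] by (auto simp: space_F)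
  ultimately have D': "{\<omega> \<in> space M. fst E t \<omega> \<in> S} \<in> sets (F t)" by simp
  have "snd E \<omega> = enat t \<longleftrightarrow> snd E \<omega> \<le> enat t \<and> \<not> (\<exists>s<t. snd E \<omega> \<le> enat s)" for \<omega>
    by (cases "snd E \<omega>") (auto simp: le_less)
  then have "{\<omega> \<in> space M. snd E \<omega> = enat t \<and> fst E t \<omega> \<in> S} =
      ({\<omega> \<in> space M. snd E \<omega> \<le> enat t} - (\<Union>s<t. {\<omega> \<in> space M. snd E \<omega> \<le> enat s}))
        \<inter> {\<omega> \<in> space M. fst E t \<omega> \<in> S}"
    by auto
  also have "\<dots> \<in> sets (F t)"
    using le D' by (intro sets.Int sets.Diff sets.finite_UN) auto
  finally show "{\<omega> \<in> space M. snd E \<omega> = enat t \<and> fst E t \<omega> \<in> S} \<in> sets (F t)" .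
qed

lemma output_event:
  assumes E: "E \<in> sequential_estimators G M y V"
  shows "{\<omega> \<in> space M. estimator_output E \<omega> = Some u} =
      (\<Union>t. {\<omega> \<in> space M. snd E \<omega> = enat t \<and> fst E t \<omega> \<in> {u}})"
    and "{\<omega> \<in> space M. estimator_output E \<omega> = Some u} \<in> sets M"
proof -
  show eq: "{\<omega> \<in> space M. estimator_output E \<omega> = Some u} =
      (\<Union>t. {\<omega> \<in> space M. snd E \<omega> = enat t \<and> fst E t \<omega> \<in> {u}})"
    by (auto simp: estimator_output_def split: enat.splits)
  show "{\<omega> \<in> space M. estimator_output E \<omega> = Some u} \<in> sets M"
    unfolding eq using subsetD[OF sets_F_subset estimator_event(1)[OF E]]
    by (intro sets.countable_UN) blast
qed

text \<open>
  When the test stops at time \<open>t\<close> with output \<open>u\<close>, the observations are at least \<open>n / \<alpha>\<close> times as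
  likely under \<open>u\<close> as under any \<open>v\<close> far from \<open>u\<close>. Integrating against the law of \<open>v\<close> bounds the
  probability of this error by \<open>\<alpha> / n\<close>.
\<close>

lemma msprt_error:
  assumes V: "V \<subseteq> pverts G" "finite V" and \<alpha>: "0 < \<alpha>"
    and u: "u \<in> V" and v: "v \<in> V" "v \<notin> nbhd G u r"
  shows "emeasure (P v) {\<omega> \<in> space M. estimator_output (msprt G Q0 Q1 y V r \<alpha>) \<omega> = Some u}
      \<le> ennreal (\<alpha> / card V)"
proof -
  define E where "E = msprt G Q0 Q1 y V r \<alpha>"
  define A where "A t = {\<omega> \<in> space M. snd E \<omega> = enat t \<and> fst E t \<omega> \<in> {u}}" for t
  define a where "a = real (card V) / \<alpha>"
  have n: "0 < card V" using V u by (auto simp: card_gt_0_iff)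
  then have a: "0 < a" using \<alpha> by (simp add: a_def)
  have uv: "u \<in> pverts G" "v \<in> pverts G" using u v V by auto
  interpret Pu: prob_space "P u" by (rule prob_P[OF uv(1)])
  interpret Pv: prob_space "P v" by (rule prob_P[OF uv(2)])
  have E: "E \<in> sequential_estimators G M y V"
    unfolding E_def by (rule msprt_sequential_estimator) (use V u in auto)
  have AF: "A t \<in> sets (F t)" for t unfolding A_def by (rule estimator_event[OF E])
  then have AM: "A t \<in> sets M" for t using sets_F_subset by auto
  have disj: "disjoint_family A" by (auto simp: A_def disjoint_family_on_def)
  have large: "a \<le> exp (llr u v t \<omega>)" if \<omega>: "\<omega> \<in> A t" for t \<omega>
  proof -
    have "snd E \<omega> \<le> enat t" using \<omega> by (simp add: A_def)
    then obtain w s where w: "w \<in> V" "s \<le> t" "ereal (ln a) \<le> mllr V r w s \<omega>"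
      using msprt_time_le_iff[of V r \<alpha> \<omega> t] u by (auto simp: E_def a_def)
    have "s = t"
    proof (rule ccontr)
      assume "s \<noteq> t"
      have "snd E \<omega> \<le> enat s"
        using msprt_time_le_iff[of V r \<alpha> \<omega> s] u w by (auto simp: E_def a_def)
      then show False using \<omega> \<open>s \<noteq> t\<close> w(2) by (auto simp: A_def)
    qed
    have fin: "finite V" "V \<noteq> {}" using V u by auto
    have max: "arg_max_on (\<lambda>v. mllr V r v t \<omega>) V = u" using \<omega> by (simp add: A_def E_def msprt_def)
    have "\<exists>x. is_arg_max (\<lambda>v. mllr V r v t \<omega>) (\<lambda>x. x \<in> V) x"
    proof -
      have "Max ((\<lambda>v. mllr V r v t \<omega>) ` V) \<in> (\<lambda>v. mllr V r v t \<omega>) ` V" using fin by (intro Max_in) auto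
      then obtain x where "x \<in> V" "mllr V r x t \<omega> = Max ((\<lambda>v. mllr V r v t \<omega>) ` V)" by auto
      then show ?thesis using fin by (intro exI[of _ x]) (auto simp: is_arg_max_linorder)
    qed
    then have "is_arg_max (\<lambda>v. mllr V r v t \<omega>) (\<lambda>x. x \<in> V) (arg_max_on (\<lambda>v. mllr V r v t \<omega>) V)"
      unfolding arg_max_on_def arg_max_def by (rule someI_ex)
    then have "mllr V r w t \<omega> \<le> mllr V r u t \<omega>"
      using w(1) unfolding max by (simp add: is_arg_max_linorder)
    then have "ereal (ln a) \<le> mllr V r u t \<omega>" using w(3) \<open>s = t\<close> by simp
    also have "\<dots> \<le> ereal (llr u v t \<omega>)"
      unfolding min_llr_def by (rule INF_lower) (use v in simp)
    finally have "exp (ln a) \<le> exp (llr u v t \<omega>)" by simp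
    then show ?thesis using a by simp
  qed
  have "ennreal a * emeasure (P v) (A t) \<le> emeasure (P u) (A t)" for t
  proof -
    have "ennreal a * emeasure (P v) (A t) = (\<integral>\<^sup>+\<omega>. ennreal a * indicator (A t) \<omega> \<partial>P v)"
      using AM[of t] sets_P[OF uv(2)] by (simp add: nn_integral_cmult_indicator)
    also have "\<dots> \<le> (\<integral>\<^sup>+\<omega>. ennreal (exp (llr u v t \<omega>)) * indicator (A t) \<omega> \<partial>P v)"
      by (rule nn_integral_mono) (auto simp: indicator_def intro!: ennreal_leI large)
    also have "\<dots> = emeasure (P u) (A t)" by (rule change_of_source[OF uv AF, symmetric])
    finally show ?thesis .
  qed
  then have "(\<Sum>t. ennreal a * emeasure (P v) (A t)) \<le> (\<Sum>t. emeasure (P u) (A t))"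
    by (intro suminf_le) auto
  also have "\<dots> = emeasure (P u) (\<Union>t. A t)"
    using AM disj sets_P[OF uv(1)] by (intro suminf_emeasure) auto
  also have "\<dots> \<le> 1" by (rule Pu.emeasure_le_1)
  finally have "ennreal a * (\<Sum>t. emeasure (P v) (A t)) \<le> 1" by simp
  also have "(\<Sum>t. emeasure (P v) (A t)) = emeasure (P v) (\<Union>t. A t)"
    using AM disj sets_P[OF uv(2)] by (intro suminf_emeasure) auto
  finally have "ennreal (1 / a) * (ennreal a * emeasure (P v) (\<Union>t. A t)) \<le> ennreal (1 / a) * 1"
    by (rule mult_left_mono) simp
  then have "emeasure (P v) (\<Union>t. A t) \<le> ennreal (1 / a)"
    using a by (simp add: mult.assoc[symmetric] ennreal_mult[symmetric])
  also have "1 / a = \<alpha> / card V" by (simp add: a_def)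
  finally show ?thesis unfolding output_event(1)[OF E, folded E_def, folded A_def] E_def[symmetric]
    using output_event(1)[OF E, of u] by (simp add: A_def)
qed

lemma gdist_gt_iff: "w \<in> pverts G \<Longrightarrow> gdist G u w > ereal (real r) \<longleftrightarrow> w \<notin> nbhd G u r"
  by (auto simp: nbhd_def)

lemma msprt_confidence:
  assumes V: "V \<subseteq> pverts G" "finite V" "V \<noteq> {}" and \<alpha>: "0 < \<alpha>"
  shows "msprt G Q0 Q1 y V r \<alpha> \<in> confidence_class G M P y V r \<alpha>"
  unfolding confidence_class_def
proof (intro CollectI conjI ballI impI)
  show "msprt G Q0 Q1 y V r \<alpha> \<in> sequential_estimators G M y V"
    by (rule msprt_sequential_estimator[OF V])
  fix u v assume uv: "u \<in> V" "v \<in> V" and far: "ereal (real r) < gdist G u v"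
  have vG: "v \<in> pverts G" using uv V by auto
  interpret Pv: prob_space "P v" by (rule prob_P[OF vG])
  have "v \<notin> nbhd G u r" using far gdist_gt_iff[OF vG] by simp
  then have "emeasure (P v) {\<omega> \<in> space (P v). estimator_output (msprt G Q0 Q1 y V r \<alpha>) \<omega> = Some u}
      \<le> ennreal (\<alpha> / card V)"
    unfolding space_P[OF vG] using msprt_error[OF V(1,2) \<alpha> uv] by simp
  then show "measure (P v) {\<omega> \<in> space (P v). estimator_output (msprt G Q0 Q1 y V r \<alpha>) \<omega> = Some u}
      \<le> \<alpha> / card V"
    using \<alpha> by (simp add: Pv.emeasure_eq_measure ennreal_le_iff)
qed

end

section \<open>The test stops quickly\<close>

context cascade
begin

lemma separating_card_ge:
  assumes "u \<in> pverts G" "v \<in> pverts G" "u \<noteq> v"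
  shows "(k - 1) ^ t \<le> card (separating v u t)"
proof -
  have "(k - 1) ^ t \<le> card (nbhd G v t - nbhd G u t)" by (rule nbhd_diff_card_ge[OF assms])
  also have "\<dots> = card ((\<lambda>w. (w, t)) ` (nbhd G v t - nbhd G u t))"
    by (rule card_image[symmetric]) (auto intro: inj_onI)
  also have "\<dots> \<le> card (separating v u t)"
    by (rule card_mono) (use separating_finite[OF assms(2)] in \<open>auto simp: separating_def\<close>)
  finally show ?thesis .
qed

text \<open>
  Every observed state that separates \<open>v\<close> from \<open>u\<close> contributes a factor below 1, the Hellinger
  affinity of the two laws, to the probability that \<open>v\<close> is not told from \<open>u\<close>.
\<close>

lemma llr_lower_tail:
  assumes u: "u \<in> pverts G" and v: "v \<in> pverts G" and "u \<noteq> v"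
    and \<rho>: "(\<integral>\<^sup>+x. ennreal (exp (- (1 / 2) * log_deriv Q0 Q1 x)) \<partial>Q1) \<le> ennreal \<rho>" "0 \<le> \<rho>" "\<rho> \<le> 1"
  shows "emeasure (P v) {\<omega> \<in> space M. llr v u t \<omega> < c} \<le> ennreal (exp (c / 2) * \<rho> ^ ((k - 1) ^ t))"
proof -
  let ?J = "separating v u t \<union> separating u v t"
  let ?a = "\<lambda>i. \<integral>\<^sup>+\<omega>. ennreal (exp (- (1 / 2) * increment v u t i (Y i \<omega>))) \<partial>P v"
  interpret Pv: prob_space "P v" by (rule prob_P[OF v])
  have J: "finite ?J" using separating_finite u v by auto
  have JG: "?J \<subseteq> pverts G \<times> UNIV" using separating_subset by fastforce
  have ind: "Pv.indep_vars (\<lambda>_. borel) (\<lambda>i \<omega>. increment v u t i (Y i \<omega>)) ?J"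
    by (rule Pv.indep_vars_compose2[OF Pv.indep_vars_subset[OF indep_Y[OF v] JG]]) measurable
  have a: "?a i = (\<integral>\<^sup>+x. ennreal (exp (- (1 / 2) * increment v u t i x))
      \<partial>(if fst i \<in> nbhd G v (snd i) then Q1 else Q0))" if "i \<in> ?J" for i
  proof -
    have i: "i \<in> pverts G \<times> UNIV" using that JG by auto
    have Yi: "Y i \<in> borel_measurable (P v)" using i y_measurable_P[OF v] by auto
    have "?a i = (\<integral>\<^sup>+x. ennreal (exp (- (1 / 2) * increment v u t i x)) \<partial>distr (P v) borel (Y i))"
      by (rule nn_integral_distr[OF Yi, symmetric]) measurable
    then show ?thesis by (simp only: distr_Y[OF v i])
  qed
  have a1: "?a i \<le> ennreal \<rho>" if "i \<in> separating v u t" for i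
    using a[of i] that \<rho>(1) by (auto simp: increment_def separating_def)
  have a0: "?a i \<le> 1" if "i \<in> separating u v t" for i
  proof -
    have "i \<notin> separating v u t" "fst i \<notin> nbhd G v (snd i)" using that by (auto simp: separating_def)
    then have "?a i = (\<integral>\<^sup>+x. ennreal (exp (- (1 / 2) * log_deriv Q1 Q0 x)) \<partial>Q0)"
      using a[of i] that by (simp add: increment_def)
    also have "\<dots> < 1"
      using equivalent_laws.hellinger_affinity_less_1[OF equivalent_laws.swapped[OF laws]] laws_distinct
      by simp
    finally show ?thesis by simp
  qed
  have "emeasure (P v) {\<omega> \<in> space M. llr v u t \<omega> < c}
      = emeasure (P v) {\<omega> \<in> space (P v). (\<Sum>i\<in>?J. increment v u t i (Y i \<omega>)) < c}"
    by (simp only: llr_eq_sum[OF u v] space_P[OF v])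
  also have "\<dots> \<le> ennreal (exp (c / 2)) * (\<Prod>i\<in>?J. ?a i)"
    by (rule Pv.chernoff_lower_tail[OF J ind])
  also have "(\<Prod>i\<in>?J. ?a i) = (\<Prod>i\<in>separating v u t. ?a i) * (\<Prod>i\<in>separating u v t. ?a i)"
    by (rule prod.union_disjoint) (use separating_finite u v separating_disjoint in auto)
  also have "\<dots> \<le> (\<Prod>i\<in>separating v u t. ennreal \<rho>) * (\<Prod>i\<in>separating u v t. 1)"
    by (intro mult_mono prod_mono_ennreal) (use a1 a0 in auto)
  also have "\<dots> = ennreal (\<rho> ^ card (separating v u t))" by (simp add: ennreal_power \<rho>(2))
  also have "\<dots> \<le> ennreal (\<rho> ^ ((k - 1) ^ t))"
    by (intro ennreal_leI power_decreasing separating_card_ge assms(3) u v \<rho>(2,3))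
  finally show ?thesis by (simp add: ennreal_mult mult_left_mono \<rho>(2))
qed

text \<open>
  A union bound over the competitors. The Chernoff parameter \<open>1 / 2\<close> turns the threshold
  \<open>log (n / \<alpha>)\<close> into the factor \<open>sqrt (n / \<alpha>)\<close>.
\<close>

lemma msprt_vertex_time_tail:
  assumes V: "V \<subseteq> pverts G" "finite V" and v: "v \<in> V" and \<alpha>: "0 < \<alpha>"
    and \<rho>: "(\<integral>\<^sup>+x. ennreal (exp (- (1 / 2) * log_deriv Q0 Q1 x)) \<partial>Q1) \<le> ennreal \<rho>" "0 \<le> \<rho>" "\<rho> \<le> 1"
  shows "emeasure (P v) {\<omega> \<in> space M. enat t < msprt_vertex_time G Q0 Q1 y V r \<alpha> v \<omega>}
    \<le> ennreal (card V * sqrt (card V / \<alpha>) * \<rho> ^ ((k - 1) ^ t))"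
proof -
  define c where "c = ln (real (card V) / \<alpha>)"
  define W where "W = V - nbhd G v r"
  have vG: "v \<in> pverts G" using V v by auto
  have n: "0 < card V" using V v by (auto simp: card_gt_0_iff)
  have W: "finite W" "card W \<le> card V" using V by (auto simp: W_def intro: card_mono)
  have uW: "u \<in> pverts G" "u \<noteq> v" if "u \<in> W" for u
    using that V nbhd_self[OF vG] by (auto simp: W_def)
  have meas: "{\<omega> \<in> space M. llr v u t \<omega> < c} \<in> sets (P v)" if "u \<in> W" for u
  proof -
    have [measurable]: "llr v u t \<in> borel_measurable (F t)" by (rule llr_measurable[OF uW(1)[OF that] vG])
    have "{\<omega> \<in> space (F t). llr v u t \<omega> < c} \<in> sets (F t)" by measurable
    then show ?thesis using sets_F_subset sets_P[OF vG] by (auto simp: space_F)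
  qed
  have "{\<omega> \<in> space M. enat t < msprt_vertex_time G Q0 Q1 y V r \<alpha> v \<omega>}
      \<subseteq> (\<Union>u\<in>W. {\<omega> \<in> space M. llr v u t \<omega> < c})"
  proof
    fix \<omega> assume \<omega>: "\<omega> \<in> {\<omega> \<in> space M. enat t < msprt_vertex_time G Q0 Q1 y V r \<alpha> v \<omega>}"
    then have "\<not> ereal c \<le> mllr V r v t \<omega>"
      using msprt_vertex_time_le_iff[of V r \<alpha> v \<omega> t] by (auto simp: c_def not_le)
    then obtain u where "u \<in> W" "\<not> ereal c \<le> ereal (llr v u t \<omega>)"
      unfolding min_llr_def W_def le_INF_iff by blast
    then show "\<omega> \<in> (\<Union>u\<in>W. {\<omega> \<in> space M. llr v u t \<omega> < c})"
      using \<omega> by (auto simp: not_le)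
  qed
  then have "emeasure (P v) {\<omega> \<in> space M. enat t < msprt_vertex_time G Q0 Q1 y V r \<alpha> v \<omega>}
      \<le> emeasure (P v) (\<Union>u\<in>W. {\<omega> \<in> space M. llr v u t \<omega> < c})"
    by (rule emeasure_mono) (use meas W(1) in auto)
  also have "\<dots> \<le> (\<Sum>u\<in>W. emeasure (P v) {\<omega> \<in> space M. llr v u t \<omega> < c})"
    by (rule emeasure_subadditive_finite) (use meas W(1) in auto)
  also have "\<dots> \<le> (\<Sum>u\<in>W. ennreal (exp (c / 2) * \<rho> ^ ((k - 1) ^ t)))"
    by (rule sum_mono) (use llr_lower_tail[OF uW(1) vG uW(2) \<rho>] in auto)
  also have "\<dots> = ennreal (card W * (exp (c / 2) * \<rho> ^ ((k - 1) ^ t)))"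
    using \<rho>(2) by (simp add: ennreal_mult ennreal_of_nat_eq_real_of_nat)
  also have "\<dots> \<le> ennreal (card V * (exp (c / 2) * \<rho> ^ ((k - 1) ^ t)))"
    using W(2) \<rho>(2) by (intro ennreal_leI mult_right_mono) auto
  also have "exp (c / 2) = sqrt (card V / \<alpha>)"
    using n \<alpha> by (simp add: c_def ln_sqrt[symmetric])
  finally show ?thesis by (simp add: mult.assoc)
qed

text \<open>
  The tail bound decays doubly exponentially: splitting \<open>\<rho> = s\<^sup>2\<close>, one factor \<open>s\<close> sums the tail
  as a geometric series, the other one makes it small after time \<open>t0\<close>.
\<close>

lemma msprt_expected_time_le:
  obtains s :: real where "0 < s" and "s < 1"
    and "\<And>V r \<alpha> t0. V \<subseteq> pverts G \<Longrightarrow> finite V \<Longrightarrow> V \<noteq> {} \<Longrightarrow> 0 < \<alpha> \<Longrightarrow>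
      worst_expected_time P V (msprt G Q0 Q1 y V r \<alpha>)
        \<le> ennreal (t0 + card V * sqrt (card V / \<alpha>) * s ^ ((k - 1) ^ t0) / (1 - s))"
proof -
  define a where "a = (\<integral>\<^sup>+x. ennreal (exp (- (1 / 2) * log_deriv Q0 Q1 x)) \<partial>Q1)"
  have "a < 1"
    unfolding a_def using equivalent_laws.hellinger_affinity_less_1[OF laws laws_distinct] .
  then obtain a' where a': "a = ennreal a'" "0 \<le> a'" "a' < 1"
    by (cases a) (auto simp: ennreal_less_one_iff)
  \<comment> \<open>The maximum makes \<open>s\<close> positive.\<close>
  define s where "s = max (sqrt a') (1 / 2)"
  have s: "0 < s" "s < 1" using a' by (auto simp: s_def real_sqrt_less_iff[of a' 1, simplified])
  have "a' = (sqrt a')\<^sup>2" using a' by simp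
  also have "\<dots> \<le> s\<^sup>2" by (rule power_mono) (use a' in \<open>auto simp: s_def\<close>)
  finally have a_le: "a \<le> ennreal (s\<^sup>2)" by (simp add: a'(1) ennreal_leI)
  have s2: "0 \<le> s\<^sup>2" "s\<^sup>2 \<le> 1" using s by (auto intro: power_le_one)
  have "worst_expected_time P V (msprt G Q0 Q1 y V r \<alpha>)
        \<le> ennreal (t0 + card V * sqrt (card V / \<alpha>) * s ^ ((k - 1) ^ t0) / (1 - s))"
    if V: "V \<subseteq> pverts G" "finite V" "V \<noteq> {}" and \<alpha>: "0 < \<alpha>" for V r \<alpha> t0
    unfolding worst_expected_time_def
  proof (rule SUP_least)
    fix v assume v: "v \<in> V"
    have vG: "v \<in> pverts G" using V v by auto
    interpret Pv: prob_space "P v" by (rule prob_P[OF vG])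
    define T where "T = msprt_vertex_time G Q0 Q1 y V r \<alpha> v"
    define K where "K = card V * sqrt (card V / \<alpha>)"
    define X where "X = (k - 1) ^ t0"
    have K: "0 \<le> K" using \<alpha> by (simp add: K_def)
    have T_le: "{\<omega> \<in> space M. T \<omega> \<le> enat t} \<in> sets (P v)" for t
    proof -
      have "T \<omega> \<le> enat t \<longleftrightarrow> (\<exists>j\<in>{..t}. ereal (ln (real (card V) / \<alpha>)) \<le> mllr V r v j \<omega>)" for \<omega>
        unfolding T_def msprt_vertex_time_le_iff by auto
      moreover have "Measurable.pred (F t)
          (\<lambda>\<omega>. \<exists>j\<in>{..t}. ereal (ln (real (card V) / \<alpha>)) \<le> mllr V r v j \<omega>)"
        by (intro pred_intros_finite) (use V v threshold_event in auto)
      ultimately have "Measurable.pred (F t) (\<lambda>\<omega>. T \<omega> \<le> enat t)" by (simp only:)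
      then have "{\<omega> \<in> space M. T \<omega> \<le> enat t} \<in> sets (F t)" by (simp add: pred_def space_F)
      then show ?thesis using sets_F_subset sets_P[OF vG] by auto
    qed
    have "T \<in> borel_measurable (P v)"
    proof (rule borel_measurableI_le)
      fix t :: enat
      show "{\<omega> \<in> space (P v). T \<omega> \<le> t} \<in> sets (P v)"
        using T_le by (cases t) (auto simp: space_P[OF vG] sets_P[OF vG])
    qed
    then have Tm: "T \<in> P v \<rightarrow>\<^sub>M count_space UNIV"
      using measurable_cong_sets[OF refl sets_borel_eq_count_space, of "P v"] by blast
    have tail: "emeasure (P v) {\<omega> \<in> space (P v). enat t < T \<omega>}
        \<le> ennreal (if t < t0 then 1 else 0) + ennreal (K * s ^ X * s ^ t)" for t
    proof (cases "t < t0")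
      case True
      have "emeasure (P v) {\<omega> \<in> space (P v). enat t < T \<omega>} \<le> 1" by (rule Pv.emeasure_le_1)
      then show ?thesis using True by (simp add: add_increasing2)
    next
      case False
      have pow: "X + t \<le> (k - 1) ^ t + (k - 1) ^ t"
      proof (rule add_mono)
        show "X \<le> (k - 1) ^ t" unfolding X_def by (rule power_increasing) (use False k_ge_3 in auto)
        have "t \<le> 2 ^ t" by (simp add: less_imp_le)
        also have "\<dots> \<le> (k - 1) ^ t" by (rule power_mono) (use k_ge_3 in auto)
        finally show "t \<le> (k - 1) ^ t" .
      qed
      have "emeasure (P v) {\<omega> \<in> space (P v). enat t < T \<omega>} \<le> ennreal (K * (s\<^sup>2) ^ ((k - 1) ^ t))"
        unfolding T_def K_def space_P[OF vG]
        by (rule msprt_vertex_time_tail[OF V(1,2) v \<alpha> a_le[unfolded a_def] s2])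
      also have "(s\<^sup>2) ^ ((k - 1) ^ t) = s ^ ((k - 1) ^ t + (k - 1) ^ t)"
        by (simp add: power_mult[symmetric] mult_2)
      also have "ennreal (K * \<dots>) \<le> ennreal (K * s ^ (X + t))"
        by (intro ennreal_leI mult_left_mono power_decreasing pow K) (use s in auto)
      finally show ?thesis using False by (simp add: power_add mult.assoc)
    qed
    have "snd (msprt G Q0 Q1 y V r \<alpha>) \<omega> \<le> T \<omega>" for \<omega>
      unfolding msprt_def T_def snd_conv by (rule INF_lower[OF v])
    then have "(\<integral>\<^sup>+\<omega>. ennreal_of_enat (snd (msprt G Q0 Q1 y V r \<alpha>) \<omega>) \<partial>P v) \<le> (\<integral>\<^sup>+\<omega>. ennreal_of_enat (T \<omega>) \<partial>P v)"
      by (intro nn_integral_mono) simp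
    also have "\<dots> = (\<Sum>t. emeasure (P v) {\<omega> \<in> space (P v). enat t < T \<omega>})"
      by (rule nn_integral_enat_function[OF Tm])
    also have "\<dots> \<le> (\<Sum>t. ennreal (if t < t0 then 1 else 0) + ennreal (K * s ^ X * s ^ t))"
      by (rule suminf_le) (use tail in auto)
    also have "\<dots> = (\<Sum>t. ennreal (if t < t0 then 1 else 0)) + (\<Sum>t. ennreal (K * s ^ X * s ^ t))"
      by (rule suminf_add[symmetric]) auto
    also have "(\<Sum>t. ennreal (if t < t0 then 1 else 0)) = ennreal t0"
    proof -
      have "(\<Sum>t. ennreal (if t < t0 then 1 else 0)) = (\<Sum>t<t0. ennreal (if t < t0 then 1 else 0))"
        by (rule suminf_finite) auto
      then show ?thesis by (simp add: ennreal_of_nat_eq_real_of_nat)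
    qed
    also have "(\<Sum>t. ennreal (K * s ^ X * s ^ t)) = ennreal (K * s ^ X / (1 - s))"
    proof (rule suminf_ennreal_eq)
      show "(\<lambda>t. K * s ^ X * s ^ t) sums (K * s ^ X / (1 - s))"
        using sums_mult[OF geometric_sums[of s], of "K * s ^ X"] s by simp
    qed (use K s in simp)
    also have "ennreal t0 + ennreal (K * s ^ X / (1 - s)) = ennreal (t0 + K * s ^ X / (1 - s))"
      using K s by (intro ennreal_plus[symmetric]) auto
    finally show "(\<integral>\<^sup>+\<omega>. ennreal_of_enat (snd (msprt G Q0 Q1 y V r \<alpha>) \<omega>) \<partial>P v)
        \<le> ennreal (t0 + card V * sqrt (card V / \<alpha>) * s ^ ((k - 1) ^ t0) / (1 - s))"
      by (simp only: K_def X_def)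
  qed
  then show ?thesis using that[OF s] by blast
qed

end

section \<open>No estimator stops earlier\<close>

context cascade
begin

text \<open>The observations of law \<open>Q1\<close> under the source \<open>v\<close>, up to time \<open>t\<close>.\<close>

definition past :: "'a \<Rightarrow> nat \<Rightarrow> ('a \<times> nat) set" where
  "past v t = {(w, s). s \<le> t \<and> w \<in> nbhd G v s}"

lemma past_finite: "v \<in> pverts G \<Longrightarrow> finite (past v t)"
  by (rule finite_subset[of _ "nbhd G v t \<times> {..t}"])
     (use nbhd_mono[of _ t G v] in \<open>auto simp: past_def nbhd_finite\<close>)

lemma past_subset: "past v t \<subseteq> nbhd G v t \<times> {..t}"
  using nbhd_mono[of _ t G v] by (auto simp: past_def)

lemma past_card_le:
  assumes "v \<in> pverts G"
  shows "card (past v t) \<le> (t + 1) * (3 * (k - 1) ^ t)"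
proof -
  have "card (past v t) \<le> card (nbhd G v t \<times> {..t})"
    by (rule card_mono[OF _ past_subset]) (simp add: nbhd_finite assms)
  also have "\<dots> = (t + 1) * card (nbhd G v t)" by (simp add: card_cartesian_product)
  also have "\<dots> \<le> (t + 1) * (3 * (k - 1) ^ t)" by (rule mult_left_mono[OF nbhd_card_le[OF assms]]) simp
  finally show ?thesis .
qed

lemma past_disjoint:
  assumes "u \<notin> nbhd G v (t + t)"
  shows "past u t \<inter> past v t = {}"
  using nbhd_disjoint[OF assms] past_subset by blast

lemma separating_eq_past:
  assumes "u \<notin> nbhd G v (t + t)"
  shows "separating v u t = past v t" "separating u v t = past u t"
  using past_disjoint[OF assms] by (auto simp: separating_def past_def)

lemma far_if_outside_larger_ball: "u \<notin> nbhd G v s \<Longrightarrow> t \<le> s \<Longrightarrow> u \<notin> nbhd G v t"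
  using nbhd_mono[of t s G v] by blast

text \<open>
  Under \<open>Q0\<close> the logarithmic density need not have a finite mean, so that a quantile takes the
  place of Markov's inequality. It exists because the logarithmic density is finite everywhere.
\<close>

lemma log_deriv_lower_quantile:
  obtains C where "0 \<le> C" and "1 / 2 \<le> measure Q0 {x. - C \<le> log_deriv Q0 Q1 x}"
proof -
  interpret laws: equivalent_laws Q0 Q1 by (rule laws)
  define A where "A n = {x. - real n \<le> log_deriv Q0 Q1 x}" for n :: nat
  have A: "A n \<in> sets Q0" for n unfolding A_def laws.sets_Q by measurable
  have "(\<lambda>n. measure Q0 (A n)) \<longlonglongrightarrow> measure Q0 (\<Union>n. A n)"
    by (rule laws.Q.finite_Lim_measure_incseq) (use A in \<open>auto simp: A_def incseq_def\<close>)
  moreover have "(\<Union>n. A n) = space Q0"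
  proof -
    have "\<exists>n::nat. - real n \<le> x" for x using real_arch_simple[of "- x"] by (auto simp: minus_le_iff)
    then show ?thesis by (auto simp: A_def sets_eq_imp_space_eq[OF laws.sets_Q])
  qed
  ultimately have "(\<lambda>n. measure Q0 (A n)) \<longlonglongrightarrow> 1" by (simp add: laws.Q.prob_space)
  then have "\<forall>\<^sub>F n in sequentially. 1 / 2 < measure Q0 (A n)" by (rule order_tendstoD) simp
  then obtain n where "1 / 2 < measure Q0 (A n)" by (auto simp: eventually_sequentially)
  then show ?thesis using that[of "real n"] by (simp add: A_def)
qed

lemma measure_distr_Y:
  assumes "v \<in> pverts G" "i \<in> pverts G \<times> UNIV" "B \<in> sets borel"
  shows "measure (P v) (Y i -` B \<inter> space (P v)) = measure (if fst i \<in> nbhd G v (snd i) then Q1 else Q0) B"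
proof -
  have "Y i \<in> borel_measurable (P v)" using assms y_measurable_P by auto
  then show ?thesis using measure_distr[of "Y i" "P v" borel B] assms(3) distr_Y[OF assms(1,2)] by simp
qed

text \<open>No observation near \<open>u\<close> speaks strongly against the source \<open>u\<close>.\<close>

definition plausible :: "real \<Rightarrow> 'a \<Rightarrow> nat \<Rightarrow> 'w set" where
  "plausible C u t = {\<omega> \<in> space M. \<forall>i\<in>past u t. - C \<le> log_deriv Q0 Q1 (Y i \<omega>)}"

lemma plausible_measurable: "u \<in> pverts G \<Longrightarrow> plausible C u t \<in> sets (F t)"
proof -
  assume u: "u \<in> pverts G"
  have "Measurable.pred (F t) (\<lambda>\<omega>. \<forall>i\<in>past u t. - C \<le> log_deriv Q0 Q1 (Y i \<omega>))"
  proof (rule pred_intros_finite(3)[OF past_finite[OF u]])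
    fix i assume "i \<in> past u t"
    then have Y: "Y i \<in> borel_measurable (F t)"
      using past_subset[of u t] nbhd_subset[of G u t] y_measurable_F[of "fst i" "snd i" t]
      by (cases i) auto
    have "(\<lambda>\<omega>. log_deriv Q0 Q1 (Y i \<omega>)) \<in> borel_measurable (F t)"
      by (rule measurable_compose[OF Y equivalent_laws.log_deriv_measurable[OF laws]])
    then show "Measurable.pred (F t) (\<lambda>\<omega>. - C \<le> log_deriv Q0 Q1 (Y i \<omega>))" by measurable
  qed
  then show ?thesis by (simp add: plausible_def pred_def space_F)
qed

text \<open>
  Under the law of \<open>v\<close>, the neighbourhoods of vertices far from \<open>v\<close> consist of observations of
  law \<open>Q0\<close>. Each of these has probability at least \<open>1 / 2\<close> not to speak strongly against being of
  law \<open>Q1\<close>. Among many far vertices with disjoint neighbourhoods, one is likely to have a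
  neighbourhood without any strong evidence against it.
\<close>

lemma none_plausible_prob:
  assumes v: "v \<in> pverts G" and U: "U \<subseteq> pverts G" "finite U" "U \<noteq> {}"
    and far: "\<And>u. u \<in> U \<Longrightarrow> u \<notin> nbhd G v (t + t)"
    and sep: "\<And>u u'. u \<in> U \<Longrightarrow> u' \<in> U \<Longrightarrow> u \<noteq> u' \<Longrightarrow> u' \<notin> nbhd G u (t + t)"
    and C: "1 / 2 \<le> measure Q0 {x. - C \<le> log_deriv Q0 Q1 x}"
    and N: "\<And>u. u \<in> U \<Longrightarrow> card (past u t) \<le> N"
  shows "measure (P v) (space M - (\<Union>u\<in>U. plausible C u t)) \<le> exp (- (card U * (1 / 2) ^ N))"
proof -
  interpret Pv: prob_space "P v" by (rule prob_P[OF v])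
  define H where "H = {x. - C \<le> log_deriv Q0 Q1 x}"
  have H: "H \<in> sets borel"
    unfolding H_def using equivalent_laws.log_deriv_measurable[OF laws] by measurable
  have PG: "past u t \<subseteq> pverts G \<times> UNIV" for u using past_subset nbhd_subset by fastforce
  have pl_M: "plausible C u t \<in> sets (P v)" if "u \<in> U" for u
    using plausible_measurable[of u C t] that U sets_F_subset sets_P[OF v] by blast
  have pl_eq: "plausible C u t = (\<Inter>i\<in>past u t. Y i -` H \<inter> space (P v))" if "u \<in> U" for u
  proof -
    have "(u, 0) \<in> past u t" using that U nbhd_self[of u] by (auto simp: past_def)
    then show ?thesis by (auto simp: plausible_def H_def space_P[OF v])
  qed
  have pl_prob: "(1 / 2) ^ N \<le> measure (P v) (plausible C u t)" if u: "u \<in> U" for u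
  proof -
    have uG: "u \<in> pverts G" using u U by auto
    have ne: "past u t \<noteq> {}" using nbhd_self[OF uG] by (auto simp: past_def)
    have "(1 / 2) ^ N \<le> (1 / 2 :: real) ^ card (past u t)" by (rule power_decreasing) (use N[OF u] in auto)
    also have "\<dots> = (\<Prod>i\<in>past u t. 1 / 2)" by simp
    also have "\<dots> \<le> (\<Prod>i\<in>past u t. measure (P v) (Y i -` H \<inter> space (P v)))"
    proof (rule prod_mono, rule conjI)
      fix i assume i: "i \<in> past u t"
      have "fst i \<notin> nbhd G v (snd i)"
        using past_disjoint[OF far[OF u]] i by (cases i) (auto simp: past_def)
      moreover have "i \<in> pverts G \<times> UNIV" using PG i by blast
      ultimately show "1 / 2 \<le> measure (P v) (Y i -` H \<inter> space (P v))"
        using C measure_distr_Y[OF v _ H, of i] by (simp add: H_def)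
    qed simp
    also have "\<dots> = measure (P v) (\<Inter>i\<in>past u t. Y i -` H \<inter> space (P v))"
      by (rule Pv.indep_varsD[OF indep_Y[OF v] ne past_finite[OF uG] PG H, symmetric])
    finally show ?thesis by (simp add: pl_eq[OF u])
  qed
  define X where "X u \<omega> = restrict (\<lambda>i. Y i \<omega>) (past u t)" for u \<omega>
  define B where "B u = {x \<in> space (PiM (past u t) (\<lambda>_. borel)). \<not> (\<forall>i\<in>past u t. x i \<in> H)}" for u
  have disj: "disjoint_family_on (\<lambda>u. past u t) U"
    unfolding disjoint_family_on_def
  proof (intro ballI impI)
    fix u u' assume "u \<in> U" "u' \<in> U" "u \<noteq> u'"
    then have "u' \<notin> nbhd G u (t + t)" by (rule sep)
    from past_disjoint[OF this] show "past u t \<inter> past u' t = {}" by blast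
  qed
  have ind: "Pv.indep_vars (\<lambda>u. PiM (past u t) (\<lambda>_. borel)) X U"
    unfolding X_def[abs_def]
    by (rule Pv.indep_vars_restrict[OF indep_Y[OF v] _ disj]) (rule PG)
  have B: "B u \<in> sets (PiM (past u t) (\<lambda>_. borel))" if "u \<in> U" for u
  proof -
    have "Measurable.pred (PiM (past u t) (\<lambda>_. borel)) (\<lambda>x. \<forall>i\<in>past u t. x i \<in> H)"
    proof (rule pred_intros_finite(3))
      show "finite (past u t)" using past_finite that U by blast
      fix i assume "i \<in> past u t"
      then have "(\<lambda>x. x i) \<in> borel_measurable (PiM (past u t) (\<lambda>_. borel))"
        by (rule measurable_component_singleton)
      then show "Measurable.pred (PiM (past u t) (\<lambda>_. borel)) (\<lambda>x. x i \<in> H)"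
        using H by (rule pred_sets2[rotated])
    qed
    then show ?thesis unfolding B_def by measurable
  qed
  have XB: "X u -` B u \<inter> space (P v) = space (P v) - plausible C u t" if "u \<in> U" for u
    by (auto simp: X_def B_def space_PiM plausible_def H_def space_P[OF v])
  have "(\<Inter>u\<in>U. X u -` B u \<inter> space (P v)) = (\<Inter>u\<in>U. space (P v) - plausible C u t)"
    by (rule INF_cong[OF refl XB])
  also have "\<dots> = space M - (\<Union>u\<in>U. plausible C u t)"
    using U(3) by (auto simp: space_P[OF v])
  finally have "measure (P v) (space M - (\<Union>u\<in>U. plausible C u t))
      = measure (P v) (\<Inter>u\<in>U. X u -` B u \<inter> space (P v))" by simp
  also have "\<dots> = (\<Prod>u\<in>U. measure (P v) (X u -` B u \<inter> space (P v)))"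
    by (rule Pv.indep_varsD_finite[OF ind U(3,2) B])
  also have "\<dots> \<le> (\<Prod>u\<in>U. exp (- ((1 / 2) ^ N)))"
  proof (rule prod_mono, rule conjI)
    fix u assume u: "u \<in> U"
    have "measure (P v) (X u -` B u \<inter> space (P v)) = 1 - measure (P v) (plausible C u t)"
      unfolding XB[OF u] by (rule Pv.prob_compl[OF pl_M[OF u]])
    also have "\<dots> \<le> 1 + - ((1 / 2) ^ N)" using pl_prob[OF u] by simp
    also have "\<dots> \<le> exp (- ((1 / 2) ^ N))" by (rule exp_ge_add_one_self)
    finally show "measure (P v) (X u -` B u \<inter> space (P v)) \<le> exp (- ((1 / 2) ^ N))" .
  qed simp
  also have "\<dots> = exp (- (card U * (1 / 2) ^ N))" by (simp add: exp_of_nat_mult[symmetric])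
  finally show ?thesis .
qed

definition moderate :: "real \<Rightarrow> 'a \<Rightarrow> nat \<Rightarrow> 'w set" where
  "moderate b v t = {\<omega> \<in> space M. (\<Sum>i\<in>past v t. \<bar>log_deriv Q1 Q0 (Y i \<omega>)\<bar>) < b}"

text \<open>
  The observations in the neighbourhood of the source are of law \<open>Q1\<close>; finiteness of the
  Kullback-Leibler divergence bounds, through Markov's inequality, the evidence that they carry.
\<close>

lemma moderate_prob:
  assumes KL: "integrable Q1 (log_deriv Q0 Q1)" and v: "v \<in> pverts G" and b: "0 < b"
    and N: "card (past v t) \<le> N"
  shows "moderate b v t \<in> sets (F t)"
    and "measure (P v) (space M - moderate b v t) \<le> N * (\<integral>x. \<bar>log_deriv Q1 Q0 x\<bar> \<partial>Q1) / b"
proof -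
  interpret Pv: prob_space "P v" by (rule prob_P[OF v])
  interpret laws: equivalent_laws Q0 Q1 by (rule laws)
  let ?l = "\<lambda>x. \<bar>log_deriv Q1 Q0 x\<bar>"
  define S where "S \<omega> = (\<Sum>i\<in>past v t. ?l (Y i \<omega>))" for \<omega>
  have lm[measurable]: "log_deriv Q1 Q0 \<in> borel_measurable borel"
    by (rule equivalent_laws.log_deriv_measurable[OF laws.swapped])
  have "integrable Q1 (\<lambda>x. - log_deriv Q0 Q1 x)" using KL by simp
  then have "integrable Q1 (log_deriv Q1 Q0)"
    by (rule integrable_cong_AE_imp) (use laws.log_deriv_swap in \<open>auto elim: eventually_mono\<close>)
  then have int: "integrable Q1 ?l" by (rule integrable_abs)
  have YF: "Y i \<in> borel_measurable (F t)" if "i \<in> past v t" for i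
    using that past_subset[of v t] nbhd_subset[of G v t] y_measurable_F[of "fst i" "snd i" t]
    by (cases i) auto
  have "S \<in> borel_measurable (F t)"
    unfolding S_def[abs_def]
  proof (rule borel_measurable_sum)
    fix i assume "i \<in> past v t"
    from YF[OF this] show "(\<lambda>\<omega>. ?l (Y i \<omega>)) \<in> borel_measurable (F t)"
      by (rule measurable_compose) measurable
  qed
  then have "{\<omega> \<in> space (F t). S \<omega> < b} \<in> sets (F t)" by measurable
  then show "moderate b v t \<in> sets (F t)" by (simp add: moderate_def S_def space_F)
  have Yi: "Y i \<in> borel_measurable (P v)" "distr (P v) borel (Y i) = Q1" if "i \<in> past v t" for i
    using that past_subset[of v t] nbhd_subset[of G v t] y_measurable_P[OF v, of "fst i" "snd i"]
      distr_Y[OF v, of i] by (cases i; auto simp: past_def)+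
  have inti: "integrable (P v) (\<lambda>\<omega>. ?l (Y i \<omega>))" "(\<integral>\<omega>. ?l (Y i \<omega>) \<partial>P v) = (\<integral>x. ?l x \<partial>Q1)"
    if "i \<in> past v t" for i
  proof -
    show "integrable (P v) (\<lambda>\<omega>. ?l (Y i \<omega>))"
      using integrable_distr_eq[OF Yi(1)[OF that], of ?l] int Yi(2)[OF that] by simp
    show "(\<integral>\<omega>. ?l (Y i \<omega>) \<partial>P v) = (\<integral>x. ?l x \<partial>Q1)"
      using integral_distr[OF Yi(1)[OF that], of ?l] Yi(2)[OF that] by simp
  qed
  have intS: "integrable (P v) S" unfolding S_def[abs_def] using inti(1) by (rule Bochner_Integration.integrable_sum)
  have "measure (P v) (space M - moderate b v t) = measure (P v) {\<omega> \<in> space (P v). b \<le> S \<omega>}"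
    by (rule arg_cong[of _ _ "measure (P v)"]) (auto simp: moderate_def S_def space_P[OF v])
  also have "\<dots> \<le> (\<integral>\<omega>. S \<omega> \<partial>P v) / b"
    by (rule integral_Markov_inequality_measure[OF intS, of "{}"]) (use b in \<open>auto simp: S_def sum_nonneg\<close>)
  also have "(\<integral>\<omega>. S \<omega> \<partial>P v) = card (past v t) * (\<integral>x. ?l x \<partial>Q1)"
    unfolding S_def using inti by (subst Bochner_Integration.integral_sum) auto
  also have "card (past v t) * (\<integral>x. ?l x \<partial>Q1) / b \<le> N * (\<integral>x. ?l x \<partial>Q1) / b"
    using N b by (intro divide_right_mono mult_right_mono) auto
  finally show "measure (P v) (space M - moderate b v t) \<le> N * (\<integral>x. ?l x \<partial>Q1) / b" .
qed

text \<open>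
  On these events the observations are almost as likely under \<open>u\<close> as under \<open>v\<close>, so that an event
  that is likely under \<open>v\<close> cannot be very unlikely under \<open>u\<close>.
\<close>

lemma confusion:
  assumes u: "u \<in> pverts G" and v: "v \<in> pverts G" and far: "u \<notin> nbhd G v (t + t)"
    and A: "A \<in> sets (F t)" and C: "0 \<le> C" and N: "card (past u t) \<le> N"
    and sub: "A \<subseteq> plausible C u t \<inter> moderate b v t"
  shows "measure (P v) A \<le> exp (C * N + b) * measure (P u) A"
proof -
  interpret Pu: prob_space "P u" by (rule prob_P[OF u])
  interpret Pv: prob_space "P v" by (rule prob_P[OF v])
  have AM: "A \<in> sets (P v)" using A sets_F_subset sets_P[OF v] by blast
  have ge: "- (C * N + b) \<le> llr u v t \<omega>" if "\<omega> \<in> A" for \<omega>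
  proof -
    have \<omega>: "\<omega> \<in> plausible C u t" "\<omega> \<in> moderate b v t" using that sub by auto
    have "- (C * N) \<le> - (C * card (past u t))" using C N by (simp add: mult_left_mono)
    also have "\<dots> = (\<Sum>i\<in>past u t. - C)" by simp
    also have "\<dots> \<le> (\<Sum>i\<in>past u t. log_deriv Q0 Q1 (Y i \<omega>))"
      by (rule sum_mono) (use \<omega>(1) in \<open>simp add: plausible_def\<close>)
    finally have 1: "- (C * N) \<le> (\<Sum>i\<in>past u t. log_deriv Q0 Q1 (Y i \<omega>))" .
    have "\<bar>\<Sum>i\<in>past v t. log_deriv Q1 Q0 (Y i \<omega>)\<bar> \<le> (\<Sum>i\<in>past v t. \<bar>log_deriv Q1 Q0 (Y i \<omega>)\<bar>)"
      by (rule sum_abs)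
    also have "\<dots> < b" using \<omega>(2) by (simp add: moderate_def)
    finally have 2: "- b \<le> (\<Sum>i\<in>past v t. log_deriv Q1 Q0 (Y i \<omega>))" by simp
    show ?thesis
      unfolding llr_eq_sum_separating[OF v u] separating_eq_past[OF far] using 1 2 by simp
  qed
  have "ennreal (exp (- (C * N + b))) * emeasure (P v) A
      = (\<integral>\<^sup>+\<omega>. ennreal (exp (- (C * N + b))) * indicator A \<omega> \<partial>P v)"
    using AM by (simp add: nn_integral_cmult_indicator)
  also have "\<dots> \<le> (\<integral>\<^sup>+\<omega>. ennreal (exp (llr u v t \<omega>)) * indicator A \<omega> \<partial>P v)"
    by (rule nn_integral_mono) (use ge in \<open>auto simp: indicator_def intro!: ennreal_leI\<close>)
  also have "\<dots> = emeasure (P u) A" by (rule change_of_source[OF u v A, symmetric])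
  finally have "exp (- (C * N + b)) * measure (P v) A \<le> measure (P u) A"
    by (simp add: Pv.emeasure_eq_measure Pu.emeasure_eq_measure ennreal_mult[symmetric] ennreal_le_iff)
  then have "exp (C * N + b) * (exp (- (C * N + b)) * measure (P v) A) \<le> exp (C * N + b) * measure (P u) A"
    by (rule mult_left_mono) simp
  then show ?thesis by (simp add: mult.assoc[symmetric] exp_add[symmetric])
qed

text \<open>
  An estimator that stops by time \<open>t\<close> under \<open>v\<close> does so near \<open>v\<close>, except with probability \<open>\<alpha>\<close>.
  Stopping by time \<open>t\<close> near \<open>v\<close> has probability at most \<open>\<alpha> / n\<close> per vertex near \<open>v\<close> under every
  source \<open>u\<close> far from \<open>v\<close>, and by confusion of \<open>v\<close> with a plausible \<open>u\<close> it is unlikely under \<open>v\<close>.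
\<close>

lemma early_stopping_prob:
  assumes KL: "integrable Q1 (log_deriv Q0 Q1)"
    and V: "V \<subseteq> pverts G" "finite V" and v: "v \<in> V"
    and E: "E \<in> confidence_class G M P y V r \<alpha>" and \<alpha>: "0 < \<alpha>"
    and C: "0 \<le> C" "1 / 2 \<le> measure Q0 {x. - C \<le> log_deriv Q0 Q1 x}"
    and N: "N = (t + 1) * (3 * (k - 1) ^ t)" and b: "0 < b" and m: "0 < m"
    and room: "(m + 1) * (3 * (k - 1) ^ (2 * t + 2 * r)) \<le> card V"
  shows "measure (P v) {\<omega> \<in> space M. snd E \<omega> \<le> enat t}
    \<le> \<alpha> + N * (\<integral>x. \<bar>log_deriv Q1 Q0 x\<bar> \<partial>Q1) / b + exp (- (m * (1 / 2) ^ N))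
        + m * exp (C * N + b) * (3 * (k - 1) ^ r) * \<alpha> / card V"
proof -
  have vG: "v \<in> pverts G" using V v by auto
  have n: "0 < card V" using V v by (auto simp: card_gt_0_iff)
  interpret Pv: prob_space "P v" by (rule prob_P[OF vG])
  have Es: "E \<in> sequential_estimators G M y V" using E by (simp add: confidence_class_def)
  have err: "measure (P u) {\<omega> \<in> space M. estimator_output E \<omega> = Some w} \<le> \<alpha> / card V"
    if "w \<in> V" "u \<in> V" "u \<notin> nbhd G w r" for u w
  proof -
    have uG: "u \<in> pverts G" using that V by auto
    have "\<forall>w\<in>V. \<forall>u\<in>V. ereal (real r) < gdist G w u \<longrightarrow>
        measure (P u) {\<omega> \<in> space (P u). estimator_output E \<omega> = Some w} \<le> \<alpha> / card V"
      using E by (simp add: confidence_class_def)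
    then have "ereal (real r) < gdist G w u \<longrightarrow>
        measure (P u) {\<omega> \<in> space (P u). estimator_output E \<omega> = Some w} \<le> \<alpha> / card V"
      using that(1,2) by blast
    then show ?thesis
      using that(3) gdist_gt_iff[OF uG, of r w] by (simp add: space_P[OF uG])
  qed
  have out: "{\<omega> \<in> space M. estimator_output E \<omega> = Some w} \<in> sets (P u)" if "u \<in> pverts G" for u w
    using output_event(2)[OF Es] sets_P[OF that] by simp
  have D: "fst E s \<omega> \<in> V" if "\<omega> \<in> space M" for s \<omega>
  proof -
    have "fst E s \<in> F s \<rightarrow>\<^sub>M count_space V"
      using Es by (auto simp: sequential_estimators_def split_beta)
    then have "fst E s \<omega> \<in> space (count_space V)"
      by (rule measurable_space) (simp add: that space_F)
    then show ?thesis by simp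
  qed
  define A where "A = (\<Union>s\<le>t. {\<omega> \<in> space M. snd E \<omega> = enat s \<and> fst E s \<omega> \<in> nbhd G v r})"
  have AF: "A \<in> sets (F t)"
    unfolding A_def
  proof (rule sets.finite_UN)
    fix s assume "s \<in> {..t}"
    then have "sets (F s) \<subseteq> sets (F t)" by (intro sets_F_mono) simp
    then show "{\<omega> \<in> space M. snd E \<omega> = enat s \<and> fst E s \<omega> \<in> nbhd G v r} \<in> sets (F t)"
      using estimator_event(1)[OF Es] by blast
  qed simp
  then have AM: "A \<in> sets M" using sets_F_subset by blast

  \<comment> \<open>Candidate sources far from \<open>v\<close>, with disjoint neighbourhoods.\<close>
  obtain U where U: "U \<subseteq> V" "card U = m" "finite U"
    and far: "\<And>u. u \<in> U \<Longrightarrow> u \<notin> nbhd G v (2 * t + 2 * r)"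
    and sep: "\<And>u u'. u \<in> U \<Longrightarrow> u' \<in> U \<Longrightarrow> u \<noteq> u' \<Longrightarrow> u' \<notin> nbhd G u (2 * t + 2 * r)"
    using packing[OF V vG room] by blast
  have UG: "U \<subseteq> pverts G" using U V by auto
  have Une: "U \<noteq> {}" using U m by auto
  have far_t: "u \<notin> nbhd G v (t + t)" and far_r: "u \<notin> nbhd G v (r + r)" if "u \<in> U" for u
    by (rule far_if_outside_larger_ball[OF far[OF that]], simp)+
  have sep_t: "u' \<notin> nbhd G u (t + t)" if "u \<in> U" "u' \<in> U" "u \<noteq> u'" for u u'
    by (rule far_if_outside_larger_ball[OF sep[OF that]]) simp
  have card_past: "card (past w t) \<le> N" if "w \<in> pverts G" for w
    using past_card_le[OF that] by (simp add: N)

  have A_u: "measure (P u) A \<le> (3 * (k - 1) ^ r) * (\<alpha> / card V)" if u: "u \<in> U" for u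
  proof -
    have uG: "u \<in> pverts G" using u UG by auto
    interpret Pu: prob_space "P u" by (rule prob_P[OF uG])
    have "A \<subseteq> (\<Union>w\<in>V \<inter> nbhd G v r. {\<omega> \<in> space M. estimator_output E \<omega> = Some w})"
      using D by (auto simp: A_def estimator_output_def)
    then have "measure (P u) A
        \<le> measure (P u) (\<Union>w\<in>V \<inter> nbhd G v r. {\<omega> \<in> space M. estimator_output E \<omega> = Some w})"
      by (rule Pu.finite_measure_mono) (use out[OF uG] V(2) in auto)
    also have "\<dots> \<le> (\<Sum>w\<in>V \<inter> nbhd G v r. measure (P u) {\<omega> \<in> space M. estimator_output E \<omega> = Some w})"
      by (rule Pu.finite_measure_subadditive_finite) (use out[OF uG] V(2) in auto)
    also have "\<dots> \<le> (\<Sum>w\<in>V \<inter> nbhd G v r. \<alpha> / card V)"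
    proof (rule sum_mono)
      fix w assume w: "w \<in> V \<inter> nbhd G v r"
      then have "u \<notin> nbhd G w r" using far_r[OF u] nbhd_trans[of w v r u r] by blast
      then show "measure (P u) {\<omega> \<in> space M. estimator_output E \<omega> = Some w} \<le> \<alpha> / card V"
        using err[of w u] w u U(1) by auto
    qed
    also have "\<dots> = card (V \<inter> nbhd G v r) * (\<alpha> / card V)" by simp
    also have "\<dots> \<le> (3 * (k - 1) ^ r) * (\<alpha> / card V)"
    proof (rule mult_right_mono)
      have "card (V \<inter> nbhd G v r) \<le> card (nbhd G v r)"
        by (rule card_mono) (use nbhd_finite[OF vG] in auto)
      also have "\<dots> \<le> 3 * (k - 1) ^ r" by (rule nbhd_card_le[OF vG])
      finally show "real (card (V \<inter> nbhd G v r)) \<le> real (3 * (k - 1) ^ r)" by (rule of_nat_mono)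
    qed (use \<alpha> in simp)
    finally show ?thesis .
  qed

  define plaus where "plaus u = plausible C u t" for u
  define moder where "moder = moderate b v t"
  have moder: "moder \<in> sets (F t)" unfolding moder_def by (rule moderate_prob(1)[OF KL vG b card_past[OF vG]])
  have plaus: "plaus u \<in> sets (F t)" if "u \<in> U" for u
    unfolding plaus_def by (rule plausible_measurable) (use that UG in auto)
  have setsP: "B \<in> sets (P v)" if "B \<in> sets (F t)" for B
    using that sets_F_subset sets_P[OF vG] by blast
  have conf: "measure (P v) (A \<inter> plaus u \<inter> moder) \<le> exp (C * N + b) * ((3 * (k - 1) ^ r) * (\<alpha> / card V))"
    if u: "u \<in> U" for u
  proof -
    have uG: "u \<in> pverts G" using u UG by auto
    interpret Pu: prob_space "P u" by (rule prob_P[OF uG])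
    have "A \<inter> plaus u \<inter> moder \<in> sets (F t)" using AF plaus[OF u] moder by auto
    then have "measure (P v) (A \<inter> plaus u \<inter> moder) \<le> exp (C * N + b) * measure (P u) (A \<inter> plaus u \<inter> moder)"
      by (rule confusion[OF uG vG far_t[OF u] _ C(1) card_past[OF uG]]) (auto simp: plaus_def moder_def)
    also have "\<dots> \<le> exp (C * N + b) * measure (P u) A"
      by (intro mult_left_mono Pu.finite_measure_mono) (use AM sets_P[OF uG] in auto)
    also have "\<dots> \<le> exp (C * N + b) * ((3 * (k - 1) ^ r) * (\<alpha> / card V))"
      by (intro mult_left_mono A_u u) simp
    finally show ?thesis .
  qed

  define far_out where "far_out = (\<Union>w\<in>V - nbhd G v r. {\<omega> \<in> space M. estimator_output E \<omega> = Some w})"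
  have cover: "{\<omega> \<in> space M. snd E \<omega> \<le> enat t} \<subseteq>
      far_out \<union> ((space M - moder) \<union> ((space M - (\<Union>u\<in>U. plaus u)) \<union> (\<Union>u\<in>U. A \<inter> plaus u \<inter> moder)))"
  proof
    fix \<omega> assume "\<omega> \<in> {\<omega> \<in> space M. snd E \<omega> \<le> enat t}"
    then obtain s where \<omega>: "\<omega> \<in> space M" "snd E \<omega> = enat s" "s \<le> t" by (cases "snd E \<omega>") auto
    have "\<omega> \<in> far_out" if "fst E s \<omega> \<notin> nbhd G v r"
      using that \<omega> D[OF \<omega>(1), of s] by (auto simp: far_out_def estimator_output_def)
    moreover have "\<omega> \<in> A" if "fst E s \<omega> \<in> nbhd G v r" using that \<omega> by (auto simp: A_def)
    ultimately show "\<omega> \<in> far_out \<union> ((space M - moder) \<union>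
        ((space M - (\<Union>u\<in>U. plaus u)) \<union> (\<Union>u\<in>U. A \<inter> plaus u \<inter> moder)))"
      using \<omega>(1) by blast
  qed
  have far_out_sets: "far_out \<in> sets (P v)" unfolding far_out_def using out[OF vG] V(2) by auto
  have compl: "space M - B \<in> sets (P v)" if "B \<in> sets (P v)" for B
    using sets.compl_sets[OF that] by (simp add: space_P[OF vG])
  note meas = far_out_sets compl[OF setsP[OF moder]] setsP[OF AF] setsP[OF plaus] setsP[OF moder]
  have pl_un: "(\<Union>u\<in>U. plaus u) \<in> sets (P v)" using setsP[OF plaus] U(3) by auto
  have conf_un: "(\<Union>u\<in>U. A \<inter> plaus u \<inter> moder) \<in> sets (P v)"
    using meas U(3) by (intro sets.finite_UN sets.Int) auto
  have p1: "measure (P v) far_out \<le> \<alpha>"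
  proof -
    have "measure (P v) far_out \<le>
        (\<Sum>w\<in>V - nbhd G v r. measure (P v) {\<omega> \<in> space M. estimator_output E \<omega> = Some w})"
      unfolding far_out_def
      by (rule Pv.finite_measure_subadditive_finite) (use out[OF vG] V(2) in auto)
    also have "\<dots> \<le> (\<Sum>w\<in>V - nbhd G v r. \<alpha> / card V)"
      by (rule sum_mono) (use err[of _ v] v nbhd_sym in blast)
    also have "\<dots> \<le> (\<Sum>w\<in>V. \<alpha> / card V)" by (rule sum_mono2) (use V(2) \<alpha> in auto)
    also have "\<dots> = \<alpha>" using n by simp
    finally show ?thesis .
  qed
  have p2: "measure (P v) (space M - moder) \<le> N * (\<integral>x. \<bar>log_deriv Q1 Q0 x\<bar> \<partial>Q1) / b"
    unfolding moder_def by (rule moderate_prob(2)[OF KL vG b card_past[OF vG]])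
  have p3: "measure (P v) (space M - (\<Union>u\<in>U. plaus u)) \<le> exp (- (m * (1 / 2) ^ N))"
    using none_plausible_prob[OF vG UG U(3) Une far_t sep_t C(2) card_past] UG U(2)
    by (auto simp: plaus_def)
  have p4: "measure (P v) (\<Union>u\<in>U. A \<inter> plaus u \<inter> moder)
      \<le> m * exp (C * N + b) * (3 * (k - 1) ^ r) * \<alpha> / card V"
  proof -
    have "measure (P v) (\<Union>u\<in>U. A \<inter> plaus u \<inter> moder) \<le> (\<Sum>u\<in>U. measure (P v) (A \<inter> plaus u \<inter> moder))"
      by (rule Pv.finite_measure_subadditive_finite) (use meas U(3) in auto)
    also have "\<dots> \<le> (\<Sum>u\<in>U. exp (C * N + b) * ((3 * (k - 1) ^ r) * (\<alpha> / card V)))"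
      by (rule sum_mono) (rule conf)
    finally show ?thesis by (simp add: U(2) mult.assoc)
  qed
  have "measure (P v) {\<omega> \<in> space M. snd E \<omega> \<le> enat t} \<le> measure (P v)
      (far_out \<union> ((space M - moder) \<union> ((space M - (\<Union>u\<in>U. plaus u)) \<union> (\<Union>u\<in>U. A \<inter> plaus u \<inter> moder))))"
    by (rule Pv.finite_measure_mono[OF cover]) (intro sets.Un meas(1,2) compl pl_un conf_un)
  also have "\<dots> \<le> measure (P v) far_out + (measure (P v) (space M - moder)
      + (measure (P v) (space M - (\<Union>u\<in>U. plaus u)) + measure (P v) (\<Union>u\<in>U. A \<inter> plaus u \<inter> moder)))"
    by (intro order_trans[OF measure_Un_le] add_mono order_refl sets.Un meas(1,2) compl pl_un conf_un)
  also have "\<dots> \<le> \<alpha> + (N * (\<integral>x. \<bar>log_deriv Q1 Q0 x\<bar> \<partial>Q1) / b + (exp (- (m * (1 / 2) ^ N))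
        + m * exp (C * N + b) * (3 * (k - 1) ^ r) * \<alpha> / card V))"
    by (intro add_mono p1 p2 p3 p4)
  finally show ?thesis by (simp add: add.assoc)
qed

text \<open>Markov's inequality for the stopping time, at the level \<open>t + 1\<close> because time is discrete.\<close>

lemma optimal_expected_time_ge:
  assumes V: "V \<subseteq> pverts G" "finite V" "V \<noteq> {}"
    and p: "\<And>E v. E \<in> confidence_class G M P y V r \<alpha> \<Longrightarrow> v \<in> V \<Longrightarrow>
      measure (P v) {\<omega> \<in> space M. snd E \<omega> \<le> enat t} \<le> p"
  shows "ennreal ((real t + 1) * (1 - p)) \<le> optimal_expected_time G M P y V r \<alpha>"
  unfolding optimal_expected_time_def
proof (rule INF_greatest)
  fix E assume E: "E \<in> confidence_class G M P y V r \<alpha>"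
  obtain v where v: "v \<in> V" using V by blast
  then have vG: "v \<in> pverts G" using V by auto
  interpret Pv: prob_space "P v" by (rule prob_P[OF vG])
  let ?A = "{\<omega> \<in> space M. snd E \<omega> \<le> enat t}"
  have Es: "E \<in> sequential_estimators G M y V" using E by (simp add: confidence_class_def)
  have A: "?A \<in> sets (P v)" using estimator_event(2)[OF Es] sets_F_subset sets_P[OF vG] by blast
  have compl: "space (P v) - ?A \<in> sets (P v)" by (rule sets.compl_sets[OF A])
  have "ennreal ((real t + 1) * (1 - p)) \<le> ennreal ((real t + 1) * measure (P v) (space (P v) - ?A))"
    unfolding Pv.prob_compl[OF A] by (intro ennreal_leI mult_left_mono) (use p[OF E v] in auto)
  also have "\<dots> = (\<integral>\<^sup>+\<omega>. ennreal (real t + 1) * indicator (space (P v) - ?A) \<omega> \<partial>P v)"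
    using nn_integral_cmult_indicator[OF compl, of "ennreal (real t + 1)"]
    by (simp add: Pv.emeasure_eq_measure ennreal_mult)
  also have "\<dots> \<le> (\<integral>\<^sup>+\<omega>. ennreal_of_enat (snd E \<omega>) \<partial>P v)"
  proof (rule nn_integral_mono)
    fix \<omega> assume \<omega>: "\<omega> \<in> space (P v)"
    show "ennreal (real t + 1) * indicator (space (P v) - ?A) \<omega> \<le> ennreal_of_enat (snd E \<omega>)"
    proof (cases "snd E \<omega> \<le> enat t")
      case True
      then show ?thesis using \<omega> by (simp add: space_P[OF vG])
    next
      case False
      then have "enat (t + 1) \<le> snd E \<omega>" by (cases "snd E \<omega>") auto
      then have le: "ennreal_of_enat (enat (t + 1)) \<le> ennreal_of_enat (snd E \<omega>)"
        by (simp only: ennreal_of_enat_le_iff)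
      have "ennreal (real t + 1) = ennreal_of_enat (enat (t + 1))"
        using ennreal_of_nat_eq_real_of_nat[of "t + 1"] by (simp add: add.commute)
      then show ?thesis
        using le \<omega> False by (simp add: add.commute)
    qed
  qed
  also have "\<dots> \<le> worst_expected_time P V E"
    unfolding worst_expected_time_def by (rule SUP_upper[OF v])
  finally show "ennreal ((real t + 1) * (1 - p)) \<le> worst_expected_time P V E" .
qed

end

section \<open>Asymptotics\<close>

lemma powr_loglog:
  fixes q :: real
  assumes "1 < q" and "1 < ln (real n)"
  shows "q powr (c * (ln (ln (real n)) / ln q)) = ln (real n) powr c"
  using assms by (simp add: powr_def)

lemma loglog_at_top: "1 < q \<Longrightarrow> filterlim (\<lambda>n. ln (ln (real n)) / ln q) at_top sequentially"
proof -
  assume "1 < q"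
  then have "0 < ln q" by simp
  then show ?thesis by real_asymp
qed

lemma eventually_ln_gt: "\<forall>\<^sub>F n in sequentially. c < ln (real n)"
proof -
  have "filterlim (\<lambda>n. ln (real n)) at_top sequentially" by real_asymp
  then show ?thesis by (simp add: filterlim_at_top_dense)
qed

text \<open>
  Slightly after time \<open>log log n / log q\<close>, the number \<open>q\<^sup>t\<close> of informative observations outgrows
  \<open>log n\<close>, the order of the threshold and of the logarithm of the number of competitors.
\<close>

lemma expected_time_bound_asymp:
  fixes s \<alpha> \<epsilon> :: real and k :: nat
  assumes s: "0 < s" "s < 1" and k: "3 \<le> k" and \<alpha>: "0 < \<alpha>" and \<epsilon>: "0 < \<epsilon>"
  defines "L \<equiv> (\<lambda>n. ln (ln (real n)) / ln (real k - 1))"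
  shows "\<forall>\<^sub>F n in sequentially.
    real (nat \<lceil>(1 + \<epsilon> / 2) * L n\<rceil>)
      + real n * sqrt (real n / \<alpha>) * s ^ ((k - 1) ^ nat \<lceil>(1 + \<epsilon> / 2) * L n\<rceil>) / (1 - s)
    \<le> (1 + \<epsilon>) * L n"
proof -
  define q where "q = real k - 1"
  have q: "1 < q" using k by (simp add: q_def)
  have Ltop: "filterlim L at_top sequentially"
    unfolding L_def q_def[symmetric] by (rule loglog_at_top[OF q])
  define c where "c = - ln s"
  have c: "0 < c" using s by (simp add: c_def)
  define d where "d = \<epsilon> / 2"
  have d: "0 < d" using \<epsilon> by (simp add: d_def)
  define K where "K = 1 / (sqrt \<alpha> * (1 - s))"
  have "(\<lambda>n. exp (3 / 2 * ln (real n) - c * ln (real n) powr (1 + d))) \<longlonglongrightarrow> 0"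
    using c d by real_asymp
  then have "(\<lambda>n. K * exp (3 / 2 * ln (real n) - c * ln (real n) powr (1 + d))) \<longlonglongrightarrow> K * 0"
    by (intro tendsto_mult tendsto_const)
  then have small: "\<forall>\<^sub>F n in sequentially. K * exp (3 / 2 * ln (real n) - c * ln (real n) powr (1 + d)) < 1"
    by (rule order_tendstoD) simp
  have "\<forall>\<^sub>F n in sequentially. 2 / d \<le> L n" using Ltop by (simp add: filterlim_at_top)
  then show ?thesis
    using small eventually_ln_gt[of 1] eventually_gt_at_top[of 0]
  proof eventually_elim
    case (elim n)
    define t where "t = nat \<lceil>(1 + d) * L n\<rceil>"
    have "0 \<le> 2 / d" using d by simp
    then have L0: "0 \<le> L n" using elim(1) by linarith
    then have "0 \<le> (1 + d) * L n" using d by simp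
    then have t: "(1 + d) * L n \<le> t" "t \<le> (1 + d) * L n + 1" unfolding t_def by linarith+
    have "real ((k - 1) ^ t) = q powr t" using k q by (simp add: q_def powr_realpow of_nat_diff)
    also have "\<dots> \<ge> q powr ((1 + d) * L n)" by (rule powr_mono) (use t q in auto)
    also have "q powr ((1 + d) * L n) = ln (real n) powr (1 + d)"
      unfolding L_def q_def[symmetric] by (rule powr_loglog[OF q elim(3)])
    finally have X: "ln (real n) powr (1 + d) \<le> real ((k - 1) ^ t)" .
    have "s ^ ((k - 1) ^ t) = exp (- c * real ((k - 1) ^ t))"
      using s by (simp only: c_def) (metis exp_of_nat_mult exp_ln minus_minus mult.commute)
    also have "\<dots> \<le> exp (- c * ln (real n) powr (1 + d))" using X c by simp
    finally have pow_le: "s ^ ((k - 1) ^ t) \<le> exp (- c * ln (real n) powr (1 + d))" .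
    have coeff: "real n * sqrt (real n / \<alpha>) / (1 - s) = K * exp (3 / 2 * ln (real n))"
    proof -
      have "exp (3 / 2 * ln (real n)) = exp (ln (real n)) * exp (ln (real n) / 2)"
        by (simp add: exp_add[symmetric])
      also have "exp (ln (real n) / 2) = sqrt (real n)"
        using elim(4) by (simp add: ln_sqrt[symmetric])
      finally show ?thesis using elim(4) by (simp add: K_def real_sqrt_divide)
    qed
    have "real n * sqrt (real n / \<alpha>) * s ^ ((k - 1) ^ t) / (1 - s)
        = real n * sqrt (real n / \<alpha>) / (1 - s) * s ^ ((k - 1) ^ t)" by simp
    also have "\<dots> \<le> real n * sqrt (real n / \<alpha>) / (1 - s) * exp (- c * ln (real n) powr (1 + d))"
      by (rule mult_left_mono[OF pow_le]) (use s \<alpha> in simp)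
    also note coeff
    also have "K * exp (3 / 2 * ln (real n)) * exp (- c * ln (real n) powr (1 + d))
        = K * exp (3 / 2 * ln (real n) - c * ln (real n) powr (1 + d))"
      by (simp add: exp_add[symmetric])
    also have "\<dots> < 1" by (rule elim(2))
    finally have "t + real n * sqrt (real n / \<alpha>) * s ^ ((k - 1) ^ t) / (1 - s) \<le> (1 + d) * L n + 2"
      using t by linarith
    also have "2 \<le> d * L n" using elim(1) d by (simp add: field_simps)
    finally show ?case by (simp add: t_def d_def algebra_simps)
  qed
qed

text \<open>Slightly before that time, the whole past of a vertex consists of \<open>o(log n)\<close> observations.\<close>

lemma past_size_asymp:
  fixes \<epsilon> :: real and k :: nat
  assumes k: "3 \<le> k" and \<epsilon>: "0 < \<epsilon>" "\<epsilon> < 1"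
  defines "L \<equiv> (\<lambda>n. ln (ln (real n)) / ln (real k - 1))"
  defines "t \<equiv> (\<lambda>n. nat \<lfloor>(1 - \<epsilon>) * L n\<rfloor>)"
  shows "(\<lambda>n. real ((t n + 1) * (3 * (k - 1) ^ t n)) / ln (real n)) \<longlonglongrightarrow> 0"
proof (rule tendsto_sandwich[OF _ _ tendsto_const])
  define q where "q = real k - 1"
  have q: "1 < q" using k by (simp add: q_def)
  have lq: "0 < ln q" using q by simp
  let ?u = "\<lambda>n. ((1 - \<epsilon>) * (ln (ln (real n)) / ln q) + 1) * (3 * ln (real n) powr (1 - \<epsilon>)) / ln (real n)"
  have "(\<lambda>n. ln (real n) powr (- \<epsilon>) * (ln (ln (real n)))) \<longlonglongrightarrow> 0" using \<epsilon> by real_asymp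
  moreover have "(\<lambda>n. ln (real n) powr (- \<epsilon>)) \<longlonglongrightarrow> 0" using \<epsilon> by real_asymp
  ultimately have "(\<lambda>n. 3 * (1 - \<epsilon>) / ln q * (ln (real n) powr (- \<epsilon>) * ln (ln (real n)))
      + 3 * ln (real n) powr (- \<epsilon>)) \<longlonglongrightarrow> 3 * (1 - \<epsilon>) / ln q * 0 + 3 * 0"
    by (intro tendsto_intros)
  moreover have "\<forall>\<^sub>F n in sequentially. 3 * (1 - \<epsilon>) / ln q * (ln (real n) powr (- \<epsilon>) * ln (ln (real n)))
      + 3 * ln (real n) powr (- \<epsilon>) = ?u n"
    using eventually_ln_gt[of 1]
  proof eventually_elim
    case (elim n)
    have "ln (real n) powr (1 - \<epsilon>) = ln (real n) * ln (real n) powr (- \<epsilon>)"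
      using elim powr_add[of "ln (real n)" 1 "- \<epsilon>"] by simp
    then show ?case using elim lq by (simp add: field_simps)
  qed
  ultimately show "?u \<longlonglongrightarrow> 0" using Lim_transform_eventually by fastforce
  show "\<forall>\<^sub>F n in sequentially. 0 \<le> real ((t n + 1) * (3 * (k - 1) ^ t n)) / ln (real n)"
    using eventually_ln_gt[of 0] by eventually_elim simp
  show "\<forall>\<^sub>F n in sequentially. real ((t n + 1) * (3 * (k - 1) ^ t n)) / ln (real n) \<le> ?u n"
    using eventually_ln_gt[of 1]
  proof eventually_elim
    case (elim n)
    have L: "0 \<le> L n" using elim q by (simp add: L_def q_def[symmetric])
    then have "0 \<le> (1 - \<epsilon>) * L n" using \<epsilon> by simp
    then have t: "real (t n) \<le> (1 - \<epsilon>) * L n" unfolding t_def by linarith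
    have "real ((k - 1) ^ t n) = q powr t n" using k q by (simp add: q_def powr_realpow of_nat_diff)
    also have "\<dots> \<le> q powr ((1 - \<epsilon>) * L n)" by (rule powr_mono) (use t q in auto)
    also have "\<dots> = ln (real n) powr (1 - \<epsilon>)"
      unfolding L_def q_def[symmetric] by (rule powr_loglog[OF q elim])
    finally have pow: "real ((k - 1) ^ t n) \<le> ln (real n) powr (1 - \<epsilon>)" .
    have "real ((t n + 1) * (3 * (k - 1) ^ t n)) = (real (t n) + 1) * (3 * real ((k - 1) ^ t n))"
      by (simp only: of_nat_mult of_nat_add of_nat_1 of_nat_numeral)
    also have "\<dots> \<le> ((1 - \<epsilon>) * L n + 1) * (3 * ln (real n) powr (1 - \<epsilon>))"
      using t pow by (intro mult_mono) auto
    finally show ?case using elim by (intro divide_right_mono) (auto simp: L_def q_def)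
  qed
qed

text \<open>
  If the past of a vertex and the radius \<open>r\<close> are at most a small multiple \<open>\<delta>\<close> of \<open>log n\<close>, then all
  factors other than \<open>n\<close> in the bound on early stopping are small powers of \<open>n\<close>. About \<open>sqrt n\<close>
  far candidates are taken: many enough for one of them to be plausible, few enough to be
  separated and for the union bound over them.
\<close>

lemma early_stopping_bound_asymp:
  fixes C K \<alpha> \<epsilon> :: real and k :: nat
  assumes k: "3 \<le> k" and C: "0 \<le> C" and K: "0 \<le> K" and \<alpha>: "0 < \<alpha>" "\<alpha> < 1" and \<epsilon>: "0 < \<epsilon>"
  obtains \<delta> :: real where "0 < \<delta>"
    and "\<forall>\<^sub>F n in sequentially. \<forall>N t r. real N \<le> \<delta> * ln (real n) \<longrightarrow> t \<le> N \<longrightarrow> real r \<le> \<delta> * ln (real n) \<longrightarrow>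
      (nat \<lfloor>sqrt (real n)\<rfloor> + 1) * (3 * (k - 1) ^ (2 * t + 2 * r)) \<le> n \<and>
      \<alpha> + real N * K / (ln (real n) / 8) + exp (- (real (nat \<lfloor>sqrt (real n)\<rfloor>) * (1 / 2) ^ N))
        + real (nat \<lfloor>sqrt (real n)\<rfloor>) * exp (C * real N + ln (real n) / 8) * (3 * (k - 1) ^ r) * \<alpha> / real n
      \<le> \<alpha> + \<epsilon>"
proof -
  define q where "q = real k - 1"
  have q: "2 \<le> q" using k by (simp add: q_def)
  have lq: "0 < ln q" using q by simp
  \<comment> \<open>Each summand of the denominator serves one of the estimates of \<open>\<delta>\<close> that follow.\<close>
  define \<delta> where "\<delta> = 1 / (32 * ln q + 8 * C + 16 * K / \<epsilon> + 4)"
  have den: "0 < 32 * ln q + 8 * C + 16 * K / \<epsilon> + 4" using lq C K \<epsilon> by (simp add: add_pos_nonneg add_nonneg_pos)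
  then have \<delta>: "0 < \<delta>" by (simp add: \<delta>_def)
  have \<delta>_le: "\<delta> * x \<le> 1" if "x \<le> 32 * ln q + 8 * C + 16 * K / \<epsilon> + 4" for x
    using that den by (simp add: \<delta>_def)
  have nn: "0 \<le> 32 * ln q" "0 \<le> 8 * C" "0 \<le> 16 * K / \<epsilon>" using lq C K \<epsilon> by auto
  have \<delta>q: "\<delta> * ln q \<le> 1 / 32" using \<delta>_le[of "32 * ln q"] nn by simp
  have \<delta>C: "\<delta> * C \<le> 1 / 8" using \<delta>_le[of "8 * C"] nn by simp
  have \<delta>K: "\<delta> * K \<le> \<epsilon> / 16" using \<delta>_le[of "16 * K / \<epsilon>"] nn \<epsilon> by (simp add: field_simps)
  have \<delta>4: "\<delta> \<le> 1 / 4" using \<delta>_le[of 4] nn by simp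
  have "(\<lambda>n. exp (- (1 / 2 * exp (ln (real n) / 4)))) \<longlonglongrightarrow> 0" by real_asymp
  then have e1: "\<forall>\<^sub>F n in sequentially. exp (- (1 / 2 * exp (ln (real n) / 4))) < \<epsilon> / 4"
    by (rule order_tendstoD) (use \<epsilon> in simp)
  have "(\<lambda>n. 3 * exp (- ln (real n) / 8)) \<longlonglongrightarrow> 0" by real_asymp
  then have e2: "\<forall>\<^sub>F n in sequentially. 3 * exp (- ln (real n) / 8) < \<epsilon> / 4"
    by (rule order_tendstoD) (use \<epsilon> in simp)
  have "\<forall>\<^sub>F n in sequentially. \<forall>N t r. real N \<le> \<delta> * ln (real n) \<longrightarrow> t \<le> N \<longrightarrow> real r \<le> \<delta> * ln (real n) \<longrightarrow>
      (nat \<lfloor>sqrt (real n)\<rfloor> + 1) * (3 * (k - 1) ^ (2 * t + 2 * r)) \<le> n \<and>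
      \<alpha> + real N * K / (ln (real n) / 8) + exp (- (real (nat \<lfloor>sqrt (real n)\<rfloor>) * (1 / 2) ^ N))
        + real (nat \<lfloor>sqrt (real n)\<rfloor>) * exp (C * real N + ln (real n) / 8) * (3 * (k - 1) ^ r) * \<alpha> / real n
      \<le> \<alpha> + \<epsilon>"
    using e1 e2 eventually_ln_gt[of 16] eventually_ge_at_top[of 4]
  proof eventually_elim
    case (elim n)
    define l where "l = ln (real n)"
    have l: "16 < l" using elim(3) by (simp add: l_def)
    have n: "real n = exp l" using elim(4) by (simp add: l_def)
    define m where "m = nat \<lfloor>sqrt (real n)\<rfloor>"
    have sqrt_n: "sqrt (real n) = exp (l / 2)"
      using elim(4) by (simp add: l_def ln_sqrt[symmetric])
    have "0 \<le> sqrt (real n)" by simp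
    then have m: "real m \<le> exp (l / 2)" "exp (l / 2) - 1 \<le> real m" unfolding m_def sqrt_n[symmetric] by linarith+
    have two: "2 \<le> exp (l / 2)" using exp_ge_add_one_self[of "l / 2"] l by linarith
    show ?case
    proof (intro allI impI)
      fix N t r :: nat
      assume N: "real N \<le> \<delta> * ln (real n)" and t: "t \<le> N" and r: "real r \<le> \<delta> * ln (real n)"
      have pow: "real ((k - 1) ^ j) = exp (ln q * j)" for j
      proof -
        have "real ((k - 1) ^ j) = exp (ln q) ^ j" using k q by (simp add: q_def of_nat_diff)
        then show ?thesis by (simp add: exp_of_nat2_mult)
      qed
      have "real (2 * t + 2 * r) \<le> 4 * (\<delta> * l)" using N t r by (simp add: l_def)
      then have "ln q * real (2 * t + 2 * r) \<le> ln q * (4 * (\<delta> * l))" using lq by (intro mult_left_mono) auto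
      also have "\<dots> = (\<delta> * ln q) * (4 * l)" by simp
      also have "\<dots> \<le> 1 / 32 * (4 * l)" using \<delta>q l by (intro mult_right_mono) auto
      finally have p1: "real ((k - 1) ^ (2 * t + 2 * r)) \<le> exp (l / 8)" unfolding pow by simp
      have "real ((m + 1) * (3 * (k - 1) ^ (2 * t + 2 * r))) = (real m + 1) * (3 * real ((k - 1) ^ (2 * t + 2 * r)))"
        by (simp only: of_nat_mult of_nat_add of_nat_1 of_nat_numeral)
      also have "\<dots> \<le> (2 * exp (l / 2)) * (3 * exp (l / 8))"
        using m two p1 by (intro mult_mono) auto
      also have "\<dots> = 6 * exp (5 / 8 * l)" by (simp add: exp_add[symmetric])
      also have "\<dots> \<le> exp (3 / 8 * l) * exp (5 / 8 * l)"
      proof (rule mult_right_mono)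
        show "6 \<le> exp (3 / 8 * l)" using exp_ge_add_one_self[of "3 / 8 * l"] l by linarith
      qed simp
      also have "\<dots> = real n" by (simp add: n exp_add[symmetric])
      finally have room: "(m + 1) * (3 * (k - 1) ^ (2 * t + 2 * r)) \<le> n" by (simp only: of_nat_le_iff)
      have b1: "real N * K / (l / 8) \<le> \<epsilon> / 2"
      proof -
        have "real N * K \<le> \<delta> * l * K" using N K by (intro mult_right_mono) (auto simp: l_def)
        also have "\<dots> = (\<delta> * K) * l" by simp
        also have "\<dots> \<le> \<epsilon> / 16 * l" using \<delta>K l by (intro mult_right_mono) auto
        finally show ?thesis using l by (simp add: field_simps)
      qed
      have b2: "exp (- (real m * (1 / 2) ^ N)) < \<epsilon> / 4"
      proof -
        have "(1 / 2 :: real) ^ N = exp (- (ln 2 * N))"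
          by (simp add: exp_minus exp_of_nat2_mult power_one_over inverse_eq_divide)
        moreover have "ln 2 * real N \<le> 1 * (1 / 4 * l)"
        proof (rule mult_mono)
          have "\<delta> * l \<le> 1 / 4 * l" by (rule mult_right_mono[OF \<delta>4]) (use l in simp)
          then show "real N \<le> 1 / 4 * l" using N unfolding l_def by linarith
          show "ln 2 \<le> (1::real)" using ln_2_less_1 by simp
        qed (use l in auto)
        ultimately have "exp (- l / 4) \<le> (1 / 2 :: real) ^ N" by simp
        then have "(1 / 2 * exp (l / 2)) * exp (- l / 4) \<le> real m * (1 / 2) ^ N"
          using m two by (intro mult_mono) auto
        then have "1 / 2 * exp (l / 4) \<le> real m * (1 / 2) ^ N" by (simp add: exp_add[symmetric])
        then have "exp (- (real m * (1 / 2) ^ N)) \<le> exp (- (1 / 2 * exp (l / 4)))" by simp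
        also have "\<dots> < \<epsilon> / 4" using elim(1) by (simp only: l_def)
        finally show ?thesis .
      qed
      have b3: "real m * exp (C * real N + l / 8) * (3 * (k - 1) ^ r) * \<alpha> / real n \<le> 3 * exp (- l / 8)"
      proof -
        have "C * real N \<le> C * (\<delta> * l)" using N C by (intro mult_left_mono) (auto simp: l_def)
        also have "\<dots> = (\<delta> * C) * l" by simp
        also have "\<dots> \<le> 1 / 8 * l" using \<delta>C l by (intro mult_right_mono) auto
        finally have CN: "C * real N + l / 8 \<le> l / 4" by simp
        have "ln q * real r \<le> ln q * (\<delta> * l)" using r lq by (intro mult_left_mono) (auto simp: l_def)
        also have "\<dots> = (\<delta> * ln q) * l" by simp
        also have "\<dots> \<le> 1 / 32 * l" using \<delta>q l by (intro mult_right_mono) auto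
        also have "\<dots> \<le> l / 8" using l by simp
        finally have pr: "real ((k - 1) ^ r) \<le> exp (l / 8)" unfolding pow by simp
        have "real m * exp (C * real N + l / 8) * (3 * real ((k - 1) ^ r)) * \<alpha>
            \<le> exp (l / 2) * exp (l / 4) * (3 * exp (l / 8)) * 1"
          using m(1) CN pr \<alpha> by (intro mult_mono mult_nonneg_nonneg) auto
        also have "\<dots> = 3 * exp (7 / 8 * l)" by (simp add: exp_add[symmetric])
        finally have "real m * exp (C * real N + l / 8) * (3 * real ((k - 1) ^ r)) * \<alpha> / real n
            \<le> 3 * exp (7 / 8 * l) / exp l"
          unfolding n by (intro divide_right_mono) auto
        also have "exp (7 / 8 * l) = exp (- l / 8) * exp l" by (simp add: exp_add[symmetric])
        also have "3 * (exp (- l / 8) * exp l) / exp l = 3 * exp (- l / 8)" by simp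
        finally show ?thesis by simp
      qed
      show "(nat \<lfloor>sqrt (real n)\<rfloor> + 1) * (3 * (k - 1) ^ (2 * t + 2 * r)) \<le> n \<and>
        \<alpha> + real N * K / (ln (real n) / 8) + exp (- (real (nat \<lfloor>sqrt (real n)\<rfloor>) * (1 / 2) ^ N))
          + real (nat \<lfloor>sqrt (real n)\<rfloor>) * exp (C * real N + ln (real n) / 8) * (3 * (k - 1) ^ r) * \<alpha> / real n
        \<le> \<alpha> + \<epsilon>"
        using room b1 b2 b3 elim(2) unfolding m_def[symmetric] l_def[symmetric] by linarith
    qed
  qed
  then show ?thesis using that[OF \<delta>] by blast
qed

context cascade
begin

lemma msprt_asymp_le:
  assumes V: "\<And>n. V n \<subseteq> pverts G" "\<And>n. finite (V n)" "\<And>n. card (V n) = n"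
    and \<alpha>: "0 < \<alpha>" and \<epsilon>: "0 < \<epsilon>"
  shows "\<forall>\<^sub>F n in sequentially. worst_expected_time P (V n) (msprt G Q0 Q1 y (V n) (R n) \<alpha>)
    \<le> ennreal ((1 + \<epsilon>) * (ln (ln (real n)) / ln (real k - 1)))"
proof -
  obtain s where s: "0 < s" "s < 1"
    and le: "\<And>V r \<alpha> t0. V \<subseteq> pverts G \<Longrightarrow> finite V \<Longrightarrow> V \<noteq> {} \<Longrightarrow> 0 < \<alpha> \<Longrightarrow>
      worst_expected_time P V (msprt G Q0 Q1 y V r \<alpha>)
        \<le> ennreal (real t0 + card V * sqrt (card V / \<alpha>) * s ^ ((k - 1) ^ t0) / (1 - s))"
    using msprt_expected_time_le by blast
  show ?thesis
    using expected_time_bound_asymp[OF s k_ge_3 \<alpha> \<epsilon>] eventually_gt_at_top[of 0]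
  proof eventually_elim
    case (elim n)
    have "V n \<noteq> {}" using V(3)[of n] elim(2) by auto
    from le[OF V(1,2) this \<alpha>] show ?case
      unfolding V(3) using ennreal_leI[OF elim(1)] by (rule order_trans)
  qed
qed

lemma optimal_asymp_ge:
  assumes KL: "integrable Q1 (log_deriv Q0 Q1)"
    and V: "\<And>n. V n \<subseteq> pverts G" "\<And>n. finite (V n)" "\<And>n. card (V n) = n"
    and R: "(\<lambda>n. real (R n) / ln (real n)) \<longlonglongrightarrow> 0"
    and \<alpha>: "0 < \<alpha>" "\<alpha> < 1" and \<epsilon>: "0 < \<epsilon>" "\<epsilon> < 1"
  shows "\<forall>\<^sub>F n in sequentially.
    ennreal ((1 - \<epsilon>) * (1 - \<alpha> - \<epsilon>) * (ln (ln (real n)) / ln (real k - 1)))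
      \<le> optimal_expected_time G M P y (V n) (R n) \<alpha>"
proof -
  define K where "K = (\<integral>x. \<bar>log_deriv Q1 Q0 x\<bar> \<partial>Q1)"
  have K: "0 \<le> K" by (simp add: K_def)
  obtain C where C: "0 \<le> C" "1 / 2 \<le> measure Q0 {x. - C \<le> log_deriv Q0 Q1 x}"
    by (rule log_deriv_lower_quantile)
  obtain \<delta> where \<delta>: "0 < \<delta>"
    and bound: "\<forall>\<^sub>F n in sequentially. \<forall>N t r. real N \<le> \<delta> * ln (real n) \<longrightarrow> t \<le> N \<longrightarrow> real r \<le> \<delta> * ln (real n) \<longrightarrow>
      (nat \<lfloor>sqrt (real n)\<rfloor> + 1) * (3 * (k - 1) ^ (2 * t + 2 * r)) \<le> n \<and>
      \<alpha> + real N * K / (ln (real n) / 8) + exp (- (real (nat \<lfloor>sqrt (real n)\<rfloor>) * (1 / 2) ^ N))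
        + real (nat \<lfloor>sqrt (real n)\<rfloor>) * exp (C * real N + ln (real n) / 8) * (3 * (k - 1) ^ r) * \<alpha> / real n
      \<le> \<alpha> + \<epsilon>"
    using early_stopping_bound_asymp[OF k_ge_3 C(1) K \<alpha> \<epsilon>(1)] by blast
  define L where "L n = ln (ln (real n)) / ln (real k - 1)" for n
  define t where "t n = nat \<lfloor>(1 - \<epsilon>) * L n\<rfloor>" for n
  define N where "N n = (t n + 1) * (3 * (k - 1) ^ t n)" for n
  have "(\<lambda>n. real (N n) / ln (real n)) \<longlonglongrightarrow> 0"
    using past_size_asymp[OF k_ge_3 \<epsilon>] by (simp only: N_def t_def L_def)
  then have "\<forall>\<^sub>F n in sequentially. real (N n) / ln (real n) < \<delta>" using \<delta> by (rule order_tendstoD)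
  moreover have "\<forall>\<^sub>F n in sequentially. real (R n) / ln (real n) < \<delta>" using R \<delta> by (rule order_tendstoD)
  ultimately show ?thesis
    using bound eventually_ln_gt[of 1] eventually_ge_at_top[of 1]
  proof eventually_elim
    case (elim n)
    define m where "m = nat \<lfloor>sqrt (real n)\<rfloor>"
    have lq: "0 < ln (real k - 1)" using k_ge_3 by simp
    have L0: "0 \<le> L n" using elim(4) lq by (simp add: L_def)
    have N_le: "real (N n) \<le> \<delta> * ln (real n)" "real (R n) \<le> \<delta> * ln (real n)"
      using elim(1,2,4) by (simp_all add: pos_divide_less_eq)
    have "1 \<le> 3 * (k - 1) ^ t n" using k_ge_3 by simp
    then have "(t n + 1) * 1 \<le> N n" unfolding N_def by (rule mult_left_mono) simp
    then have tN: "t n \<le> N n" by simp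
    have "1 \<le> sqrt (real n)" using elim(5) by simp
    then have m: "0 < m" unfolding m_def by linarith
    have ne: "V n \<noteq> {}" using V(3)[of n] elim(5) by auto
    note b = elim(3)[rule_format, OF N_le(1) tN N_le(2), folded m_def]
    have "measure (P v) {\<omega> \<in> space M. snd E \<omega> \<le> enat (t n)} \<le> \<alpha> + \<epsilon>"
      if E: "E \<in> confidence_class G M P y (V n) (R n) \<alpha>" and v: "v \<in> V n" for E v
    proof -
      have "measure (P v) {\<omega> \<in> space M. snd E \<omega> \<le> enat (t n)}
          \<le> \<alpha> + N n * K / (ln n / 8) + exp (- (m * (1 / 2) ^ N n))
            + m * exp (C * N n + ln n / 8) * (3 * (k - 1) ^ R n) * \<alpha> / card (V n)"
        unfolding K_def
        by (rule early_stopping_prob[OF KL V(1,2) v E \<alpha>(1) C N_def _ m]) (use elim(4) b in \<open>simp_all add: V(3)\<close>)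
      then show ?thesis using b by (simp add: V(3))
    qed
    then have "ennreal ((real (t n) + 1) * (1 - (\<alpha> + \<epsilon>))) \<le> optimal_expected_time G M P y (V n) (R n) \<alpha>"
      by (rule optimal_expected_time_ge[OF V(1,2) ne])
    moreover have "ennreal ((1 - \<epsilon>) * (1 - \<alpha> - \<epsilon>) * L n) \<le> ennreal ((real (t n) + 1) * (1 - (\<alpha> + \<epsilon>)))"
    proof (cases "0 \<le> 1 - (\<alpha> + \<epsilon>)")
      case True
      have "(1 - \<epsilon>) * L n \<le> real (t n) + 1" unfolding t_def by linarith
      then have "(1 - \<epsilon>) * L n * (1 - (\<alpha> + \<epsilon>)) \<le> (real (t n) + 1) * (1 - (\<alpha> + \<epsilon>))"
        using True by (rule mult_right_mono)
      then show ?thesis by (intro ennreal_leI) (simp add: algebra_simps)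
    next
      case False
      have "(1 - \<epsilon>) * (1 - \<alpha> - \<epsilon>) \<le> 0" using False \<epsilon> by (intro mult_nonneg_nonpos) auto
      then have "(1 - \<epsilon>) * (1 - \<alpha> - \<epsilon>) * L n \<le> 0" using L0 by (rule mult_nonpos_nonneg)
      then show ?thesis by (simp add: ennreal_neg)
    qed
    ultimately show ?case unfolding L_def by (rule order_trans[rotated])
  qed
qed

end

text \<open>
  Both iterated limits only see the relative errors, which vanish with \<open>\<alpha>\<close>.
\<close>

lemma asymp_approx_if_sandwiched:
  fixes f g :: "nat \<Rightarrow> real \<Rightarrow> ennreal" and L :: "nat \<Rightarrow> real" and c d :: "real \<Rightarrow> real"
  assumes L: "\<forall>\<^sub>F n in sequentially. 0 < L n"
    and lower: "\<And>\<alpha>. 0 < \<alpha> \<Longrightarrow> \<alpha> < 1 \<Longrightarrow> \<forall>\<^sub>F n in sequentially. ennreal (c \<alpha> * L n) \<le> f n \<alpha>"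
    and middle: "\<And>\<alpha>. 0 < \<alpha> \<Longrightarrow> \<alpha> < 1 \<Longrightarrow> \<forall>\<^sub>F n in sequentially. f n \<alpha> \<le> g n \<alpha>"
    and upper: "\<And>\<alpha>. 0 < \<alpha> \<Longrightarrow> \<alpha> < 1 \<Longrightarrow> \<forall>\<^sub>F n in sequentially. g n \<alpha> \<le> ennreal (d \<alpha> * L n)"
    and c: "(c \<longlongrightarrow> 1) (at_right 0)" and d: "(d \<longlongrightarrow> 1) (at_right 0)"
  shows "asymp_approx g f" and "asymp_approx f (\<lambda>n \<alpha>. ennreal (L n))"
proof -
  have range: "\<forall>\<^sub>F \<alpha> in at_right 0. 0 < \<alpha> \<and> \<alpha> < (1::real)"
    using eventually_at_right_real[of 0 1] by simp
  have cpos: "\<forall>\<^sub>F \<alpha> in at_right 0. 0 < c \<alpha>" using c by (rule order_tendstoD) simp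
  have dpos: "\<forall>\<^sub>F \<alpha> in at_right 0. 0 < d \<alpha>" using d by (rule order_tendstoD) simp
  have dc: "((\<lambda>\<alpha>. d \<alpha> / c \<alpha>) \<longlongrightarrow> 1 / 1) (at_right 0)" by (intro tendsto_divide d c) simp
  have lim_le: "asymp_le p q"
    if "\<And>\<alpha>. 0 < \<alpha> \<Longrightarrow> \<alpha> < 1 \<Longrightarrow> 0 < c \<alpha> \<Longrightarrow> 0 < d \<alpha> \<Longrightarrow> \<forall>\<^sub>F n in sequentially. p n \<alpha> / q n \<alpha> \<le> ennreal (e \<alpha>)"
      and e: "(e \<longlongrightarrow> 1) (at_right 0)" for p q e
    unfolding asymp_le_def Limsup_le_iff
  proof (intro allI impI)
    fix z :: ennreal assume "1 < z"
    then have "((\<lambda>\<alpha>. ennreal (e \<alpha>)) \<longlongrightarrow> ennreal 1) (at_right 0)" by (intro tendsto_ennrealI e)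
    then have "\<forall>\<^sub>F \<alpha> in at_right 0. ennreal (e \<alpha>) < z" by (rule order_tendstoD) (use \<open>1 < z\<close> in simp)
    then show "\<forall>\<^sub>F \<alpha> in at_right 0. Limsup sequentially (\<lambda>n. p n \<alpha> / q n \<alpha>) < z"
      using range cpos dpos
    proof eventually_elim
      case (elim \<alpha>)
      have "Limsup sequentially (\<lambda>n. p n \<alpha> / q n \<alpha>) \<le> ennreal (e \<alpha>)"
        by (rule Limsup_bounded) (rule that(1), use elim in auto)
      then show ?case using elim(1) by simp
    qed
  qed
  have lim_ge: "asymp_ge p q"
    if "\<And>\<alpha>. 0 < \<alpha> \<Longrightarrow> \<alpha> < 1 \<Longrightarrow> 0 < c \<alpha> \<Longrightarrow> 0 < d \<alpha> \<Longrightarrow> \<forall>\<^sub>F n in sequentially. ennreal (e \<alpha>) \<le> p n \<alpha> / q n \<alpha>"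
      and e: "(e \<longlongrightarrow> 1) (at_right 0)" for p q e
    unfolding asymp_ge_def le_Liminf_iff
  proof (intro allI impI)
    fix z :: ennreal assume "z < 1"
    then have "((\<lambda>\<alpha>. ennreal (e \<alpha>)) \<longlongrightarrow> ennreal 1) (at_right 0)" by (intro tendsto_ennrealI e)
    then have "\<forall>\<^sub>F \<alpha> in at_right 0. z < ennreal (e \<alpha>)" by (rule order_tendstoD) (use \<open>z < 1\<close> in simp)
    then show "\<forall>\<^sub>F \<alpha> in at_right 0. z < Liminf sequentially (\<lambda>n. p n \<alpha> / q n \<alpha>)"
      using range cpos dpos
    proof eventually_elim
      case (elim \<alpha>)
      have "ennreal (e \<alpha>) \<le> Liminf sequentially (\<lambda>n. p n \<alpha> / q n \<alpha>)"
        by (rule Liminf_bounded) (rule that(1), use elim in auto)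
      then show ?case using elim(1) by simp
    qed
  qed
  have fL_ge: "asymp_ge f (\<lambda>n \<alpha>. ennreal (L n))"
  proof (rule lim_ge[OF _ c])
    fix \<alpha> :: real assume \<alpha>: "0 < \<alpha>" "\<alpha> < 1" "0 < c \<alpha>"
    show "\<forall>\<^sub>F n in sequentially. ennreal (c \<alpha>) \<le> f n \<alpha> / ennreal (L n)"
      using lower[OF \<alpha>(1,2)] L
    proof eventually_elim
      case (elim n)
      have "ennreal (c \<alpha>) = ennreal (c \<alpha> * L n) / ennreal (L n)"
        using elim(2) \<alpha>(3) by (simp add: divide_ennreal)
      also have "\<dots> \<le> f n \<alpha> / ennreal (L n)" using elim(1) by (rule divide_right_mono_ennreal)
      finally show ?case .
    qed
  qed
  have fL_le: "asymp_le f (\<lambda>n \<alpha>. ennreal (L n))"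
  proof (rule lim_le[OF _ d])
    fix \<alpha> :: real assume \<alpha>: "0 < \<alpha>" "\<alpha> < 1" "0 < d \<alpha>"
    show "\<forall>\<^sub>F n in sequentially. f n \<alpha> / ennreal (L n) \<le> ennreal (d \<alpha>)"
      using middle[OF \<alpha>(1,2)] upper[OF \<alpha>(1,2)] L
    proof eventually_elim
      case (elim n)
      have "f n \<alpha> \<le> ennreal (d \<alpha> * L n)" using elim(1,2) by (rule order_trans)
      then have "f n \<alpha> / ennreal (L n) \<le> ennreal (d \<alpha> * L n) / ennreal (L n)"
        by (rule divide_right_mono_ennreal)
      also have "\<dots> = ennreal (d \<alpha>)" using elim(3) \<alpha>(3) by (simp add: divide_ennreal)
      finally show ?case .
    qed
  qed
  have gf_ge: "asymp_ge g f"
  proof (rule lim_ge[where e = "\<lambda>_. 1"])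
    fix \<alpha> :: real assume \<alpha>: "0 < \<alpha>" "\<alpha> < 1" "0 < c \<alpha>"
    show "\<forall>\<^sub>F n in sequentially. ennreal 1 \<le> g n \<alpha> / f n \<alpha>"
      using lower[OF \<alpha>(1,2)] middle[OF \<alpha>(1,2)] upper[OF \<alpha>(1,2)] L
    proof eventually_elim
      case (elim n)
      have "0 < ennreal (c \<alpha> * L n)" using elim(4) \<alpha>(3) by simp
      also have "\<dots> \<le> f n \<alpha>" by (rule elim(1))
      finally have "f n \<alpha> \<noteq> 0" by simp
      moreover have "f n \<alpha> < top"
        using order_trans[OF elim(2,3)] by (rule le_less_trans) simp
      ultimately have "ennreal 1 = f n \<alpha> / f n \<alpha>" by simp
      also have "\<dots> \<le> g n \<alpha> / f n \<alpha>" using elim(2) by (rule divide_right_mono_ennreal)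
      finally show ?case .
    qed
  qed simp
  have gf_le: "asymp_le g f"
  proof (rule lim_le[OF _ dc[unfolded div_by_1]])
    fix \<alpha> :: real assume \<alpha>: "0 < \<alpha>" "\<alpha> < 1" "0 < c \<alpha>" "0 < d \<alpha>"
    show "\<forall>\<^sub>F n in sequentially. g n \<alpha> / f n \<alpha> \<le> ennreal (d \<alpha> / c \<alpha>)"
      using lower[OF \<alpha>(1,2)] upper[OF \<alpha>(1,2)] L
    proof eventually_elim
      case (elim n)
      have pos: "0 < ennreal (c \<alpha> * L n)" using elim(3) \<alpha>(3) by simp
      have "g n \<alpha> \<le> ennreal (c \<alpha> * L n * (d \<alpha> / c \<alpha>))" using elim(2) \<alpha>(3) by (simp add: mult.commute)
      also have "\<dots> = ennreal (c \<alpha> * L n) * ennreal (d \<alpha> / c \<alpha>)"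
        by (rule ennreal_mult) (use elim(3) \<alpha>(3,4) in auto)
      also have "\<dots> \<le> f n \<alpha> * ennreal (d \<alpha> / c \<alpha>)" by (rule mult_right_mono[OF elim(1)]) simp
      finally show ?case by (rule divide_le_posI_ennreal[OF less_le_trans[OF pos elim(1)]])
    qed
  qed
  show "asymp_approx g f" "asymp_approx f (\<lambda>n \<alpha>. ennreal (L n))"
    using fL_ge fL_le gf_ge gf_le by (simp_all add: asymp_approx_def)
qed

theorem corollary1:
  fixes G :: "'a pair_pre_digraph" and k :: nat and v0 :: 'a
    and V :: "nat \<Rightarrow> 'a set" and R :: "nat \<Rightarrow> nat"
    and Q0 Q1 :: "real measure" and M :: "'w measure" and P :: "'a \<Rightarrow> 'w measure"
    and y :: "'a \<Rightarrow> nat \<Rightarrow> 'w \<Rightarrow> real"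
  assumes "k \<ge> 3" and "infinite_regular_tree k G"
    and "v0 \<in> pverts G" and "\<And>n. closest_vertices G v0 n (V n)"
    and "prob_space Q0" and "prob_space Q1"
    and "sets Q0 = sets borel" and "sets Q1 = sets borel"
    and "Q0 \<noteq> Q1" and "absolutely_continuous Q0 Q1" and "absolutely_continuous Q1 Q0"
    and finite_KL: "integrable Q1 (log_deriv Q0 Q1)"
    and "cascade_observations G Q0 Q1 M P y"
    and "\<And>n. R n \<ge> 1" and "(\<lambda>n. real (R n) / ln (real n)) \<longlonglongrightarrow> 0"
  shows "asymp_approx
           (\<lambda>n \<alpha>. worst_expected_time P (V n) (msprt G Q0 Q1 y (V n) (R n) \<alpha>))
           (\<lambda>n \<alpha>. optimal_expected_time G M P y (V n) (R n) \<alpha>)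
       \<and> asymp_approx
           (\<lambda>n \<alpha>. optimal_expected_time G M P y (V n) (R n) \<alpha>)
           (\<lambda>n \<alpha>. ennreal (ln (ln (real n)) / ln (real k - 1)))"
proof -
  have "equivalent_laws Q0 Q1" using assms(5-8,10,11) by (simp add: equivalent_laws_def)
  then have "cascade G k Q0 Q1 M P y"
    using infinite_regular_tree_locale[OF assms(1,2)] assms(9,13)
    by (simp add: cascade_def cascade_axioms_def)
  then interpret cascade G k Q0 Q1 M P y .
  have V: "\<And>n. V n \<subseteq> pverts G" "\<And>n. finite (V n)" "\<And>n. card (V n) = n"
    using assms(4) by (auto simp: closest_vertices_def)
  define L where "L n = ln (ln (real n)) / ln (real k - 1)" for n
  have "filterlim L at_top sequentially"
    unfolding L_def[abs_def] by (rule loglog_at_top) (use assms(1) in simp)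
  then have L: "\<forall>\<^sub>F n in sequentially. 0 < L n" by (simp add: filterlim_at_top_dense)
  \<comment> \<open>The relative errors \<open>\<epsilon>\<close> of both bounds are arbitrary and may be chosen as \<open>\<alpha>\<close>.\<close>
  have lower: "\<forall>\<^sub>F n in sequentially.
      ennreal ((1 - \<alpha>) * (1 - \<alpha> - \<alpha>) * L n) \<le> optimal_expected_time G M P y (V n) (R n) \<alpha>"
    if "0 < \<alpha>" "\<alpha> < 1" for \<alpha>
    unfolding L_def by (rule optimal_asymp_ge[OF finite_KL V assms(15) that that])
  have upper: "\<forall>\<^sub>F n in sequentially.
      worst_expected_time P (V n) (msprt G Q0 Q1 y (V n) (R n) \<alpha>) \<le> ennreal ((1 + \<alpha>) * L n)"
    if "0 < \<alpha>" "\<alpha> < 1" for \<alpha>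
    unfolding L_def by (rule msprt_asymp_le[OF V that(1) that(1)])
  have middle: "\<forall>\<^sub>F n in sequentially. optimal_expected_time G M P y (V n) (R n) \<alpha>
      \<le> worst_expected_time P (V n) (msprt G Q0 Q1 y (V n) (R n) \<alpha>)"
    if "0 < \<alpha>" "\<alpha> < 1" for \<alpha>
    using eventually_gt_at_top[of 0]
  proof eventually_elim
    case (elim n)
    then have "V n \<noteq> {}" using V(3)[of n] by auto
    then show ?case
      unfolding optimal_expected_time_def
      by (intro INF_lower msprt_confidence V that(1))
  qed
  have "((\<lambda>\<alpha>::real. (1 - \<alpha>) * (1 - \<alpha> - \<alpha>)) \<longlongrightarrow> (1 - 0) * (1 - 0 - 0)) (at_right 0)"
    by (intro tendsto_intros)
  then have c: "((\<lambda>\<alpha>::real. (1 - \<alpha>) * (1 - \<alpha> - \<alpha>)) \<longlongrightarrow> 1) (at_right 0)" by simp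
  have "((\<lambda>\<alpha>::real. 1 + \<alpha>) \<longlongrightarrow> 1 + 0) (at_right 0)" by (intro tendsto_intros)
  then have d: "((\<lambda>\<alpha>::real. 1 + \<alpha>) \<longlongrightarrow> 1) (at_right 0)" by simp
  show ?thesis
    using asymp_approx_if_sandwiched[OF L lower middle upper c d] unfolding L_def by simp
qed

end
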